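(* Assume the Markov semigroup $(P_t)$ on the Polish space $(E,\rho)$ is Feller, and that: (1) there exist a measurable $V:E\to[0,\infty)$, a concave differentiable function $\phi:\mathbb R_+\to\mathbb R_+$ increasing to infinity with $\phi(0)=0$, and a constant $K>0$ such that $P_tV(x)\le V(x)-\int_0^tP_s(\phi\circ V)(x)\,ds+Kt$ for all $t\ge0$, $x\in E$; (2) $\rho\wedge1\le\theta$ for a premetric $\theta$; (3) Assumption A holds (with this $\theta$) for some functions $r,L$; (4) there exists $t_0>0$ such that for any $M>0$, Assumption B1 holds for $B=\{V\le M\}$ and $t_0$. Then $(P_t)$ has a unique invariant probability measure $\pi$, and for any $\delta\in(0,1)$ there exist constants $C_1,C_2>0$ such that for all $x\in E$ and $t\ge0$, $$W_{\rho\wedge1}(P_t(x,\cdot),\pi)\le\frac{C_1(1+\phi(V(x))^\delta)}{\phi(H_\phi^{-1}(C_2t))^\delta},$$ where $H_\phi(x):=\int_1^x\frac{du}{\phi(u)}$, $x\ge1$.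
   Context: $(E,\rho)$ is a Polish space with Borel $\sigma$-field $\mathcal E$; $\{P_t\}_{t\ge0}$ is a Markov transition function with semigroup $P_t\phi(x)=\int\phi(y)P_t(x,dy)$ and $\mathbb P_x$ the law of the corresponding Markov process started at $x$. Feller means $P_t$ maps bounded continuous functions to bounded continuous functions. A premetric is a lower semicontinuous $\theta:E\times E\to\mathbb R_+$ with $\theta(x,y)=0\iff x=y$. For a distance-like (symmetric, lower semicontinuous, vanishing exactly on the diagonal) or metric $d$, $W_d(\mu,\nu):=\inf\int d\,d\lambda$ over couplings $\lambda$ of $\mu,\nu$; $d_{TV}(\mu,\nu)=\sup_A|\mu(A)-\nu(A)|$. Assumption A: there exist a non-increasing $r:\mathbb R_+\to\mathbb R_+$ with $r(t)\to0$ and a locally bounded $L:\mathbb R_+\to\mathbb R_+$ such that for any $x,y\in E$ there exist random processes $X^{x,y},Y^{x,y}$ on a common probability space with (1) $\mathrm{Law}(X^{x,y})=\mathbb P_x$ and $d_{TV}(\mathrm{Law}(Y^{x,y}_t),P_t(y,\cdot))\le L(t)\theta(x,y)$, $t\ge0$; (2) $\mathbb E\theta(X^{x,y}_t,Y^{x,y}_t)\le r(t)\theta(x,y)$, $t\ge0$. Assumption B1 (for a set $B$ and $t_0>0$): for any $\varepsilon>0$ there is a measurable $D$ with $\inf_{x\in B}P_{t_0}(x,D)>0$ and $\sup_{x,y\in D}\theta(x,y)\le\varepsilon$. *)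

theory Defs
  imports "HOL-Probability.Probability"
begin

text \<open>The Polish space (E, rho) is a type of class polish_space with rho = dist,
  and its Borel sigma-field is borel.  Time parameter ranges over t >= 0.\<close>

definition markov_tf :: "(real \<Rightarrow> 'a::topological_space \<Rightarrow> 'a measure) \<Rightarrow> bool" where
  "markov_tf P \<longleftrightarrow>
     (\<forall>t\<ge>0. \<forall>x. prob_space (P t x) \<and> sets (P t x) = sets borel) \<and>
     (\<forall>t\<ge>0. \<forall>A\<in>sets borel. (\<lambda>x. emeasure (P t x) A) \<in> borel_measurable borel) \<and>
     (\<forall>x. P 0 x = return borel x) \<and>
     (\<forall>s\<ge>0. \<forall>t\<ge>0. \<forall>x. \<forall>A\<in>sets borel.
        emeasure (P (s + t) x) A = (\<integral>\<^sup>+ y. emeasure (P t y) A \<partial>P s x))"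

definition feller :: "(real \<Rightarrow> 'a::topological_space \<Rightarrow> 'a measure) \<Rightarrow> bool" where
  "feller P \<longleftrightarrow>
     (\<forall>t\<ge>0. \<forall>f::'a \<Rightarrow> real. continuous_on UNIV f \<and> bounded (range f) \<longrightarrow>
        continuous_on UNIV (\<lambda>x. \<integral>y. f y \<partial>P t x) \<and> bounded (range (\<lambda>x. \<integral>y. f y \<partial>P t x)))"

text \<open>Finite-dimensional distributions of the Markov process started at x:
  the list [(h0,A0),(h1,A1),...] stands for the event
  X_{t0} in A0, X_{t1} in A1, ... with t_i = h0 + ... + h_i.\<close>
fun mkv_fdd :: "(real \<Rightarrow> 'a \<Rightarrow> 'a measure) \<Rightarrow> 'a \<Rightarrow> (real \<times> 'a set) list \<Rightarrow> ennreal" where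
  "mkv_fdd P x [] = 1"
| "mkv_fdd P x ((h, A) # rest) = (\<integral>\<^sup>+ y. indicator A y * mkv_fdd P y rest \<partial>P h x)"

text \<open>Law(X) = P_x: the process X on the probability space M is a Markov process
  with transition function P started at x (equality of the laws on the product
  sigma-field over times t >= 0, i.e. equality of all finite-dimensional distributions).\<close>
definition has_markov_law ::
  "(real \<Rightarrow> 'a::topological_space \<Rightarrow> 'a measure) \<Rightarrow> 'a \<Rightarrow> 'w measure \<Rightarrow> (real \<Rightarrow> 'w \<Rightarrow> 'a) \<Rightarrow> bool" where
  "has_markov_law P x M X \<longleftrightarrow>
     prob_space M \<and> (\<forall>t\<ge>0. X t \<in> measurable M borel) \<and>
     (\<forall>l. (\<forall>i<length l. fst (l ! i) \<ge> 0 \<and> snd (l ! i) \<in> sets borel) \<longrightarrow>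
        emeasure M {\<omega>\<in>space M. \<forall>i<length l. X (\<Sum>j\<le>i. fst (l ! j)) \<omega> \<in> snd (l ! i)}
          = mkv_fdd P x l)"

definition premetric :: "('a::topological_space \<Rightarrow> 'a \<Rightarrow> real) \<Rightarrow> bool" where
  "premetric \<theta> \<longleftrightarrow>
     (\<forall>c. open {p::'a \<times> 'a. c < \<theta> (fst p) (snd p)}) \<and>
     (\<forall>x y. \<theta> x y \<ge> 0) \<and> (\<forall>x y. \<theta> x y = 0 \<longleftrightarrow> x = y)"

definition dTV :: "'a measure \<Rightarrow> 'a measure \<Rightarrow> real" where
  "dTV \<mu> \<nu> = (SUP A\<in>sets \<mu>. \<bar>measure \<mu> A - measure \<nu> A\<bar>)"

definition couplings :: "'a::topological_space measure \<Rightarrow> 'a measure \<Rightarrow> ('a \<times> 'a) measure set" where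
  "couplings \<mu> \<nu> = {c. sets c = sets (borel \<Otimes>\<^sub>M borel) \<and> prob_space c \<and>
      distr c borel fst = \<mu> \<and> distr c borel snd = \<nu>}"

definition wasserstein :: "('a::topological_space \<Rightarrow> 'a \<Rightarrow> real) \<Rightarrow> 'a measure \<Rightarrow> 'a measure \<Rightarrow> ennreal" where
  "wasserstein d \<mu> \<nu> = (INF c\<in>couplings \<mu> \<nu>. \<integral>\<^sup>+ z. ennreal (d (fst z) (snd z)) \<partial>c)"

definition invariant_prob :: "(real \<Rightarrow> 'a::topological_space \<Rightarrow> 'a measure) \<Rightarrow> 'a measure \<Rightarrow> bool" where
  "invariant_prob P \<pi> \<longleftrightarrow> prob_space \<pi> \<and> sets \<pi> = sets borel \<and>
     (\<forall>t\<ge>0. \<forall>A\<in>sets borel. (\<integral>\<^sup>+ x. emeasure (P t x) A \<partial>\<pi>) = emeasure \<pi> A)"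

definition assumption_A ::
  "'w itself \<Rightarrow> (real \<Rightarrow> 'a::topological_space \<Rightarrow> 'a measure) \<Rightarrow> ('a \<Rightarrow> 'a \<Rightarrow> real)
     \<Rightarrow> (real \<Rightarrow> real) \<Rightarrow> (real \<Rightarrow> real) \<Rightarrow> bool" where
  "assumption_A (_::'w itself) P \<theta> r L \<longleftrightarrow>
     (\<forall>s\<ge>0. r s \<ge> 0) \<and> antimono_on {0..} r \<and> (r \<longlongrightarrow> 0) at_top \<and>
     (\<forall>s\<ge>0. L s \<ge> 0) \<and> (\<forall>T\<ge>0. bounded (L ` {0..T})) \<and>
     (\<forall>x y. \<exists>(M::'w measure) X Y.
        has_markov_law P x M X \<and> (\<forall>t\<ge>0. Y t \<in> measurable M borel) \<and>
        (\<forall>t\<ge>0. dTV (distr M borel (Y t)) (P t y) \<le> L t * \<theta> x y) \<and>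
        (\<forall>t\<ge>0. (\<integral>\<^sup>+ \<omega>. ennreal (\<theta> (X t \<omega>) (Y t \<omega>)) \<partial>M) \<le> ennreal (r t * \<theta> x y)))"

definition assumption_B1 ::
  "(real \<Rightarrow> 'a::topological_space \<Rightarrow> 'a measure) \<Rightarrow> ('a \<Rightarrow> 'a \<Rightarrow> real) \<Rightarrow> 'a set \<Rightarrow> real \<Rightarrow> bool" where
  "assumption_B1 P \<theta> B t0 \<longleftrightarrow>
     (\<forall>\<epsilon>>0. \<exists>D\<in>sets borel. (\<exists>c>0. \<forall>x\<in>B. measure (P t0 x) D \<ge> c) \<and>
        (\<forall>x\<in>D. \<forall>y\<in>D. \<theta> x y \<le> \<epsilon>))"

definition H_phi :: "(real \<Rightarrow> real) \<Rightarrow> real \<Rightarrow> real" where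
  "H_phi \<phi> x = integral {1..x} (\<lambda>u. 1 / \<phi> u)"

definition H_phi_inv :: "(real \<Rightarrow> real) \<Rightarrow> real \<Rightarrow> real" where
  "H_phi_inv \<phi> s = (THE y. y \<ge> 1 \<and> H_phi \<phi> y = s)"

end

theory Submission
  imports Defs
begin

text \<open>
  Everything is done on the dual side: for a function f that is 1-Lipschitz for min(dist, 1) we
  bound the oscillation of P_t f, which needs couplings of P_t(x, .) and P_t(y, .) only for fixed
  x, y and hence no measurable selection. Kantorovich duality then returns to the Wasserstein
  distance.

  With h = t0 + T for a large T and d = min(1, N theta) for a large N, Assumption A contracts d
  on pairs with d < 1, and B1 contracts it on pairs in a sublevel set of the Lyapunov function v.
  By Hoelder's inequality the oscillation bounds |f x - f y| <= d(x, y)^(1-q) (J x + J y)^q are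
  propagated by P_h, for weights J = b^n w(v) + (1/2 + beta v)/(beta s) truncated at a level s:
  the first summand decays geometrically at a rate proportional to phi'(s) as long as v stays
  below s, because w(u) = exp(l H(u)) is concave on [1, s] when l is at most phi'(s); the second
  summand exceeds 1 as soon as v exceeds s.
  Choosing phi(s) = phi(v)^(1-q) phi(R)^q with H(R) proportional to the time and using
  phi'(s) (H(R) - H(s)) >= ln (phi(R) / phi(s)) makes both summands at most a constant times
  (phi(v) / phi(R))^q, which is the claimed rate with delta = q^2.

  The skeleton chain with kernel P_h satisfies E v(X_1) <= v(x) - eta phi(v(x)) + const. Summing this
  drift, the moment of phi(v) stays below a fixed bound at infinitely many times; integrating its
  truncation against an invariant law bounds the moment there too, whence uniqueness. Along times
  whose successive differences are such good times, the laws of the chain are Cauchy for the dual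
  distance, and the transport kernels between successive laws glue, by the Ionescu-Tulcea theorem,
  to an almost surely convergent sequence of random points, whose limit law is invariant.
\<close>

section \<open>Optimal transport on finite sets\<close>

lemma compact_function_box: "compact {p :: 'b \<Rightarrow> real. \<forall>z. a \<le> p z \<and> p z \<le> b}"
proof -
  have "{p :: 'b \<Rightarrow> real. \<forall>z. a \<le> p z \<and> p z \<le> b} = PiE UNIV (\<lambda>_. {a..b})"
    by (auto simp: PiE_iff)
  moreover have "compactin (product_topology (\<lambda>_::'b. euclidean) UNIV) (PiE UNIV (\<lambda>_. {a..b}))"
    by (subst compactin_PiE) auto
  ultimately show ?thesis
    by (simp add: euclidean_product_topology flip: compactin_euclidean_iff)
qed

lemma linear_coeff_nonneg:
  fixes \<alpha> \<gamma> b :: real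
  assumes "0 < b" "0 < \<gamma>" and quadratic: "\<And>e. 0 < e \<Longrightarrow> e \<le> b \<Longrightarrow> 0 \<le> e * \<alpha> + \<gamma> * e\<^sup>2"
  shows "0 \<le> \<alpha>"
proof (rule ccontr)
  assume "\<not> 0 \<le> \<alpha>"
  define e where "e = min b (- \<alpha> / (2 * \<gamma>))"
  have e_bounds: "0 < e" "e \<le> b" "\<gamma> * e \<le> - \<alpha> / 2"
    using \<open>\<not> 0 \<le> \<alpha>\<close> assms(1,2) by (auto simp: e_def min_def field_simps)
  then have "0 \<le> e * (\<alpha> + \<gamma> * e)"
    using quadratic[of e] by (simp add: power2_eq_square algebra_simps)
  then show False
    using e_bounds \<open>\<not> 0 \<le> \<alpha>\<close> by (simp add: zero_le_mult_iff)
qed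

locale finite_transport =
  fixes I :: "'a set" and c :: "'a \<Rightarrow> 'a \<Rightarrow> real" and m k :: "'a \<Rightarrow> real"
  assumes finite_I: "finite I"
    and m_nonneg: "\<And>x. x \<in> I \<Longrightarrow> 0 \<le> m x" and sum_m: "sum m I = 1"
    and k_nonneg: "\<And>x. x \<in> I \<Longrightarrow> 0 \<le> k x" and sum_k: "sum k I = 1"
    and c_nonneg: "\<And>x y. 0 \<le> c x y" and c_self: "\<And>x. c x x = 0"
    and c_triangle: "\<And>x y z. c x z \<le> c x y + c y z"
begin

definition row :: "('a \<times> 'a \<Rightarrow> real) \<Rightarrow> 'a \<Rightarrow> real" where
  "row p x = (\<Sum>y\<in>I. p (x, y))"

definition col :: "('a \<times> 'a \<Rightarrow> real) \<Rightarrow> 'a \<Rightarrow> real" where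
  "col p y = (\<Sum>x\<in>I. p (x, y))"

definition cost :: "('a \<times> 'a \<Rightarrow> real) \<Rightarrow> real" where
  "cost p = (\<Sum>x\<in>I. \<Sum>y\<in>I. p (x, y) * c x y)"

definition defect :: "('a \<times> 'a \<Rightarrow> real) \<Rightarrow> real" where
  "defect p = (\<Sum>x\<in>I. (row p x - m x)\<^sup>2) + (\<Sum>y\<in>I. (col p y - k y)\<^sup>2)"

definition penalised_cost :: "real \<Rightarrow> ('a \<times> 'a \<Rightarrow> real) \<Rightarrow> real" where
  "penalised_cost \<tau> p = cost p + defect p / (2 * \<tau>)"

definition plans :: "('a \<times> 'a \<Rightarrow> real) set" where
  "plans = {p. \<forall>z. 0 \<le> p z \<and> p z \<le> 4}"

definition total_cost :: real where
  "total_cost = (\<Sum>x\<in>I. \<Sum>y\<in>I. c x y)"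

lemma compact_plans: "compact plans" and plans_nonempty: "plans \<noteq> {}"
  unfolding plans_def by (rule compact_function_box) (auto intro!: exI[of _ "\<lambda>_. 0"])

lemma continuous_on_cost: "continuous_on A cost"
  and continuous_on_defect: "continuous_on A defect"
  unfolding cost_def defect_def row_def col_def
  by (intro continuous_intros continuous_on_subset[OF continuous_on_product_coordinates]
      subset_UNIV)+

lemma m_le_1: "x \<in> I \<Longrightarrow> m x \<le> 1" and k_le_1: "x \<in> I \<Longrightarrow> k x \<le> 1"
  using member_le_sum[of x I m] member_le_sum[of x I k] m_nonneg k_nonneg sum_m sum_k finite_I
  by auto

lemma cost_nonneg: "p \<in> plans \<Longrightarrow> 0 \<le> cost p"
  unfolding cost_def plans_def by (auto intro!: sum_nonneg mult_nonneg_nonneg c_nonneg)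

lemma row_defect_le: "x \<in> I \<Longrightarrow> (row p x - m x)\<^sup>2 \<le> defect p"
  and col_defect_le: "x \<in> I \<Longrightarrow> (col p x - k x)\<^sup>2 \<le> defect p"
proof -
  have nonneg: "0 \<le> (\<Sum>x\<in>I. (row p x - m x)\<^sup>2)" "0 \<le> (\<Sum>x\<in>I. (col p x - k x)\<^sup>2)"
    by (auto intro!: sum_nonneg)
  show "(row p x - m x)\<^sup>2 \<le> defect p" if "x \<in> I"
    using member_le_sum[of x I "\<lambda>x. (row p x - m x)\<^sup>2"] that finite_I nonneg
    by (simp add: defect_def)
  show "(col p x - k x)\<^sup>2 \<le> defect p" if "x \<in> I"
    using member_le_sum[of x I "\<lambda>x. (col p x - k x)\<^sup>2"] that finite_I nonneg
    by (simp add: defect_def)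
qed

lemma defect_nonneg: "0 \<le> defect p"
  unfolding defect_def by (auto intro!: sum_nonneg add_nonneg_nonneg)

lemma defect_eq_0_iff: "defect p = 0 \<longleftrightarrow> (\<forall>x\<in>I. row p x = m x \<and> col p x = k x)"
  unfolding defect_def using finite_I
  by (auto simp: add_nonneg_eq_0_iff sum_nonneg sum_nonneg_eq_0_iff)

lemma product_plan_penalised_cost:
  "\<exists>p\<in>plans. \<forall>\<tau>. penalised_cost \<tau> p \<le> total_cost"
proof
  define p where "p z = (if z \<in> I \<times> I then m (fst z) * k (snd z) else 0)" for z
  have p_le_1: "m x * k y \<le> 1" if "x \<in> I" "y \<in> I" for x y
    using that mult_mono[OF m_le_1 k_le_1, of x y] k_nonneg by simp
  show "p \<in> plans"
    unfolding plans_def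
    by (auto simp: p_def intro!: mult_nonneg_nonneg m_nonneg k_nonneg order_trans[OF p_le_1])
  have "row p x = m x" "col p x = k x" if "x \<in> I" for x
    using that sum_m sum_k
    by (simp_all add: row_def col_def p_def flip: sum_distrib_left sum_distrib_right)
  then have "defect p = 0"
    by (simp add: defect_eq_0_iff)
  moreover have "cost p \<le> total_cost"
    unfolding cost_def total_cost_def
    by (intro sum_mono)
      (auto simp: p_def intro!: mult_left_le_one_le mult_nonneg_nonneg c_nonneg m_nonneg k_nonneg p_le_1)
  ultimately show "\<forall>\<tau>. penalised_cost \<tau> p \<le> total_cost"
    by (simp add: penalised_cost_def)
qed

definition reduced_cost :: "real \<Rightarrow> ('a \<times> 'a \<Rightarrow> real) \<Rightarrow> 'a \<Rightarrow> 'a \<Rightarrow> real" where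
  "reduced_cost \<tau> p a b = c a b + (row p a - m a) / \<tau> + (col p b - k b) / \<tau>"

lemma penalised_cost_update:
  assumes indices: "a \<in> I" "b \<in> I" and "0 < \<tau>"
  shows "penalised_cost \<tau> (p((a, b) := p (a, b) + e)) =
    penalised_cost \<tau> p + (e * reduced_cost \<tau> p a b + (1 / \<tau>) * e\<^sup>2)"
proof -
  define p' where "p' = p((a, b) := p (a, b) + e)"
  have p'_apply: "p' (x, y) = p (x, y) + (if x = a then if y = b then e else 0 else 0)" for x y
    by (auto simp: p'_def)
  have "(row p' x - m x)\<^sup>2
      = (row p x - m x)\<^sup>2 + (if x = a then 2 * e * (row p a - m a) + e\<^sup>2 else 0)"
    for x
    using indices finite_I
    by (auto simp: row_def p'_apply sum.distrib power2_eq_square algebra_simps)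
  moreover have "(col p' x - k x)\<^sup>2
      = (col p x - k x)\<^sup>2 + (if x = b then 2 * e * (col p b - k b) + e\<^sup>2 else 0)"
    for x
    using indices finite_I
    by (auto simp: col_def p'_apply sum.distrib power2_eq_square algebra_simps)
  ultimately have defect: "defect p'
      = defect p + (2 * e * (row p a - m a) + e\<^sup>2 + (2 * e * (col p b - k b) + e\<^sup>2))"
    using indices finite_I by (simp add: defect_def sum.distrib)
  have "cost p' = (\<Sum>x\<in>I. \<Sum>y\<in>I. p (x, y) * c x y + (if x = a then if y = b then e * c a b else 0 else 0))"
    unfolding cost_def by (intro sum.cong refl) (auto simp: p'_apply algebra_simps)
  also have "\<dots> = cost p + (\<Sum>x\<in>I. \<Sum>y\<in>I. if x = a then if y = b then e * c a b else 0 else 0)"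
    by (simp add: cost_def sum.distrib)
  also have "(\<Sum>x\<in>I. \<Sum>y\<in>I. if x = a then if y = b then e * c a b else 0 else 0)
      = (\<Sum>x\<in>I. if x = a then e * c a b else 0)"
    using indices finite_I by (intro sum.cong) auto
  finally have cost: "cost p' = cost p + e * c a b"
    using indices finite_I by simp
  show ?thesis
    unfolding penalised_cost_def p'_def[symmetric] defect cost reduced_cost_def
    using \<open>0 < \<tau>\<close> by (simp add: field_simps)
qed

context
  fixes \<tau> :: real and p :: "'a \<times> 'a \<Rightarrow> real"
  assumes \<tau>: "0 < \<tau>" "\<tau> * total_cost \<le> 1"
    and p: "p \<in> plans" and minimal: "\<And>p'. p' \<in> plans \<Longrightarrow> penalised_cost \<tau> p \<le> penalised_cost \<tau> p'"
begin

lemma minimiser_defect_le: "defect p \<le> 2 * \<tau> * total_cost"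
proof -
  have "penalised_cost \<tau> p \<le> total_cost"
    using product_plan_penalised_cost minimal by (meson order_trans)
  then have "defect p / (2 * \<tau>) \<le> total_cost"
    using cost_nonneg[OF p] by (simp add: penalised_cost_def)
  then show ?thesis
    using \<tau> by (simp add: field_simps)
qed

text \<open>The minimiser stays away from the upper faces of the box, so that the box does not
  interfere with the first-order conditions.\<close>

lemma minimiser_le_3:
  assumes "a \<in> I" "b \<in> I"
  shows "p (a, b) \<le> 3"
proof -
  have "p (a, b) \<le> row p a"
    unfolding row_def using assms finite_I p by (intro member_le_sum) (auto simp: plans_def)
  moreover have "(row p a - m a)\<^sup>2 \<le> 2\<^sup>2"
    using row_defect_le[OF assms(1), of p] minimiser_defect_le \<tau>(2) by simp
  then have "row p a - m a \<le> 2"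
    by (rule power2_le_imp_le) simp
  ultimately show ?thesis
    using m_le_1[OF assms(1)] by simp
qed

lemma minimiser_reduced_cost_nonneg:
  assumes "a \<in> I" "b \<in> I"
  shows "0 \<le> reduced_cost \<tau> p a b"
proof (rule linear_coeff_nonneg)
  show "0 \<le> e * reduced_cost \<tau> p a b + (1 / \<tau>) * e\<^sup>2" if e_bounds: "0 < e" "e \<le> 1" for e
  proof -
    have "p((a, b) := p (a, b) + e) \<in> plans"
      using p e_bounds minimiser_le_3[OF assms] by (auto simp: plans_def)
    from minimal[OF this] show ?thesis
      using penalised_cost_update[OF assms \<tau>(1), of p e] by simp
  qed
qed (use \<tau>(1) in auto)

lemma minimiser_complementary_slackness:
  assumes "a \<in> I" "b \<in> I"
  shows "p (a, b) * reduced_cost \<tau> p a b = 0"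
proof (cases "p (a, b) = 0")
  case False
  have "0 \<le> - reduced_cost \<tau> p a b"
  proof (rule linear_coeff_nonneg)
    show "0 < p (a, b)"
      using False p by (auto simp: plans_def less_le)
    show "0 \<le> e * - reduced_cost \<tau> p a b + (1 / \<tau>) * e\<^sup>2" if e_bounds: "0 < e" "e \<le> p (a, b)" for e
    proof -
      have "p((a, b) := p (a, b) + - e) \<in> plans"
        using p e_bounds minimiser_le_3[OF assms] by (auto simp: plans_def)
      from minimal[OF this] show ?thesis
        using penalised_cost_update[OF assms \<tau>(1), of p "- e"] by simp
    qed
  qed (use \<tau>(1) in auto)
  with minimiser_reduced_cost_nonneg[OF assms] show ?thesis
    by simp
qed simp

text \<open>Up to the factor \<open>-1 / \<tau>\<close>, the marginal defects of the minimiser are dual potentials.\<close>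

lemma minimiser_potential:
  obtains f where "\<And>x y. f x - f y \<le> c x y"
    "\<And>x. x \<in> I \<Longrightarrow> (m x - row p x) / \<tau> \<le> f x" "\<And>x. x \<in> I \<Longrightarrow> f x \<le> (col p x - k x) / \<tau>"
proof -
  define v where "v x = (k x - col p x) / \<tau>" for x
  define f where "f x = Min ((\<lambda>y. c x y - v y) ` I)" for x
  have f_le: "f x \<le> c x y - v y" if "y \<in> I" for x y
    unfolding f_def using that finite_I by (intro Min_le) auto
  have f_attained: "\<exists>y\<in>I. f x = c x y - v y" for x
  proof -
    have "I \<noteq> {}"
      using sum_m by auto
    then have "f x \<in> (\<lambda>y. c x y - v y) ` I"
      unfolding f_def using finite_I by (intro Min_in) auto
    then show ?thesis
      by auto
  qed
  show thesis
  proof (rule that)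
    fix x y
    obtain z where "z \<in> I" "f y = c y z - v z"
      using f_attained by blast
    then show "f x - f y \<le> c x y"
      using f_le[of z x] c_triangle[of x z y] by simp
  next
    fix x assume x_in_I: "x \<in> I"
    obtain y where "y \<in> I" "f x = c x y - v y"
      using f_attained by blast
    then show "(m x - row p x) / \<tau> \<le> f x"
      using minimiser_reduced_cost_nonneg[OF x_in_I, of y]
      by (simp add: reduced_cost_def v_def diff_divide_distrib)
    show "f x \<le> (col p x - k x) / \<tau>"
      using f_le[OF x_in_I, of x] c_self by (simp add: v_def diff_divide_distrib)
  qed
qed

lemma minimiser_cost_le_dual:
  assumes dual: "\<And>f. (\<And>x y. f x - f y \<le> c x y) \<Longrightarrow> (\<Sum>x\<in>I. f x * (m x - k x)) \<le> D"
  shows "cost p \<le> D"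
proof -
  define u where "u x = (m x - row p x) / \<tau>" for x
  define v where "v x = (k x - col p x) / \<tau>" for x
  obtain f where potential: "\<And>x y. f x - f y \<le> c x y" and u_le: "\<And>x. x \<in> I \<Longrightarrow> u x \<le> f x"
    and v_le: "\<And>x. x \<in> I \<Longrightarrow> v x \<le> - f x"
    using minimiser_potential unfolding u_def v_def
    by (metis minus_diff_eq minus_divide_left neg_le_iff_le)
  have "c x y = reduced_cost \<tau> p x y + (u x + v y)" for x y
    by (simp add: reduced_cost_def u_def v_def diff_divide_distrib)
  then have "p (x, y) * c x y = p (x, y) * u x + p (x, y) * v y" if "x \<in> I" "y \<in> I" for x y
    using minimiser_complementary_slackness[OF that] by (simp add: distrib_left)
  then have "cost p = (\<Sum>x\<in>I. \<Sum>y\<in>I. p (x, y) * u x + p (x, y) * v y)"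
    unfolding cost_def by (intro sum.cong refl)
  also have "\<dots> = (\<Sum>x\<in>I. row p x * u x) + (\<Sum>y\<in>I. col p y * v y)"
    unfolding sum.distrib row_def col_def sum_distrib_right by (subst (2) sum.swap) simp
  also have "\<dots> \<le> (\<Sum>x\<in>I. m x * u x) + (\<Sum>y\<in>I. k y * v y)"
  proof (intro add_mono sum_mono)
    have m_eq: "m x = row p x + \<tau> * u x" and k_eq: "k x = col p x + \<tau> * v x" for x
      using \<tau>(1) by (auto simp: u_def v_def)
    show "row p x * u x \<le> m x * u x" "col p x * v x \<le> k x * v x" for x
      unfolding m_eq k_eq using \<tau>(1) by (auto simp: distrib_right mult.assoc)
  qed
  also have "\<dots> \<le> (\<Sum>x\<in>I. m x * f x) + (\<Sum>y\<in>I. k y * - f y)"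
    by (intro add_mono sum_mono mult_left_mono u_le v_le m_nonneg k_nonneg)
  also have "\<dots> = (\<Sum>x\<in>I. f x * (m x - k x))"
    by (simp add: algebra_simps sum_negf sum_subtractf)
  also have "\<dots> \<le> D"
    by (intro dual potential)
  finally show ?thesis .
qed

end

lemma approximate_plan:
  assumes dual: "\<And>f. (\<And>x y. f x - f y \<le> c x y) \<Longrightarrow> (\<Sum>x\<in>I. f x * (m x - k x)) \<le> D"
    and "0 < e"
  shows "\<exists>p\<in>plans. defect p \<le> e \<and> cost p \<le> D"
proof -
  have "0 \<le> total_cost"
    unfolding total_cost_def by (intro sum_nonneg c_nonneg)
  define \<tau> where "\<tau> = min 1 (e / 2) / (total_cost + 1)"
  have "0 < \<tau>" "\<tau> * (total_cost + 1) = min 1 (e / 2)"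
    using \<open>0 \<le> total_cost\<close> \<open>0 < e\<close> by (auto simp: \<tau>_def)
  then have "0 < \<tau>" "\<tau> * total_cost \<le> min 1 (e / 2)"
    by (auto simp: distrib_left)
  then have \<tau>_bounds: "0 < \<tau>" "\<tau> * total_cost \<le> 1" "2 * \<tau> * total_cost \<le> e"
    by auto
  obtain p where "p \<in> plans" and "\<And>p'. p' \<in> plans \<Longrightarrow> penalised_cost \<tau> p \<le> penalised_cost \<tau> p'"
    using continuous_attains_inf[OF compact_plans plans_nonempty, of "penalised_cost \<tau>"] \<tau>_bounds(1)
    unfolding penalised_cost_def
    by (force intro: continuous_intros continuous_on_cost continuous_on_defect)
  with minimiser_defect_le[OF \<tau>_bounds(1,2)] minimiser_cost_le_dual[OF \<tau>_bounds(1,2) _ _ dual] \<tau>_bounds(3)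
  show ?thesis
    by (meson order_trans)
qed

theorem duality:
  assumes dual: "\<And>f. (\<And>x y. f x - f y \<le> c x y) \<Longrightarrow> (\<Sum>x\<in>I. f x * (m x - k x)) \<le> D"
  shows "\<exists>p. (\<forall>z. 0 \<le> p z) \<and> (\<forall>x\<in>I. row p x = m x \<and> col p x = k x) \<and> cost p \<le> D"
proof -
  define G where "G p = defect p + max 0 (cost p - D)" for p
  have "continuous_on plans G"
    unfolding G_def by (intro continuous_intros continuous_on_cost continuous_on_defect)
  then obtain p where p_in_plans: "p \<in> plans" and minimal: "\<And>p'. p' \<in> plans \<Longrightarrow> G p \<le> G p'"
    using continuous_attains_inf[OF compact_plans plans_nonempty] by blast
  have "G p \<le> 0 + e" if "0 < e" for e
    using approximate_plan[OF dual that] minimal by (fastforce simp: G_def)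
  then have "G p \<le> 0"
    by (rule field_le_epsilon)
  then have "defect p = 0" "cost p \<le> D"
    using defect_nonneg[of p] by (auto simp: G_def)
  with p_in_plans show ?thesis
    by (auto simp: defect_eq_0_iff plans_def)
qed

end

section \<open>Borel probability measures and the truncated distance\<close>

locale borel_prob_space = prob_space \<mu> for \<mu> :: "'a::topological_space measure" +
  assumes sets_eq_borel [simp, measurable_cong]: "sets \<mu> = sets borel"
begin

lemma space_eq_UNIV [simp]: "space \<mu> = UNIV"
  using sets_eq_imp_space_eq[OF sets_eq_borel] by simp

lemma emeasure_UNIV [simp]: "emeasure \<mu> UNIV = 1"
  using emeasure_space_1 by simp

lemma prob_UNIV [simp]: "prob UNIV = 1"
  using prob_space by simp

lemma in_prob_algebra: "\<mu> \<in> space (prob_algebra borel)"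
  by (simp add: space_prob_algebra prob_space_axioms)

lemma measurable_iff_borel: "f \<in> \<mu> \<rightarrow>\<^sub>M N \<longleftrightarrow> f \<in> borel \<rightarrow>\<^sub>M N"
  by (simp cong: measurable_cong_sets)

lemma prob_algebra_eq_borel: "prob_algebra \<mu> = prob_algebra borel"
  by (simp add: prob_algebra_def subprob_algebra_cong[OF sets_eq_borel])

lemma integrable_bounded:
  fixes f :: "'a \<Rightarrow> real"
  assumes "f \<in> borel_measurable borel" "\<And>x. \<bar>f x\<bar> \<le> B"
  shows "integrable \<mu> f"
  using assms by (intro integrable_const_bound[where B=B]) (auto simp: measurable_iff_borel)

lemma abs_integral_le:
  fixes f :: "'a \<Rightarrow> real"
  assumes "f \<in> borel_measurable borel" "\<And>x. \<bar>f x\<bar> \<le> B"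
  shows "\<bar>\<integral>x. f x \<partial>\<mu>\<bar> \<le> B"
proof -
  have "\<bar>\<integral>x. f x \<partial>\<mu>\<bar> \<le> (\<integral>x. \<bar>f x\<bar> \<partial>\<mu>)"
    by (rule integral_abs_bound)
  also have "\<dots> \<le> (\<integral>x. B \<partial>\<mu>)"
    using assms integrable_bounded[OF assms] by (intro integral_mono) auto
  finally show ?thesis
    by simp
qed

end

lemma borel_prob_space_iff: "borel_prob_space \<mu> \<longleftrightarrow> prob_space \<mu> \<and> sets \<mu> = sets borel"
  by (auto simp: borel_prob_space_def borel_prob_space_axioms_def)

lemma borel_prob_space_kernel:
  "\<kappa> \<in> M \<rightarrow>\<^sub>M prob_algebra borel \<Longrightarrow> x \<in> space M \<Longrightarrow> borel_prob_space (\<kappa> x)"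
  by (auto dest: measurable_space simp: space_prob_algebra borel_prob_space_iff)

lemma (in prob_space) borel_prob_space_bind:
  assumes "\<kappa> \<in> M \<rightarrow>\<^sub>M prob_algebra borel"
  shows "borel_prob_space (M \<bind> \<kappa>)"
proof -
  have "M \<in> space (prob_algebra M)"
    by (simp add: space_prob_algebra prob_space_axioms)
  then show ?thesis
    unfolding borel_prob_space_iff using assms by (intro conjI prob_space_bind' sets_bind')
qed

lemma bind_density_kernel:
  fixes g :: "'a \<times> 'b \<Rightarrow> ennreal"
  assumes "prob_space \<mu>" "prob_space \<nu>" and g_meas [measurable]: "g \<in> borel_measurable (\<mu> \<Otimes>\<^sub>M \<nu>)"
    and left: "\<And>x. x \<in> space \<mu> \<Longrightarrow> (\<integral>\<^sup>+y. g (x, y) \<partial>\<nu>) = 1"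
    and right: "AE y in \<nu>. (\<integral>\<^sup>+x. g (x, y) \<partial>\<mu>) = 1"
  shows "(\<lambda>x. density \<nu> (\<lambda>y. g (x, y))) \<in> \<mu> \<rightarrow>\<^sub>M prob_algebra \<nu>"
    and "\<mu> \<bind> (\<lambda>x. density \<nu> (\<lambda>y. g (x, y))) = \<nu>"
proof -
  interpret \<mu>: prob_space \<mu> by fact
  interpret \<nu>: prob_space \<nu> by fact
  interpret pair_prob_space \<mu> \<nu> ..
  let ?\<kappa> = "\<lambda>x. density \<nu> (\<lambda>y. g (x, y))"
  have emeasure_\<kappa>: "emeasure (?\<kappa> x) A = (\<integral>\<^sup>+y. g (x, y) * indicator A y \<partial>\<nu>)"
    if "x \<in> space \<mu>" "A \<in> sets \<nu>" for x A
    using that by (intro emeasure_density) auto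
  have prob: "prob_space (?\<kappa> x)" if "x \<in> space \<mu>" for x
    using that left by (intro prob_spaceI) (simp add: emeasure_\<kappa> cong: nn_integral_cong)
  show kernel: "?\<kappa> \<in> \<mu> \<rightarrow>\<^sub>M prob_algebra \<nu>"
  proof (intro measurable_prob_algebraI measurable_subprob_algebra prob)
    fix A assume [measurable]: "A \<in> sets \<nu>"
    show "(\<lambda>x. emeasure (?\<kappa> x) A) \<in> borel_measurable \<mu>"
      by (subst measurable_cong[OF emeasure_\<kappa>]) measurable
  qed (auto intro: prob_space_imp_subprob_space prob)
  show "\<mu> \<bind> ?\<kappa> = \<nu>"
  proof (rule measure_eqI)
    show sets: "sets (\<mu> \<bind> ?\<kappa>) = sets \<nu>"
      using kernel by (intro sets_bind) (auto simp: \<mu>.not_empty)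
    fix A assume "A \<in> sets (\<mu> \<bind> ?\<kappa>)"
    then have A_sets [measurable]: "A \<in> sets \<nu>"
      by (simp only: sets)
    have "emeasure (\<mu> \<bind> ?\<kappa>) A = (\<integral>\<^sup>+x. emeasure (?\<kappa> x) A \<partial>\<mu>)"
      using A_sets \<mu>.not_empty measurable_prob_algebraD[OF kernel]
      by (intro emeasure_bind[where N=\<nu>]) auto
    also have "\<dots> = (\<integral>\<^sup>+x. \<integral>\<^sup>+y. g (x, y) * indicator A y \<partial>\<nu> \<partial>\<mu>)"
      by (intro nn_integral_cong emeasure_\<kappa> A_sets)
    also have "\<dots> = (\<integral>\<^sup>+y. (\<integral>\<^sup>+x. g (x, y) * indicator A y \<partial>\<mu>) \<partial>\<nu>)"
      by (rule Fubini'[symmetric]) (simp add: split_beta')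
    also have "\<dots> = (\<integral>\<^sup>+y. (\<integral>\<^sup>+x. g (x, y) \<partial>\<mu>) * indicator A y \<partial>\<nu>)"
      by (intro nn_integral_cong nn_integral_multc) measurable
    also have "\<dots> = (\<integral>\<^sup>+y. indicator A y \<partial>\<nu>)"
      by (rule nn_integral_cong_AE) (use right in eventually_elim, simp)
    finally show "emeasure (\<mu> \<bind> ?\<kappa>) A = emeasure \<nu> A"
      by simp
  qed
qed

definition bdist :: "'a::metric_space \<Rightarrow> 'a \<Rightarrow> real" where
  "bdist x y = min (dist x y) 1"

definition bLip :: "('a::metric_space \<Rightarrow> real) \<Rightarrow> bool" where
  "bLip f \<longleftrightarrow> (\<forall>x y. f x - f y \<le> bdist x y)"

lemma bdist_nonneg [simp]: "0 \<le> bdist x y" and bdist_le_1 [simp]: "bdist x y \<le> 1"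
  and bdist_self [simp]: "bdist x x = 0" and bdist_commute: "bdist x y = bdist y x"
  by (auto simp: bdist_def dist_commute)

lemma bdist_triangle: "bdist x z \<le> bdist x y + bdist y z"
  using dist_triangle[of x z y] zero_le_dist[of x y] zero_le_dist[of y z] unfolding bdist_def
  by linarith

lemma bdist_measurable [measurable]:
  "f \<in> M \<rightarrow>\<^sub>M borel \<Longrightarrow> g \<in> M \<rightarrow>\<^sub>M borel \<Longrightarrow>
    (\<lambda>x. bdist (f x) (g x :: 'a::{second_countable_topology, metric_space})) \<in> borel_measurable M"
  unfolding bdist_def by measurable

lemma bLip_0: "bLip (\<lambda>_. 0)"
  by (simp add: bLip_def)

lemma bLip_abs_diff_le: "bLip f \<Longrightarrow> \<bar>f x - f y\<bar> \<le> bdist x y"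
  unfolding bLip_def by (metis abs_le_iff bdist_commute minus_diff_eq)

lemma bLip_osc_le_1: "bLip f \<Longrightarrow> \<bar>f x - f y\<bar> \<le> 1"
  using bLip_abs_diff_le bdist_le_1 order_trans by blast

lemma bLip_continuous:
  assumes "bLip f"
  shows "continuous_on UNIV f"
proof (rule lipschitz_on_continuous_on)
  show "1-lipschitz_on UNIV f"
    by (rule lipschitz_onI) (use bLip_abs_diff_le[OF assms] in \<open>auto simp: dist_real_def bdist_def\<close>)
qed

lemma bLip_measurable [measurable_dest]: "bLip f \<Longrightarrow> f \<in> borel_measurable borel"
  by (intro borel_measurable_continuous_onI bLip_continuous)

lemma bLip_abs_le: "bLip f \<Longrightarrow> \<bar>f x\<bar> \<le> \<bar>f undefined\<bar> + 1"
  using bLip_osc_le_1[of f x undefined] by linarith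

lemma bLip_bounded: "bLip f \<Longrightarrow> bounded (range f)"
  using bLip_abs_le by (auto simp: bounded_iff)

lemma integrable_bLip: "borel_prob_space \<mu> \<Longrightarrow> bLip f \<Longrightarrow> integrable \<mu> f"
  by (rule borel_prob_space.integrable_bounded[OF _ bLip_measurable bLip_abs_le])

section \<open>Kantorovich duality for the truncated distance\<close>

lemma simple_function_approximation:
  obtains F :: "nat \<Rightarrow> 'a \<Rightarrow> 'a::{second_countable_topology, metric_space}"
  where "\<And>i. simple_function borel (F i)"
    "\<And>\<mu>. borel_prob_space \<mu> \<Longrightarrow> (\<lambda>i. \<integral>x. bdist x (F i x) \<partial>\<mu>) \<longlonglongrightarrow> 0"
proof -
  obtain F :: "nat \<Rightarrow> 'a \<Rightarrow> 'a" where F_approximates: "\<And>i. simple_function borel (F i)"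
    "\<And>x. (\<lambda>i. F i x) \<longlonglongrightarrow> x"
    using borel_measurable_implies_sequence_metric[of "\<lambda>x::'a. x" borel undefined] by auto
  have [measurable]: "F i \<in> borel \<rightarrow>\<^sub>M borel" for i
    by (rule borel_measurable_simple_function[OF F_approximates(1)])
  have "(\<lambda>i. \<integral>x. bdist x (F i x) \<partial>\<mu>) \<longlonglongrightarrow> 0" if "borel_prob_space \<mu>" for \<mu>
  proof -
    interpret borel_prob_space \<mu> by fact
    have "(\<lambda>i. \<integral>x. bdist x (F i x) \<partial>\<mu>) \<longlonglongrightarrow> (\<integral>x. 0 \<partial>\<mu>)"
    proof (rule integral_dominated_convergence[where w="\<lambda>_. 1"])
      have "(\<lambda>i. bdist x (F i x)) \<longlonglongrightarrow> min (dist x x) 1" for x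
        unfolding bdist_def by (intro tendsto_intros F_approximates)
      then show "AE x in \<mu>. (\<lambda>i. bdist x (F i x)) \<longlonglongrightarrow> 0"
        by simp
    qed auto
    then show ?thesis
      by simp
  qed
  with F_approximates(1) show thesis
    by (rule that)
qed

locale transport_quantisation = \<mu>: borel_prob_space \<mu> + \<nu>: borel_prob_space \<nu>
  for \<mu> \<nu> :: "'a::{second_countable_topology, metric_space} measure" +
  fixes T :: "'a \<Rightarrow> 'a"
  assumes simple_T: "simple_function borel T"
begin

definition mass :: "'a measure \<Rightarrow> 'a \<Rightarrow> real" where
  "mass M a = measure M (T -` {a})"

lemma mass_nonneg [simp]: "0 \<le> mass M a"
  by (simp add: mass_def)

lemma finite_range_T: "finite (range T)"
  using simple_T by (simp add: simple_function_def)

lemma T_measurable [measurable]: "T \<in> borel \<rightarrow>\<^sub>M borel"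
  by (rule borel_measurable_simple_function[OF simple_T])

lemma vimage_T [measurable]: "T -` {a} \<in> sets borel"
  using measurable_sets[OF T_measurable, of "{a}"] by simp

lemma simple_function_T_comp:
  assumes "f \<in> M \<rightarrow>\<^sub>M borel"
  shows "simple_function M (\<lambda>x. T (f x))"
proof (rule simple_function_borel_measurable)
  show "(\<lambda>x. T (f x)) \<in> borel_measurable M"
    using assms by measurable
  show "finite ((\<lambda>x. T (f x)) ` space M)"
    by (rule finite_subset[OF _ finite_range_T]) auto
qed

lemma comp_T_measurable: "(\<lambda>x. h (T x)) \<in> borel_measurable borel"
  by (intro borel_measurable_simple_function simple_function_compose1[OF simple_T])

lemma comp_T_measurable2:
  "(\<lambda>z. g (T (fst z)) (T (snd z))) \<in> borel_measurable (borel \<Otimes>\<^sub>M borel)"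
  by (rule borel_measurable_simple_function[OF simple_function_compose2])
    (intro simple_function_T_comp measurable_fst measurable_snd)+

lemma integral_comp_T:
  fixes h :: "'a \<Rightarrow> real"
  assumes "borel_prob_space M"
  shows "(\<integral>x. h (T x) \<partial>M) = (\<Sum>a\<in>range T. h a * mass M a)"
proof -
  interpret borel_prob_space M by fact
  have "h (T x) = (\<Sum>a\<in>range T. h a * indicator (T -` {a}) x)" for x
    by (simp add: indicator_def if_distrib[of "(*) _"] finite_range_T cong: if_cong)
  then have "(\<integral>x. h (T x) \<partial>M) = (\<integral>x. (\<Sum>a\<in>range T. h a * indicator (T -` {a}) x) \<partial>M)"
    by simp
  also have "\<dots> = (\<Sum>a\<in>range T. h a * mass M a)"
    by (subst Bochner_Integration.integral_sum)
      (auto simp: mass_def intro!: integrable_real_indicator simp: emeasure_eq_measure)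
  finally show ?thesis .
qed

lemma nn_integral_comp_T:
  assumes "borel_prob_space M" and h_nonneg: "\<And>a. 0 \<le> h a"
  shows "(\<integral>\<^sup>+x. ennreal (h (T x)) \<partial>M) = ennreal (\<Sum>a\<in>range T. h a * mass M a)"
proof -
  interpret borel_prob_space M by fact
  have "\<bar>h (T x)\<bar> \<le> (\<Sum>a\<in>range T. h a)" for x
    using h_nonneg member_le_sum[of "T x" "range T" h] finite_range_T by simp
  then have "integrable M (\<lambda>x. h (T x))"
    by (intro integrable_bounded comp_T_measurable)
  then have "(\<integral>\<^sup>+x. ennreal (h (T x)) \<partial>M) = ennreal (\<integral>x. h (T x) \<partial>M)"
    using h_nonneg by (intro nn_integral_eq_integral) auto
  then show ?thesis
    by (simp only: integral_comp_T[OF assms(1)])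
qed

lemma sum_mass: "borel_prob_space M \<Longrightarrow> (\<Sum>a\<in>range T. mass M a) = 1"
  using integral_comp_T[of M "\<lambda>_. 1"] borel_prob_space.prob_UNIV[of M]
  by (simp add: borel_prob_space.space_eq_UNIV)

sublocale finite_transport "range T" bdist "mass \<mu>" "mass \<nu>"
  by standard
    (auto simp: finite_range_T sum_mass \<mu>.borel_prob_space_axioms \<nu>.borel_prob_space_axioms
      bdist_triangle)

text \<open>On atoms of \<open>\<mu>\<close> without mass the value is irrelevant; 1 keeps the kernel Markov.\<close>

definition plan_density :: "('a \<times> 'a \<Rightarrow> real) \<Rightarrow> 'a \<Rightarrow> 'a \<Rightarrow> real" where
  "plan_density p a b = (if mass \<mu> a = 0 then 1 else p (a, b) / (mass \<mu> a * mass \<nu> b))"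

definition plan_kernel :: "('a \<times> 'a \<Rightarrow> real) \<Rightarrow> 'a \<Rightarrow> 'a measure" where
  "plan_kernel p x = density \<nu> (\<lambda>y. ennreal (plan_density p (T x) (T y)))"

lemma AE_mass_pos: "AE y in \<nu>. mass \<nu> (T y) \<noteq> 0"
proof -
  have "AE y in \<nu>. \<forall>b\<in>{b\<in>range T. mass \<nu> b = 0}. y \<notin> T -` {b}"
  proof (rule AE_finite_allI)
    show "AE y in \<nu>. y \<notin> T -` {b}" if "b \<in> {b \<in> range T. mass \<nu> b = 0}" for b
      using that vimage_T
      by (intro AE_not_in null_setsI) (auto simp: mass_def \<nu>.emeasure_eq_measure)
  qed (simp add: finite_range_T)
  then show ?thesis
    by eventually_elim auto
qed

context
  fixes p :: "'a \<times> 'a \<Rightarrow> real"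
  assumes p_nonneg: "\<And>z. 0 \<le> p z"
    and p_marginals: "\<And>a. a \<in> range T \<Longrightarrow> row p a = mass \<mu> a" "\<And>b. b \<in> range T \<Longrightarrow> col p b = mass \<nu> b"
begin

lemma plan_eq_0:
  assumes "a \<in> range T" "b \<in> range T" "mass \<mu> a = 0 \<or> mass \<nu> b = 0"
  shows "p (a, b) = 0"
  using assms p_nonneg p_marginals(1)[OF assms(1)] p_marginals(2)[OF assms(2)] finite_range_T
  by (auto simp: row_def col_def sum_nonneg_eq_0_iff)

lemma plan_density_nonneg: "0 \<le> plan_density p a b"
  by (simp add: plan_density_def p_nonneg)

lemma plan_density_mult:
  assumes "a \<in> range T" "b \<in> range T"
  shows "plan_density p a b * mass \<nu> b * mass \<mu> a = p (a, b)"
  using plan_eq_0[OF assms] by (auto simp: plan_density_def)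

lemma plan_density_row:
  assumes "a \<in> range T"
  shows "(\<Sum>b\<in>range T. plan_density p a b * mass \<nu> b) = 1"
proof (cases "mass \<mu> a = 0")
  case True
  then show ?thesis
    by (simp add: plan_density_def sum_k)
next
  case False
  have "(\<Sum>b\<in>range T. plan_density p a b * mass \<nu> b) * mass \<mu> a = row p a"
    unfolding sum_distrib_right row_def by (intro sum.cong refl plan_density_mult assms)
  then show ?thesis
    using False p_marginals(1)[OF assms] by simp
qed

lemma plan_density_col:
  assumes "b \<in> range T" "mass \<nu> b \<noteq> 0"
  shows "(\<Sum>a\<in>range T. plan_density p a b * mass \<mu> a) = 1"
proof -
  have "(\<Sum>a\<in>range T. plan_density p a b * mass \<mu> a) * mass \<nu> b = col p b"
    unfolding sum_distrib_right col_def
    by (intro sum.cong refl) (use plan_density_mult[OF _ assms(1)] in \<open>simp add: ac_simps\<close>)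
  then show ?thesis
    using assms p_marginals(2)[OF assms(1)] by simp
qed

lemma plan_kernel: "plan_kernel p \<in> borel \<rightarrow>\<^sub>M prob_algebra borel" "\<mu> \<bind> plan_kernel p = \<nu>"
proof -
  note [measurable] = comp_T_measurable2[of "plan_density p"]
  have left: "(\<integral>\<^sup>+y. ennreal (plan_density p (T x) (T y)) \<partial>\<nu>) = 1" for x
    by (subst nn_integral_comp_T)
      (simp_all add: \<nu>.borel_prob_space_axioms plan_density_nonneg plan_density_row)
  have "AE y in \<nu>. (\<integral>\<^sup>+x. ennreal (plan_density p (T x) (T y)) \<partial>\<mu>) = 1"
    using AE_mass_pos
    by eventually_elim
      (subst nn_integral_comp_T, simp_all add: \<mu>.borel_prob_space_axioms plan_density_nonneg plan_density_col)
  then have "(\<lambda>x. density \<nu> (\<lambda>y. ennreal (plan_density p (T x) (T y)))) \<in> \<mu> \<rightarrow>\<^sub>M prob_algebra \<nu>"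
    "\<mu> \<bind> (\<lambda>x. density \<nu> (\<lambda>y. ennreal (plan_density p (T x) (T y)))) = \<nu>"
    using bind_density_kernel[OF \<mu>.prob_space_axioms \<nu>.prob_space_axioms,
        of "\<lambda>z. ennreal (plan_density p (T (fst z)) (T (snd z)))"] left
    by simp_all
  then show "plan_kernel p \<in> borel \<rightarrow>\<^sub>M prob_algebra borel" "\<mu> \<bind> plan_kernel p = \<nu>"
    by (simp_all add: plan_kernel_def[abs_def] \<mu>.measurable_iff_borel \<nu>.prob_algebra_eq_borel)
qed

lemma plan_kernel_cost:
  "(\<integral>\<^sup>+x. \<integral>\<^sup>+y. ennreal (bdist (T x) (T y)) \<partial>plan_kernel p x \<partial>\<mu>) = ennreal (cost p)"
proof -
  let ?h = "\<lambda>a. \<Sum>b\<in>range T. (plan_density p a b * bdist a b) * mass \<nu> b"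
  have "(\<integral>\<^sup>+y. ennreal (bdist (T x) (T y)) \<partial>plan_kernel p x) = ennreal (?h (T x))" for x
  proof -
    have "(\<integral>\<^sup>+y. ennreal (bdist (T x) (T y)) \<partial>plan_kernel p x)
        = (\<integral>\<^sup>+y. ennreal (plan_density p (T x) (T y) * bdist (T x) (T y)) \<partial>\<nu>)"
      unfolding plan_kernel_def using comp_T_measurable[of "plan_density p (T x)"]
      by (subst nn_integral_density) (auto simp: ennreal_mult plan_density_nonneg)
    also have "\<dots> = ennreal (?h (T x))"
      using plan_density_nonneg by (intro nn_integral_comp_T \<nu>.borel_prob_space_axioms) auto
    finally show ?thesis .
  qed
  then have "(\<integral>\<^sup>+x. \<integral>\<^sup>+y. ennreal (bdist (T x) (T y)) \<partial>plan_kernel p x \<partial>\<mu>)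
      = (\<integral>\<^sup>+x. ennreal (?h (T x)) \<partial>\<mu>)"
    by simp
  also have "\<dots> = ennreal (\<Sum>a\<in>range T. ?h a * mass \<mu> a)"
    using plan_density_nonneg
    by (intro nn_integral_comp_T \<mu>.borel_prob_space_axioms sum_nonneg mult_nonneg_nonneg) auto
  also have "(\<Sum>a\<in>range T. ?h a * mass \<mu> a) = cost p"
    unfolding cost_def sum_distrib_right
    by (intro sum.cong refl) (use plan_density_mult in \<open>simp add: ac_simps\<close>)
  finally show ?thesis .
qed

end

lemma quantised_dual_le:
  assumes bLip: "bLip f"
  shows "(\<Sum>a\<in>range T. f a * (mass \<mu> a - mass \<nu> a))
    \<le> (\<integral>x. f x \<partial>\<mu>) - (\<integral>x. f x \<partial>\<nu>) + (\<integral>x. bdist x (T x) \<partial>\<mu>) + (\<integral>x. bdist x (T x) \<partial>\<nu>)"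
proof -
  have shift: "\<bar>(\<integral>x. f (T x) \<partial>M) - (\<integral>x. f x \<partial>M)\<bar> \<le> (\<integral>x. bdist x (T x) \<partial>M)"
    if "borel_prob_space M" for M
  proof -
    interpret borel_prob_space M by fact
    have integrable: "integrable M (\<lambda>x. f (T x))" "integrable M f"
      by (rule integrable_bounded[OF comp_T_measurable bLip_abs_le[OF bLip]],
          rule integrable_bLip[OF that bLip])
    have "\<bar>(\<integral>x. f (T x) \<partial>M) - (\<integral>x. f x \<partial>M)\<bar> = \<bar>\<integral>x. f (T x) - f x \<partial>M\<bar>"
      using integrable by simp
    also have "\<dots> \<le> (\<integral>x. \<bar>f (T x) - f x\<bar> \<partial>M)"
      by (rule integral_abs_bound)
    also have "\<dots> \<le> (\<integral>x. bdist x (T x) \<partial>M)"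
    proof (rule integral_mono)
      show "integrable M (\<lambda>x. bdist x (T x))"
        by (rule integrable_bounded[where B=1]) auto
      show "\<bar>f (T x) - f x\<bar> \<le> bdist x (T x)" for x
        using bLip_abs_diff_le[OF bLip, of "T x" x] by (simp add: bdist_commute)
    qed (use integrable in auto)
    finally show ?thesis .
  qed
  have "(\<Sum>a\<in>range T. f a * (mass \<mu> a - mass \<nu> a)) = (\<integral>x. f (T x) \<partial>\<mu>) - (\<integral>x. f (T x) \<partial>\<nu>)"
    by (simp add: integral_comp_T \<mu>.borel_prob_space_axioms \<nu>.borel_prob_space_axioms
        right_diff_distrib sum_subtractf)
  then show ?thesis
    using shift[OF \<mu>.borel_prob_space_axioms] shift[OF \<nu>.borel_prob_space_axioms] by linarith
qed

lemma kernel_cost_le_quantised: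
  assumes kernel: "\<kappa> \<in> borel \<rightarrow>\<^sub>M prob_algebra borel" and bind: "\<mu> \<bind> \<kappa> = \<nu>"
  shows "(\<integral>\<^sup>+x. \<integral>\<^sup>+y. ennreal (bdist x y) \<partial>\<kappa> x \<partial>\<mu>) \<le> (\<integral>\<^sup>+x. ennreal (bdist x (T x)) \<partial>\<mu>)
    + ((\<integral>\<^sup>+x. \<integral>\<^sup>+y. ennreal (bdist (T x) (T y)) \<partial>\<kappa> x \<partial>\<mu>) + (\<integral>\<^sup>+y. ennreal (bdist y (T y)) \<partial>\<nu>))"
proof -
  note [measurable] = measurable_prob_algebraD[OF kernel]
  have [measurable]: "(\<lambda>x. \<integral>\<^sup>+y. ennreal (bdist (T x) (T y)) \<partial>\<kappa> x) \<in> borel_measurable borel"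
    "(\<lambda>x. \<integral>\<^sup>+y. ennreal (bdist y (T y)) \<partial>\<kappa> x) \<in> borel_measurable borel"
    by (rule nn_integral_measurable_subprob_algebra2[where N=borel]; measurable)+
  have pointwise: "(\<integral>\<^sup>+y. ennreal (bdist x y) \<partial>\<kappa> x) \<le> ennreal (bdist x (T x))
      + ((\<integral>\<^sup>+y. ennreal (bdist (T x) (T y)) \<partial>\<kappa> x) + (\<integral>\<^sup>+y. ennreal (bdist y (T y)) \<partial>\<kappa> x))" for x
  proof -
    interpret \<kappa>: borel_prob_space "\<kappa> x"
      using borel_prob_space_kernel[OF kernel] by simp
    have "bdist x y \<le> bdist x (T x) + (bdist (T x) (T y) + bdist y (T y))" for y
      using bdist_triangle[of x y "T x"] bdist_triangle[of "T x" y "T y"]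
      by (simp add: bdist_commute)
    then have "(\<integral>\<^sup>+y. ennreal (bdist x y) \<partial>\<kappa> x)
        \<le> (\<integral>\<^sup>+y. ennreal (bdist x (T x)) + (ennreal (bdist (T x) (T y)) + ennreal (bdist y (T y))) \<partial>\<kappa> x)"
      by (intro nn_integral_mono) (simp flip: ennreal_plus)
    also have "\<dots> = ennreal (bdist x (T x))
        + ((\<integral>\<^sup>+y. ennreal (bdist (T x) (T y)) \<partial>\<kappa> x) + (\<integral>\<^sup>+y. ennreal (bdist y (T y)) \<partial>\<kappa> x))"
      by (simp add: nn_integral_add)
    finally show ?thesis .
  qed
  have "(\<integral>\<^sup>+x. \<integral>\<^sup>+y. ennreal (bdist x y) \<partial>\<kappa> x \<partial>\<mu>) \<le> (\<integral>\<^sup>+x. ennreal (bdist x (T x))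
      + ((\<integral>\<^sup>+y. ennreal (bdist (T x) (T y)) \<partial>\<kappa> x) + (\<integral>\<^sup>+y. ennreal (bdist y (T y)) \<partial>\<kappa> x)) \<partial>\<mu>)"
    by (intro nn_integral_mono pointwise)
  also have "\<dots> = (\<integral>\<^sup>+x. ennreal (bdist x (T x)) \<partial>\<mu>) + ((\<integral>\<^sup>+x. \<integral>\<^sup>+y. ennreal (bdist (T x) (T y)) \<partial>\<kappa> x \<partial>\<mu>)
      + (\<integral>\<^sup>+x. \<integral>\<^sup>+y. ennreal (bdist y (T y)) \<partial>\<kappa> x \<partial>\<mu>))"
    by (simp add: nn_integral_add)
  also have "(\<integral>\<^sup>+x. \<integral>\<^sup>+y. ennreal (bdist y (T y)) \<partial>\<kappa> x \<partial>\<mu>) = (\<integral>\<^sup>+y. ennreal (bdist y (T y)) \<partial>\<nu>)"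
    unfolding bind[symmetric]
    by (rule nn_integral_bind[where B=borel, symmetric])
      (use measurable_prob_algebraD[OF kernel] in \<open>auto simp: \<mu>.measurable_iff_borel\<close>)
  finally show ?thesis .
qed

lemma nn_integral_bdist_T:
  assumes "borel_prob_space M"
  shows "(\<integral>\<^sup>+x. ennreal (bdist x (T x)) \<partial>M) = ennreal (\<integral>x. bdist x (T x) \<partial>M)"
proof -
  interpret borel_prob_space M by fact
  show ?thesis
    by (intro nn_integral_eq_integral integrable_bounded[where B=1]) auto
qed

end

theorem transport_kernel:
  fixes \<mu> \<nu> :: "'a::{second_countable_topology, metric_space} measure"
  assumes \<mu>: "borel_prob_space \<mu>" and \<nu>: "borel_prob_space \<nu>"
    and dual: "\<And>f. bLip f \<Longrightarrow> (\<integral>x. f x \<partial>\<mu>) - (\<integral>x. f x \<partial>\<nu>) \<le> D" and "\<epsilon> > 0"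
  shows "\<exists>\<kappa>. \<kappa> \<in> borel \<rightarrow>\<^sub>M prob_algebra borel \<and> \<mu> \<bind> \<kappa> = \<nu> \<and>
    (\<integral>\<^sup>+x. \<integral>\<^sup>+y. ennreal (bdist x y) \<partial>\<kappa> x \<partial>\<mu>) \<le> ennreal (D + \<epsilon>)"
proof -
  obtain F :: "nat \<Rightarrow> 'a \<Rightarrow> 'a" where simple: "\<And>i. simple_function borel (F i)"
    and quantisation_error: "\<And>\<mu>. borel_prob_space \<mu> \<Longrightarrow> (\<lambda>i. \<integral>x. bdist x (F i x) \<partial>\<mu>) \<longlonglongrightarrow> 0"
    by (rule simple_function_approximation, rule that)
  have "\<forall>\<^sub>F i in sequentially. (\<integral>x. bdist x (F i x) \<partial>\<mu>) < \<epsilon> / 4 \<and> (\<integral>x. bdist x (F i x) \<partial>\<nu>) < \<epsilon> / 4"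
    using \<open>\<epsilon> > 0\<close> by (intro eventually_conj order_tendstoD[OF quantisation_error] \<mu> \<nu>) auto
  then obtain i where quantisation_error_less: "(\<integral>x. bdist x (F i x) \<partial>\<mu>) < \<epsilon> / 4"
    "(\<integral>x. bdist x (F i x) \<partial>\<nu>) < \<epsilon> / 4"
    by (auto dest: eventually_happens)
  define T where "T = F i"
  define e where "e M = (\<integral>x. bdist x (T x) \<partial>M)" for M
  have e_bounds: "e \<mu> \<le> \<epsilon> / 4" "e \<nu> \<le> \<epsilon> / 4" and e_nonneg: "0 \<le> e M" for M
    using quantisation_error_less by (simp_all add: e_def T_def)
  interpret transport_quantisation \<mu> \<nu> T
    using \<mu> \<nu> simple
    by (simp add: transport_quantisation_def transport_quantisation_axioms_def T_def)
  have "(\<Sum>a\<in>range T. f a * (mass \<mu> a - mass \<nu> a)) \<le> D + e \<mu> + e \<nu>"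
    if "\<And>x y. f x - f y \<le> bdist x y" for f
    using quantised_dual_le[of f] dual[of f] that by (simp add: bLip_def e_def)
  then obtain p where plan: "\<And>z. 0 \<le> p z" "\<And>a. a \<in> range T \<Longrightarrow> row p a = mass \<mu> a"
      "\<And>b. b \<in> range T \<Longrightarrow> col p b = mass \<nu> b" and cost: "cost p \<le> D + e \<mu> + e \<nu>"
    using duality by meson
  have "0 \<le> D"
    using dual[OF bLip_0] by simp
  have "(\<integral>\<^sup>+x. \<integral>\<^sup>+y. ennreal (bdist x y) \<partial>plan_kernel p x \<partial>\<mu>)
      \<le> ennreal (e \<mu>) + (ennreal (cost p) + ennreal (e \<nu>))"
    using kernel_cost_le_quantised[OF plan_kernel[OF plan]]
    by (simp add: plan_kernel_cost[OF plan] nn_integral_bdist_T \<mu> \<nu> e_def)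
  also have "\<dots> \<le> ennreal (e \<mu>) + (ennreal (D + e \<mu> + e \<nu>) + ennreal (e \<nu>))"
    using cost by (intro add_mono ennreal_leI order_refl)
  also have "\<dots> \<le> ennreal (D + \<epsilon>)"
    using \<open>0 \<le> D\<close> e_bounds e_nonneg by (simp add: ennreal_leI flip: ennreal_plus)
  finally show ?thesis
    using plan_kernel[OF plan] by blast
qed

section \<open>Weak limits\<close>

lemma bdist_le_sum:
  assumes "m \<le> n"
  shows "bdist (z m) (z n) \<le> (\<Sum>i=m..<n. bdist (z i) (z (Suc i)))"
  using assms
proof (induction n rule: dec_induct)
  case (step n)
  then show ?case
    using bdist_triangle[of "z m" "z (Suc n)" "z n"] by (simp add: sum.atLeastLessThan_Suc)
qed simp

lemma summable_bdist_imp_Cauchy: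
  assumes "summable (\<lambda>i. bdist (z i) (z (Suc i)))"
  shows "Cauchy z"
proof (rule CauchyI')
  fix e :: real assume "0 < e"
  then obtain N where tail_less: "\<And>m n. N \<le> m \<Longrightarrow> norm (\<Sum>i=m..<n. bdist (z i) (z (Suc i))) < min e 1"
    using assms unfolding summable_Cauchy by (metis min_less_iff_conj zero_less_one)
  have "dist (z m) (z n) < e" if "N \<le> m" "m < n" for m n
  proof -
    have "bdist (z m) (z n) < min e 1"
      using bdist_le_sum[of m n z] tail_less[of m n] that unfolding real_norm_def by linarith
    then show ?thesis
      by (auto simp: bdist_def min_def split: if_splits)
  qed
  then show "\<exists>N. \<forall>m\<ge>N. \<forall>n>m. dist (z m) (z n) < e"
    by blast
qed

lemma AE_Cauchy_if_summable_bdist: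
  fixes X :: "nat \<Rightarrow> 'b \<Rightarrow> 'a::{second_countable_topology, metric_space}"
  assumes [measurable]: "\<And>i. X i \<in> M \<rightarrow>\<^sub>M borel"
    and "summable b" "\<And>i. 0 \<le> b i"
    and bound: "\<And>i. (\<integral>\<^sup>+\<omega>. ennreal (bdist (X i \<omega>) (X (Suc i) \<omega>)) \<partial>M) \<le> ennreal (b i)"
  shows "AE \<omega> in M. Cauchy (\<lambda>i. X i \<omega>)"
proof -
  have "(\<integral>\<^sup>+\<omega>. (\<Sum>i. ennreal (bdist (X i \<omega>) (X (Suc i) \<omega>))) \<partial>M)
      = (\<Sum>i. \<integral>\<^sup>+\<omega>. ennreal (bdist (X i \<omega>) (X (Suc i) \<omega>)) \<partial>M)"
    by (rule nn_integral_suminf) measurable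
  also have "\<dots> \<le> (\<Sum>i. ennreal (b i))"
    by (intro suminf_le bound) auto
  also have "\<dots> = ennreal (\<Sum>i. b i)"
    using assms(2,3) by (intro suminf_ennreal2)
  finally have "AE \<omega> in M. (\<Sum>i. ennreal (bdist (X i \<omega>) (X (Suc i) \<omega>))) \<noteq> \<infinity>"
    by (intro nn_integral_PInf_AE) (auto simp: top_unique)
  then show ?thesis
    by eventually_elim (auto intro!: summable_bdist_imp_Cauchy summable_suminf_not_top)
qed

lemma AE_Cauchy_imp_measurable_limit:
  fixes X :: "nat \<Rightarrow> 'b \<Rightarrow> 'a::polish_space"
  assumes [measurable]: "\<And>i. X i \<in> M \<rightarrow>\<^sub>M borel" and "AE \<omega> in M. Cauchy (\<lambda>i. X i \<omega>)"
  obtains Z where "Z \<in> M \<rightarrow>\<^sub>M borel" "AE \<omega> in M. (\<lambda>i. X i \<omega>) \<longlonglongrightarrow> Z \<omega>"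
proof
  define X' where "X' i \<omega> = (if Cauchy (\<lambda>i. X i \<omega>) then X i \<omega> else undefined)" for i \<omega>
  define Z where "Z \<omega> = lim (\<lambda>i. X' i \<omega>)" for \<omega>
  have "Cauchy (\<lambda>i. X' i \<omega>)" for \<omega>
    by (cases "Cauchy (\<lambda>i. X i \<omega>)") (simp_all add: X'_def LIMSEQ_imp_Cauchy[OF tendsto_const])
  then have lim: "(\<lambda>i. X' i \<omega>) \<longlonglongrightarrow> Z \<omega>" for \<omega>
    unfolding Z_def by (simp add: Cauchy_convergent_iff convergent_LIMSEQ_iff)
  have "X' i \<in> M \<rightarrow>\<^sub>M borel" for i
    unfolding X'_def by measurable
  then show "Z \<in> M \<rightarrow>\<^sub>M borel"
    by (rule borel_measurable_LIMSEQ_metric) (rule lim)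
  show "AE \<omega> in M. (\<lambda>i. X i \<omega>) \<longlonglongrightarrow> Z \<omega>"
    using assms(2)
  proof eventually_elim
    fix \<omega> assume "Cauchy (\<lambda>i. X i \<omega>)"
    then show "(\<lambda>i. X i \<omega>) \<longlonglongrightarrow> Z \<omega>"
      using lim[of \<omega>] by (simp add: X'_def)
  qed
qed

primrec markov_law :: "'a measure \<Rightarrow> (nat \<Rightarrow> 'a \<Rightarrow> 'a measure) \<Rightarrow> nat \<Rightarrow> 'a measure" where
  "markov_law \<mu> \<kappa> 0 = \<mu>"
| "markov_law \<mu> \<kappa> (Suc i) = markov_law \<mu> \<kappa> i \<bind> \<kappa> i"

locale inhomogeneous_markov_chain =
  fixes M \<mu> :: "'a measure" and \<kappa> :: "nat \<Rightarrow> 'a \<Rightarrow> 'a measure"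
  assumes init: "\<mu> \<in> space (prob_algebra M)" and kernel: "\<And>i. \<kappa> i \<in> M \<rightarrow>\<^sub>M prob_algebra M"
begin

definition transition :: "nat \<Rightarrow> (nat \<Rightarrow> 'a) \<Rightarrow> 'a measure" where
  "transition i \<omega> = (case i of 0 \<Rightarrow> \<mu> | Suc j \<Rightarrow> \<kappa> j (\<omega> j))"

lemma kernel_subprob [measurable]: "\<kappa> i \<in> M \<rightarrow>\<^sub>M subprob_algebra M"
  by (rule measurable_prob_algebraD[OF kernel])

sublocale Ionescu_Tulcea transition "\<lambda>_. M"
proof (rule Ionescu_Tulcea.intro)
  fix i
  have "\<mu> \<in> space (subprob_algebra M)"
    using init by (simp add: space_prob_algebra space_subprob_algebra prob_space_imp_subprob_space)
  then show "transition i \<in> measurable (PiM {0..<i} (\<lambda>_. M)) (subprob_algebra M)"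
    by (cases i) (simp_all add: transition_def[abs_def])
  show "prob_space (transition i \<omega>)" if "\<omega> \<in> space (PiM {0..<i} (\<lambda>_. M))" for \<omega>
    using init measurable_space[OF kernel] that
    by (cases i) (auto simp: transition_def space_prob_algebra space_PiM PiE_iff)
qed

abbreviation law :: "nat \<Rightarrow> 'a measure" where "law \<equiv> markov_law \<mu> \<kappa>"

abbreviation paths :: "nat \<Rightarrow> (nat \<Rightarrow> 'a) measure" where "paths n \<equiv> C 0 n (\<lambda>_. undefined)"

lemma law_in_prob_algebra: "law i \<in> space (prob_algebra M)"
proof (induction i)
  case (Suc i)
  then show ?case
    using prob_space_bind'[OF Suc kernel] sets_bind'[OF Suc kernel]
    by (simp add: space_prob_algebra)
qed (simp add: init)

lemma sets_law [measurable_cong]: "sets (law i) = sets M"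
  using law_in_prob_algebra by (simp add: space_prob_algebra)

lemma nn_integral_paths_Suc:
  assumes "F \<in> borel_measurable (PiM {0..<Suc n} (\<lambda>_. M))"
  shows "(\<integral>\<^sup>+\<omega>. F \<omega> \<partial>paths (Suc n)) = (\<integral>\<^sup>+\<omega>. \<integral>\<^sup>+y. F (fun_upd \<omega> n y) \<partial>transition n \<omega> \<partial>paths n)"
proof -
  have sets: "sets (paths n) = sets (PiM {0..<n} (\<lambda>_. M))"
    by (subst sets_C) (auto simp: space_PiM)
  have "(\<integral>\<^sup>+\<omega>. F \<omega> \<partial>paths (Suc n)) = (\<integral>\<^sup>+\<omega>. \<integral>\<^sup>+\<omega>'. F \<omega>' \<partial>eP n \<omega> \<partial>paths n)"
    unfolding C.simps add_0
    by (rule nn_integral_bind[OF assms])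
      (use measurable_eP[of n] in \<open>simp add: measurable_cong_sets[OF sets refl]\<close>)
  then show ?thesis
    using nn_integral_eP[OF _ assms]
    by (simp add: sets_eq_imp_space_eq[OF sets] cong: nn_integral_cong_simp)
qed

lemma nn_integral_paths_last:
  assumes [measurable]: "f \<in> borel_measurable M"
  shows "(\<integral>\<^sup>+\<omega>. f (\<omega> i) \<partial>paths (Suc i)) = (\<integral>\<^sup>+x. f x \<partial>law i)"
  using assms
proof (induction i arbitrary: f)
  case 0
  note [measurable] = 0
  have "(\<integral>\<^sup>+\<omega>. f (\<omega> 0) \<partial>paths (Suc 0)) = (\<integral>\<^sup>+\<omega>. \<integral>\<^sup>+y. f y \<partial>\<mu> \<partial>paths 0)"
    by (subst nn_integral_paths_Suc) (auto simp: transition_def)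
  also have "\<dots> = (\<integral>\<^sup>+y. f y \<partial>\<mu>)"
    unfolding C.simps by (subst nn_integral_return) (auto simp: space_PiM)
  finally show ?case
    by simp
next
  case (Suc i)
  note [measurable] = Suc.prems
  have "(\<integral>\<^sup>+\<omega>. f (\<omega> (Suc i)) \<partial>paths (Suc (Suc i))) = (\<integral>\<^sup>+\<omega>. \<integral>\<^sup>+y. f y \<partial>\<kappa> i (\<omega> i) \<partial>paths (Suc i))"
    by (subst nn_integral_paths_Suc) (auto simp: transition_def)
  also have "\<dots> = (\<integral>\<^sup>+x. \<integral>\<^sup>+y. f y \<partial>\<kappa> i x \<partial>law i)"
    by (rule Suc.IH) (rule nn_integral_measurable_subprob_algebra2[where N=M], measurable)
  also have "\<dots> = (\<integral>\<^sup>+y. f y \<partial>law (Suc i))"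
    unfolding markov_law.simps by (rule nn_integral_bind[where B=M, symmetric]) measurable
  finally show ?case .
qed

lemma nn_integral_lim_restrict:
  assumes "F \<in> borel_measurable (PiM {0..<n} (\<lambda>_. M))"
  shows "(\<integral>\<^sup>+\<omega>. F (restrict \<omega> {0..<n}) \<partial>PF.lim) = (\<integral>\<^sup>+\<omega>. F \<omega> \<partial>paths n)"
proof -
  have "up_to {0..<n} = n"
  proof (rule antisym)
    show "up_to {0..<n} \<le> n"
      by (simp add: up_to_iff)
    show "n \<le> up_to {0..<n}"
      using up_to_less[of "{0..<n}" "n - 1"] by (cases n) auto
  qed
  then have "CI {0..<n} = paths n"
    using distr_C[of n n "\<lambda>_. undefined" 0] by (simp add: CI_def space_PiM)
  then have "distr PF.lim (PiM {0..<n} (\<lambda>_. M)) (\<lambda>\<omega>. restrict \<omega> {0..<n}) = paths n"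
    by (simp add: distr_lim)
  then have "(\<integral>\<^sup>+\<omega>. F \<omega> \<partial>paths n)
      = (\<integral>\<^sup>+\<omega>. F \<omega> \<partial>distr PF.lim (PiM {0..<n} (\<lambda>_. M)) (\<lambda>\<omega>. restrict \<omega> {0..<n}))"
    by simp
  also have "\<dots> = (\<integral>\<^sup>+\<omega>. F (restrict \<omega> {0..<n}) \<partial>PF.lim)"
    using assms
    by (intro nn_integral_distr)
      (auto simp: measurable_cong_sets[OF PF.sets_lim refl] intro: measurable_restrict_subset)
  finally show ?thesis
    by simp
qed

lemma distr_lim_component: "distr PF.lim M (\<lambda>\<omega>. \<omega> i) = law i"
proof (rule measure_eqI)
  note [measurable_cong] = PF.sets_lim
  fix A assume "A \<in> sets (distr PF.lim M (\<lambda>\<omega>. \<omega> i))"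
  then have A_sets [measurable]: "A \<in> sets M"
    by simp
  have "emeasure (distr PF.lim M (\<lambda>\<omega>. \<omega> i)) A = (\<integral>\<^sup>+x. indicator A x \<partial>distr PF.lim M (\<lambda>\<omega>. \<omega> i))"
    by simp
  also have "\<dots> = (\<integral>\<^sup>+\<omega>. indicator A (\<omega> i) \<partial>PF.lim)"
    by (rule nn_integral_distr) measurable
  also have "\<dots> = (\<integral>\<^sup>+x. indicator A x \<partial>law i)"
    using nn_integral_lim_restrict[of "\<lambda>\<omega>. indicator A (\<omega> i)" "Suc i"]
      nn_integral_paths_last[of "indicator A" i] by simp
  also have "\<dots> = emeasure (law i) A"
    by (simp add: sets_law)
  finally show "emeasure (distr PF.lim M (\<lambda>\<omega>. \<omega> i)) A = emeasure (law i) A" .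
qed (simp add: sets_law)

lemma prob_space_lim: "prob_space PF.lim"
proof (rule prob_space_distrD)
  show "(\<lambda>\<omega>. \<omega> 0) \<in> PF.lim \<rightarrow>\<^sub>M M"
    by (simp add: measurable_cong_sets[OF PF.sets_lim refl])
  show "prob_space (distr PF.lim M (\<lambda>\<omega>. \<omega> 0))"
    using law_in_prob_algebra[of 0] by (simp add: distr_lim_component space_prob_algebra)
qed

lemma nn_integral_lim_step:
  assumes [measurable]: "(\<lambda>(x, y). f x y) \<in> borel_measurable (M \<Otimes>\<^sub>M M)"
  shows "(\<integral>\<^sup>+\<omega>. f (\<omega> i) (\<omega> (Suc i)) \<partial>PF.lim) = (\<integral>\<^sup>+x. \<integral>\<^sup>+y. f x y \<partial>\<kappa> i x \<partial>law i)"
proof -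
  have "(\<integral>\<^sup>+\<omega>. f (\<omega> i) (\<omega> (Suc i)) \<partial>PF.lim) = (\<integral>\<^sup>+\<omega>. f (\<omega> i) (\<omega> (Suc i)) \<partial>paths (Suc (Suc i)))"
    using nn_integral_lim_restrict[of "\<lambda>\<omega>. f (\<omega> i) (\<omega> (Suc i))" "Suc (Suc i)"] by simp
  also have "\<dots> = (\<integral>\<^sup>+\<omega>. \<integral>\<^sup>+y. f (\<omega> i) y \<partial>\<kappa> i (\<omega> i) \<partial>paths (Suc i))"
    by (subst nn_integral_paths_Suc) (auto simp: transition_def)
  also have "\<dots> = (\<integral>\<^sup>+x. \<integral>\<^sup>+y. f x y \<partial>\<kappa> i x \<partial>law i)"
    by (rule nn_integral_paths_last)
      (rule nn_integral_measurable_subprob_algebra2[where N=M], measurable)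
  finally show ?thesis .
qed

end

lemma tendsto_integral_distr:
  fixes X :: "nat \<Rightarrow> 'b \<Rightarrow> 'a::metric_space" and g :: "'a \<Rightarrow> real"
  assumes "prob_space M" and [measurable]: "\<And>i. X i \<in> M \<rightarrow>\<^sub>M borel" "Z \<in> M \<rightarrow>\<^sub>M borel"
    and limit: "AE \<omega> in M. (\<lambda>i. X i \<omega>) \<longlonglongrightarrow> Z \<omega>"
    and g: "continuous_on UNIV g" "bounded (range g)"
  shows "(\<lambda>i. \<integral>x. g x \<partial>distr M borel (X i)) \<longlonglongrightarrow> (\<integral>x. g x \<partial>distr M borel Z)"
proof -
  interpret prob_space M by fact
  have [measurable]: "g \<in> borel_measurable borel"
    using g(1) by (rule borel_measurable_continuous_onI)
  obtain B where g_bound: "\<And>x. \<bar>g x\<bar> \<le> B"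
    using g(2) by (auto simp: bounded_iff)
  have "(\<lambda>i. \<integral>\<omega>. g (X i \<omega>) \<partial>M) \<longlonglongrightarrow> (\<integral>\<omega>. g (Z \<omega>) \<partial>M)"
  proof (rule integral_dominated_convergence[where w="\<lambda>_. B"])
    show "AE \<omega> in M. (\<lambda>i. g (X i \<omega>)) \<longlonglongrightarrow> g (Z \<omega>)"
      using limit by eventually_elim (rule continuous_on_tendsto_compose[OF g(1)], auto)
  qed (auto simp: g_bound)
  then show ?thesis
    by (simp add: integral_distr)
qed

theorem weak_limit_if_summable_dual_distance:
  fixes \<mu> :: "nat \<Rightarrow> 'a::polish_space measure"
  assumes \<mu>: "\<And>i. borel_prob_space (\<mu> i)" and b_summable: "summable b" "\<And>i. 0 < b i"
    and dual: "\<And>i f. bLip f \<Longrightarrow> (\<integral>x. f x \<partial>\<mu> i) - (\<integral>x. f x \<partial>\<mu> (Suc i)) \<le> b i"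
  shows "\<exists>\<pi>. borel_prob_space \<pi> \<and> (\<forall>g::'a \<Rightarrow> real. continuous_on UNIV g \<longrightarrow> bounded (range g) \<longrightarrow>
    (\<lambda>i. \<integral>x. g x \<partial>\<mu> i) \<longlonglongrightarrow> (\<integral>x. g x \<partial>\<pi>))"
proof -
  have "\<exists>\<kappa>. \<kappa> \<in> borel \<rightarrow>\<^sub>M prob_algebra borel \<and> \<mu> i \<bind> \<kappa> = \<mu> (Suc i) \<and>
    (\<integral>\<^sup>+x. \<integral>\<^sup>+y. ennreal (bdist x y) \<partial>\<kappa> x \<partial>\<mu> i) \<le> ennreal (b i + b i)" for i
    by (intro transport_kernel \<mu> dual b_summable)
  then obtain \<kappa> where \<kappa>_transports: "\<And>i. \<kappa> i \<in> borel \<rightarrow>\<^sub>M prob_algebra borel"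
    "\<And>i. \<mu> i \<bind> \<kappa> i = \<mu> (Suc i)"
    and cost: "\<And>i. (\<integral>\<^sup>+x. \<integral>\<^sup>+y. ennreal (bdist x y) \<partial>\<kappa> i x \<partial>\<mu> i) \<le> ennreal (b i + b i)"
    by metis
  interpret inhomogeneous_markov_chain borel "\<mu> 0" \<kappa>
    by standard (auto intro: borel_prob_space.in_prob_algebra \<mu> \<kappa>_transports)
  have law: "law i = \<mu> i" for i
    by (induction i) (simp_all add: \<kappa>_transports(2))
  note [measurable_cong] = PF.sets_lim
  interpret lim: prob_space PF.lim
    by (rule prob_space_lim)
  have "AE \<omega> in PF.lim. Cauchy \<omega>"
  proof (rule AE_Cauchy_if_summable_bdist[where X="\<lambda>i \<omega>. \<omega> i"])
    show "summable (\<lambda>i. b i + b i)" "0 \<le> b i + b i" for i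
      using b_summable by (auto intro: summable_add simp: less_imp_le)
    show "(\<integral>\<^sup>+\<omega>. ennreal (bdist (\<omega> i) (\<omega> (Suc i))) \<partial>PF.lim) \<le> ennreal (b i + b i)" for i
      using cost[of i] by (subst nn_integral_lim_step) (auto simp: law split_beta')
  qed measurable
  then obtain Z where [measurable]: "Z \<in> PF.lim \<rightarrow>\<^sub>M borel" and Z_limit: "AE \<omega> in PF.lim. \<omega> \<longlonglongrightarrow> Z \<omega>"
    by (rule AE_Cauchy_imp_measurable_limit[rotated]) measurable
  have component: "distr PF.lim borel (\<lambda>\<omega>. \<omega> i) = \<mu> i" for i
    by (simp add: distr_lim_component law)
  have "borel_prob_space (distr PF.lim borel Z)"
    by (auto simp: borel_prob_space_iff intro: lim.prob_space_distr)
  moreover have "(\<lambda>i. \<integral>x. g x \<partial>\<mu> i) \<longlonglongrightarrow> (\<integral>x. g x \<partial>distr PF.lim borel Z)"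
    if "continuous_on UNIV g" "bounded (range g)" for g :: "'a \<Rightarrow> real"
    using tendsto_integral_distr[of PF.lim "\<lambda>i \<omega>. \<omega> i" Z, OF prob_space_lim _ _ Z_limit that]
    by (simp add: component)
  ultimately show ?thesis
    by blast
qed

lemma bLip_min_infdist:
  assumes "A \<noteq> {}" "0 \<le> e" "e \<le> 1"
  shows "bLip (\<lambda>x. min (infdist x A) e)"
  unfolding bLip_def bdist_def
proof (intro allI)
  fix x y
  show "min (infdist x A) e - min (infdist y A) e \<le> min (dist x y) 1"
    using infdist_triangle[of x A y] infdist_nonneg[of y A] zero_le_dist[of x y] assms by linarith
qed

lemma scaled_infdist_tendsto_indicator:
  assumes "open U" "- U \<noteq> {}"
  shows "(\<lambda>n. real (Suc n) * min (infdist x (- U)) (1 / real (Suc n))) \<longlonglongrightarrow> indicator U x"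
proof (cases "x \<in> U")
  case True
  then have "0 < infdist x (- U)"
    using assms by (intro infdist_pos_not_in_closed) auto
  then obtain N where inverse_N_less: "1 / real (Suc N) < infdist x (- U)"
    using nat_approx_posE by blast
  have "\<forall>\<^sub>F n in sequentially. real (Suc n) * min (infdist x (- U)) (1 / real (Suc n)) = 1"
    using eventually_ge_at_top[of N]
  proof eventually_elim
    case (elim n)
    then have "1 / real (Suc n) \<le> 1 / real (Suc N)"
      by (intro divide_left_mono) auto
    then show ?case
      using inverse_N_less by (simp add: min_def)
  qed
  then show ?thesis
    using True by (simp add: tendsto_eventually)
qed simp

lemma measure_eqI_bLip:
  fixes \<mu> \<nu> :: "'a::metric_space measure"
  assumes \<mu>: "borel_prob_space \<mu>" and \<nu>: "borel_prob_space \<nu>"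
    and integral_eq: "\<And>f. bLip f \<Longrightarrow> (\<integral>x. f x \<partial>\<mu>) = (\<integral>x. f x \<partial>\<nu>)"
  shows "\<mu> = \<nu>"
proof -
  interpret \<mu>: borel_prob_space \<mu> by fact
  interpret \<nu>: borel_prob_space \<nu> by fact
  have "measure \<mu> U = measure \<nu> U" if "open U" for U
  proof (cases "- U = {}")
    case False
    have [measurable]: "U \<in> sets borel"
      using that by (rule borel_open)
    define g where "g n x = min (infdist x (- U)) (1 / real (Suc n))" for n x
    have bLip: "bLip (g n)" for n
      unfolding g_def using False by (intro bLip_min_infdist) auto
    have [measurable]: "g n \<in> borel_measurable borel" for n
      by (rule bLip_measurable[OF bLip])
    have lim: "(\<lambda>n. real (Suc n) * (\<integral>x. g n x \<partial>M)) \<longlonglongrightarrow> measure M U" if "borel_prob_space M" for M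
    proof -
      interpret borel_prob_space M by fact
      have "(\<lambda>n. \<integral>x. real (Suc n) * g n x \<partial>M) \<longlonglongrightarrow> (\<integral>x. indicator U x \<partial>M)"
      proof (rule integral_dominated_convergence[where w="\<lambda>_. 1"])
        show "AE x in M. (\<lambda>n. real (Suc n) * g n x) \<longlonglongrightarrow> indicator U x"
          unfolding g_def by (intro AE_I2 scaled_infdist_tendsto_indicator \<open>open U\<close> False)
        show "AE x in M. norm (real (Suc n) * g n x) \<le> 1" for n
          using infdist_nonneg[of _ "- U"] by (auto simp: g_def min_def field_simps)
      qed auto
      then show ?thesis
        by simp
    qed
    show ?thesis
      using lim[OF \<mu>] lim[OF \<nu>] unfolding integral_eq[OF bLip] by (rule LIMSEQ_unique)
  next
    case True
    then have "U = UNIV"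
      by auto
    then show ?thesis
      by simp
  qed
  then show ?thesis
    by (intro measure_eqI_generator_eq[where \<Omega>=UNIV and E="{U. open U}" and A="\<lambda>_. UNIV"])
      (auto simp: \<mu>.emeasure_eq_measure \<nu>.emeasure_eq_measure Int_stable_def borel_def)
qed

section \<open>Couplings\<close>

lemma couplingsD:
  assumes "c \<in> couplings \<mu> \<nu>"
  shows "prob_space c" "sets c = sets (borel \<Otimes>\<^sub>M borel)" "distr c borel fst = \<mu>"
    "distr c borel snd = \<nu>"
  using assms by (auto simp: couplings_def)

definition joint_law :: "'w measure \<Rightarrow> ('w \<Rightarrow> 'a::topological_space) \<Rightarrow> ('w \<Rightarrow> 'a measure) \<Rightarrow> ('a \<times> 'a) measure" where
  "joint_law M X \<kappa> = M \<bind> (\<lambda>\<omega>. distr (\<kappa> \<omega>) (borel \<Otimes>\<^sub>M borel) (Pair (X \<omega>)))"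

context
  fixes M :: "'w measure" and X :: "'w \<Rightarrow> 'a::topological_space" and \<kappa> :: "'w \<Rightarrow> 'a measure"
  assumes prob_space_M: "prob_space M" and X_meas [measurable]: "X \<in> M \<rightarrow>\<^sub>M borel"
    and kernel [measurable]: "\<kappa> \<in> M \<rightarrow>\<^sub>M prob_algebra borel"
begin

lemma M_in_prob_algebra: "M \<in> space (prob_algebra M)"
  using prob_space_M by (simp add: space_prob_algebra)

lemma borel_kernel:
  assumes "\<omega> \<in> space M"
  shows "sets (\<kappa> \<omega>) = sets borel" "emeasure (\<kappa> \<omega>) UNIV = 1"
  using borel_prob_space_kernel[OF kernel assms]
  by (auto simp: borel_prob_space.sets_eq_borel borel_prob_space.emeasure_UNIV)

lemma joint_kernel:
  "(\<lambda>\<omega>. distr (\<kappa> \<omega>) (borel \<Otimes>\<^sub>M borel) (Pair (X \<omega>))) \<in> M \<rightarrow>\<^sub>M prob_algebra (borel \<Otimes>\<^sub>M borel)"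
  by (rule measurable_distr_prob_space2[OF kernel]) simp

lemma sets_joint_law: "sets (joint_law M X \<kappa>) = sets (borel \<Otimes>\<^sub>M borel)"
  unfolding joint_law_def by (rule sets_bind'[OF M_in_prob_algebra joint_kernel])

lemma nn_integral_joint_law:
  assumes "F \<in> borel_measurable (borel \<Otimes>\<^sub>M borel)"
  shows "(\<integral>\<^sup>+z. F z \<partial>joint_law M X \<kappa>) = (\<integral>\<^sup>+\<omega>. \<integral>\<^sup>+y. F (X \<omega>, y) \<partial>\<kappa> \<omega> \<partial>M)"
proof -
  have "(\<integral>\<^sup>+z. F z \<partial>joint_law M X \<kappa>)
      = (\<integral>\<^sup>+\<omega>. \<integral>\<^sup>+z. F z \<partial>distr (\<kappa> \<omega>) (borel \<Otimes>\<^sub>M borel) (Pair (X \<omega>)) \<partial>M)"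
    unfolding joint_law_def
    by (rule nn_integral_bind[OF assms measurable_prob_algebraD[OF joint_kernel]])
  also have "\<dots> = (\<integral>\<^sup>+\<omega>. \<integral>\<^sup>+y. F (X \<omega>, y) \<partial>\<kappa> \<omega> \<partial>M)"
    using assms borel_kernel
    by (intro nn_integral_cong nn_integral_distr) (auto cong: measurable_cong_sets)
  finally show ?thesis .
qed

lemma emeasure_distr_joint_law:
  fixes f :: "'a \<times> 'a \<Rightarrow> 'a"
  assumes [measurable]: "f \<in> borel \<Otimes>\<^sub>M borel \<rightarrow>\<^sub>M borel" "A \<in> sets borel"
  shows "emeasure (distr (joint_law M X \<kappa>) borel f) A
      = (\<integral>\<^sup>+\<omega>. \<integral>\<^sup>+y. indicator A (f (X \<omega>, y)) \<partial>\<kappa> \<omega> \<partial>M)"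
proof -
  have f_meas: "f \<in> joint_law M X \<kappa> \<rightarrow>\<^sub>M borel"
    by (simp add: measurable_cong_sets[OF sets_joint_law refl])
  have "emeasure (distr (joint_law M X \<kappa>) borel f) A
      = (\<integral>\<^sup>+x. indicator A x \<partial>distr (joint_law M X \<kappa>) borel f)"
    by simp
  also have "\<dots> = (\<integral>\<^sup>+z. indicator A (f z) \<partial>joint_law M X \<kappa>)"
    by (rule nn_integral_distr[OF f_meas]) simp
  finally show ?thesis
    by (simp add: nn_integral_joint_law)
qed

lemma joint_law_coupling: "joint_law M X \<kappa> \<in> couplings (distr M borel X) (M \<bind> \<kappa>)"
proof -
  have "distr (joint_law M X \<kappa>) borel fst = distr M borel X"
  proof (rule measure_eqI)
    fix A assume "A \<in> sets (distr (joint_law M X \<kappa>) borel fst)"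
    then have A_sets [measurable]: "A \<in> sets borel"
      by simp
    have "emeasure (distr (joint_law M X \<kappa>) borel fst) A = (\<integral>\<^sup>+\<omega>. indicator A (X \<omega>) \<partial>M)"
      by (simp add: emeasure_distr_joint_law borel_kernel sets_eq_imp_space_eq[OF borel_kernel(1)]
          cong: nn_integral_cong_simp)
    also have "\<dots> = (\<integral>\<^sup>+x. indicator A x \<partial>distr M borel X)"
      by (rule nn_integral_distr[symmetric]) measurable
    finally show "emeasure (distr (joint_law M X \<kappa>) borel fst) A = emeasure (distr M borel X) A"
      by simp
  qed simp
  moreover have "distr (joint_law M X \<kappa>) borel snd = M \<bind> \<kappa>"
  proof (rule measure_eqI)
    show "sets (distr (joint_law M X \<kappa>) borel snd) = sets (M \<bind> \<kappa>)"
      by (simp add: sets_bind'[OF M_in_prob_algebra kernel])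
    fix A assume "A \<in> sets (distr (joint_law M X \<kappa>) borel snd)"
    then have A_sets: "A \<in> sets borel"
      by simp
    then show "emeasure (distr (joint_law M X \<kappa>) borel snd) A = emeasure (M \<bind> \<kappa>) A"
      using emeasure_bind_prob_algebra[OF M_in_prob_algebra kernel A_sets] borel_kernel
      by (simp add: emeasure_distr_joint_law cong: nn_integral_cong_simp)
  qed
  moreover have "prob_space (joint_law M X \<kappa>)"
    unfolding joint_law_def by (rule prob_space_bind'[OF M_in_prob_algebra joint_kernel])
  ultimately show ?thesis
    by (simp add: couplings_def sets_joint_law)
qed

end

lemma wasserstein_le_dual:
  fixes \<mu> \<nu> :: "'a::{second_countable_topology, metric_space} measure"
  assumes \<mu>: "borel_prob_space \<mu>" and \<nu>: "borel_prob_space \<nu>"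
    and dual: "\<And>f. bLip f \<Longrightarrow> (\<integral>x. f x \<partial>\<mu>) - (\<integral>x. f x \<partial>\<nu>) \<le> D"
  shows "wasserstein bdist \<mu> \<nu> \<le> ennreal D"
proof (rule ennreal_le_epsilon)
  interpret \<mu>: borel_prob_space \<mu> by fact
  fix e :: real assume "0 < e"
  obtain \<kappa> where kernel: "\<kappa> \<in> borel \<rightarrow>\<^sub>M prob_algebra borel" "\<mu> \<bind> \<kappa> = \<nu>"
    and cost: "(\<integral>\<^sup>+x. \<integral>\<^sup>+y. ennreal (bdist x y) \<partial>\<kappa> x \<partial>\<mu>) \<le> ennreal (D + e)"
    using transport_kernel[OF \<mu> \<nu> dual \<open>0 < e\<close>] by blast
  let ?c = "joint_law \<mu> (\<lambda>x. x) \<kappa>"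
  have "(\<lambda>x. x) \<in> \<mu> \<rightarrow>\<^sub>M borel" and "\<kappa> \<in> \<mu> \<rightarrow>\<^sub>M prob_algebra borel"
    using kernel(1) by (simp_all add: \<mu>.measurable_iff_borel)
  note joint = \<mu>.prob_space_axioms this
  have "?c \<in> couplings \<mu> \<nu>"
    using joint_law_coupling[OF joint] by (simp add: kernel(2) distr_id2)
  then have "wasserstein bdist \<mu> \<nu> \<le> (\<integral>\<^sup>+z. ennreal (bdist (fst z) (snd z)) \<partial>?c)"
    unfolding wasserstein_def by (rule INF_lower)
  also have "\<dots> = (\<integral>\<^sup>+x. \<integral>\<^sup>+y. ennreal (bdist x y) \<partial>\<kappa> x \<partial>\<mu>)"
    by (subst nn_integral_joint_law[OF joint]) auto
  also note cost
  also have "ennreal (D + e) = ennreal D + ennreal e"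
    using dual[OF bLip_0] \<open>0 < e\<close> by simp
  finally show "wasserstein bdist \<mu> \<nu> \<le> ennreal D + ennreal e" .
qed

lemma product_coupling:
  assumes "borel_prob_space \<mu>" "borel_prob_space \<nu>"
  shows "\<mu> \<Otimes>\<^sub>M \<nu> \<in> couplings \<mu> \<nu>"
proof -
  interpret \<mu>: borel_prob_space \<mu> by fact
  interpret \<nu>: borel_prob_space \<nu> by fact
  interpret pair_prob_space \<mu> \<nu> ..
  have "distr (\<mu> \<Otimes>\<^sub>M \<nu>) borel fst = distr (\<mu> \<Otimes>\<^sub>M \<nu>) \<mu> fst"
    by (rule distr_cong) auto
  moreover have "distr (\<mu> \<Otimes>\<^sub>M \<nu>) borel snd = distr (\<nu> \<Otimes>\<^sub>M \<mu>) \<nu> fst"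
    by (subst distr_pair_swap, subst distr_distr)
      (auto simp: comp_def split_beta' intro!: distr_cong)
  ultimately show ?thesis
    by (simp add: couplings_def prob_space_axioms \<nu>.distr_pair_fst \<mu>.distr_pair_fst
        sets_pair_measure_cong[OF \<mu>.sets_eq_borel \<nu>.sets_eq_borel])
qed

lemma coupling_marginals:
  assumes coupling: "c \<in> couplings \<mu> \<nu>" and [measurable]: "f \<in> borel_measurable borel"
  shows "(\<integral>\<^sup>+z. f (fst z) \<partial>c) = (\<integral>\<^sup>+x. f x \<partial>\<mu>)" "(\<integral>\<^sup>+z. f (snd z) \<partial>c) = (\<integral>\<^sup>+x. f x \<partial>\<nu>)"
proof -
  note [measurable_cong] = couplingsD(2)[OF coupling]
  show "(\<integral>\<^sup>+z. f (fst z) \<partial>c) = (\<integral>\<^sup>+x. f x \<partial>\<mu>)"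
    unfolding couplingsD(3)[OF coupling, symmetric]
    by (rule nn_integral_distr[symmetric]) measurable
  show "(\<integral>\<^sup>+z. f (snd z) \<partial>c) = (\<integral>\<^sup>+x. f x \<partial>\<nu>)"
    unfolding couplingsD(4)[OF coupling, symmetric]
    by (rule nn_integral_distr[symmetric]) measurable
qed

lemma nn_integral_coupling_add:
  assumes coupling: "c \<in> couplings \<mu> \<nu>" and [measurable]: "J \<in> borel_measurable borel"
    and J_nonneg: "\<And>x. 0 \<le> J x"
  shows "(\<integral>\<^sup>+z. ennreal (J (fst z) + J (snd z)) \<partial>c)
      = (\<integral>\<^sup>+x. ennreal (J x) \<partial>\<mu>) + (\<integral>\<^sup>+x. ennreal (J x) \<partial>\<nu>)"
proof -
  note [measurable_cong] = couplingsD(2)[OF coupling]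
  have "(\<integral>\<^sup>+z. ennreal (J (fst z) + J (snd z)) \<partial>c)
      = (\<integral>\<^sup>+z. ennreal (J (fst z)) \<partial>c) + (\<integral>\<^sup>+z. ennreal (J (snd z)) \<partial>c)"
    using J_nonneg by (subst nn_integral_add[symmetric]) auto
  then show ?thesis
    using coupling_marginals[OF coupling, of "\<lambda>x. ennreal (J x)"] by simp
qed

lemma abs_integral_diff_le_coupling:
  fixes g :: "'a::topological_space \<Rightarrow> real"
  assumes coupling: "c \<in> couplings \<mu> \<nu>" and g_meas [measurable]: "g \<in> borel_measurable borel"
    and "\<And>x. \<bar>g x\<bar> \<le> K"
    and osc_le: "\<And>x y. \<bar>g x - g y\<bar> \<le> \<Psi> (x, y)"
    and integral_osc_le: "(\<integral>\<^sup>+z. ennreal (\<Psi> z) \<partial>c) \<le> ennreal B" "0 \<le> B"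
  shows "\<bar>(\<integral>x. g x \<partial>\<mu>) - (\<integral>x. g x \<partial>\<nu>)\<bar> \<le> B"
proof -
  note [measurable_cong] = couplingsD(2)[OF coupling]
  interpret prob_space c
    by (rule couplingsD(1)[OF coupling])
  have integrable: "integrable c (\<lambda>z. g (fst z))" "integrable c (\<lambda>z. g (snd z))"
    by (auto intro!: integrable_const_bound[where B=K] simp: assms(3))
  have "(\<integral>x. g x \<partial>\<mu>) = (\<integral>z. g (fst z) \<partial>c)" "(\<integral>x. g x \<partial>\<nu>) = (\<integral>z. g (snd z) \<partial>c)"
    unfolding couplingsD(3,4)[OF coupling, symmetric] by (auto intro: integral_distr)
  then have "\<bar>(\<integral>x. g x \<partial>\<mu>) - (\<integral>x. g x \<partial>\<nu>)\<bar> = \<bar>\<integral>z. g (fst z) - g (snd z) \<partial>c\<bar>"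
    using integrable by simp
  also have "\<dots> \<le> (\<integral>z. \<bar>g (fst z) - g (snd z)\<bar> \<partial>c)"
    by (rule integral_abs_bound)
  also have "\<dots> \<le> B"
  proof -
    have "ennreal (\<integral>z. \<bar>g (fst z) - g (snd z)\<bar> \<partial>c) = (\<integral>\<^sup>+z. ennreal \<bar>g (fst z) - g (snd z)\<bar> \<partial>c)"
      using integrable by (intro nn_integral_eq_integral[symmetric]) auto
    also have "\<dots> \<le> (\<integral>\<^sup>+z. ennreal (\<Psi> z) \<partial>c)"
      by (intro nn_integral_mono ennreal_leI) (use osc_le in auto)
    also note integral_osc_le(1)
    finally show ?thesis
      using integral_osc_le(2) by (simp add: ennreal_le_iff)
  qed
  finally show ?thesis .
qed

lemma abs_integral_bLip_diff_le_1:
  assumes "borel_prob_space \<mu>" "borel_prob_space \<nu>" "bLip f"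
  shows "\<bar>(\<integral>x. f x \<partial>\<mu>) - (\<integral>x. f x \<partial>\<nu>)\<bar> \<le> 1"
proof (rule abs_integral_diff_le_coupling)
  show coupling: "\<mu> \<Otimes>\<^sub>M \<nu> \<in> couplings \<mu> \<nu>"
    by (rule product_coupling[OF assms(1,2)])
  show "(\<integral>\<^sup>+z. ennreal 1 \<partial>(\<mu> \<Otimes>\<^sub>M \<nu>)) \<le> ennreal 1"
    using prob_space.emeasure_space_1[OF couplingsD(1)[OF coupling]] by simp
qed (use assms(3) in \<open>auto intro: bLip_measurable bLip_abs_le bLip_osc_le_1\<close>)

lemma nn_integral_Hoelder:
  assumes "prob_space M" and [measurable]: "f \<in> borel_measurable M" "g \<in> borel_measurable M"
    and f_nonneg: "\<And>x. 0 \<le> f x" and g_nonneg: "\<And>x. 0 \<le> (g x :: real)"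
    and A_bounds: "(\<integral>\<^sup>+x. ennreal (f x) \<partial>M) \<le> ennreal A" "0 < A"
    and B_bounds: "(\<integral>\<^sup>+x. ennreal (g x) \<partial>M) \<le> ennreal B" "0 < B"
    and q_bounds: "0 < q" "q < 1"
  shows "(\<integral>\<^sup>+x. ennreal (f x powr (1 - q) * g x powr q) \<partial>M) \<le> ennreal (A powr (1 - q) * B powr q)"
proof -
  interpret prob_space M by fact
  define C where "C = A powr (1 - q) * B powr q"
  define a where "a = C * ((1 - q) / A)"
  define b where "b = C * (q / B)"
  have "0 < C" "0 \<le> a" "0 \<le> b"
    using A_bounds B_bounds q_bounds by (simp_all add: C_def a_def b_def)
  have young: "f x powr (1 - q) * g x powr q \<le> a * f x + b * g x" for x
  proof (cases "f x = 0 \<or> g x = 0")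
    case True
    then show ?thesis
      using \<open>0 \<le> a\<close> \<open>0 \<le> b\<close> f_nonneg[of x] g_nonneg[of x] by auto
  next
    case False
    then have pos: "f x > 0" "g x > 0"
      using f_nonneg[of x] g_nonneg[of x] by auto
    have "f x powr (1 - q) * g x powr q = C * ((f x / A) powr (1 - q) * (g x / B) powr q)"
      using pos A_bounds B_bounds by (simp add: C_def powr_divide)
    also have "\<dots> \<le> C * ((1 - q) * (f x / A) + q * (g x / B))"
      using pos A_bounds B_bounds q_bounds \<open>0 < C\<close>
      by (intro mult_left_mono Youngs_inequality_0) auto
    finally show ?thesis
      by (simp add: a_def b_def algebra_simps)
  qed
  have "(\<integral>\<^sup>+x. ennreal (f x powr (1 - q) * g x powr q) \<partial>M)
      \<le> (\<integral>\<^sup>+x. ennreal a * ennreal (f x) + ennreal b * ennreal (g x) \<partial>M)"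
    using young \<open>0 \<le> a\<close> \<open>0 \<le> b\<close> f_nonneg g_nonneg
    by (intro nn_integral_mono) (simp add: ennreal_leI flip: ennreal_mult ennreal_plus)
  also have "\<dots> = ennreal a * (\<integral>\<^sup>+x. ennreal (f x) \<partial>M) + ennreal b * (\<integral>\<^sup>+x. ennreal (g x) \<partial>M)"
    by (subst nn_integral_add) (auto simp: nn_integral_cmult)
  also have "\<dots> \<le> ennreal a * ennreal A + ennreal b * ennreal B"
    by (intro add_mono mult_left_mono A_bounds B_bounds) auto
  also have "\<dots> = ennreal (a * A + b * B)"
    using \<open>0 \<le> a\<close> \<open>0 \<le> b\<close> A_bounds B_bounds by (simp flip: ennreal_mult ennreal_plus)
  also have "a * A + b * B = C"
    using A_bounds B_bounds by (simp add: a_def b_def field_simps)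
  finally show ?thesis
    by (simp add: C_def)
qed

lemma abs_integral_diff_le_powr:
  fixes g W :: "'a::topological_space \<Rightarrow> real"
  assumes \<mu>: "borel_prob_space \<mu>" and \<nu>: "borel_prob_space \<nu>"
    and g_bounded: "g \<in> borel_measurable borel" "\<And>x. \<bar>g x\<bar> \<le> K"
    and W_meas [measurable]: "W \<in> borel_measurable borel" and W_nonneg: "\<And>x. 0 \<le> W x"
    and osc: "\<And>x y. \<bar>g x - g y\<bar> \<le> C * (W x + W y) powr \<delta>" and "0 \<le> C" "0 < \<delta>" "\<delta> < 1"
    and m_bounds: "(\<integral>\<^sup>+x. ennreal (W x) \<partial>\<mu>) \<le> ennreal m" "0 \<le> m"
    and n_bounds: "(\<integral>\<^sup>+x. ennreal (W x) \<partial>\<nu>) \<le> ennreal n" "0 \<le> n" and "0 < m + n"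
  shows "\<bar>(\<integral>x. g x \<partial>\<mu>) - (\<integral>x. g x \<partial>\<nu>)\<bar> \<le> C * (m + n) powr \<delta>"
proof (rule abs_integral_diff_le_coupling)
  show coupling: "\<mu> \<Otimes>\<^sub>M \<nu> \<in> couplings \<mu> \<nu>"
    by (rule product_coupling[OF \<mu> \<nu>])
  note [measurable_cong] = couplingsD(2)[OF coupling]
  interpret prob_space "\<mu> \<Otimes>\<^sub>M \<nu>"
    by (rule couplingsD(1)[OF coupling])
  let ?W = "\<lambda>z. W (fst z) + W (snd z)"
  have "(\<integral>\<^sup>+z. ennreal (?W z) \<partial>(\<mu> \<Otimes>\<^sub>M \<nu>)) \<le> ennreal m + ennreal n"
    unfolding nn_integral_coupling_add[OF coupling W_meas W_nonneg]
    by (intro add_mono m_bounds n_bounds)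
  then have "(\<integral>\<^sup>+z. ennreal (1 powr (1 - \<delta>) * ?W z powr \<delta>) \<partial>(\<mu> \<Otimes>\<^sub>M \<nu>))
      \<le> ennreal (1 powr (1 - \<delta>) * (m + n) powr \<delta>)"
    using assms by (intro nn_integral_Hoelder) (auto simp: prob_space_axioms emeasure_space_1)
  then have "ennreal C * (\<integral>\<^sup>+z. ennreal (?W z powr \<delta>) \<partial>(\<mu> \<Otimes>\<^sub>M \<nu>))
      \<le> ennreal C * ennreal ((m + n) powr \<delta>)"
    by (intro mult_left_mono) auto
  then show "(\<integral>\<^sup>+z. ennreal (C * ?W z powr \<delta>) \<partial>(\<mu> \<Otimes>\<^sub>M \<nu>)) \<le> ennreal (C * (m + n) powr \<delta>)"
    using \<open>0 \<le> C\<close> by (subst (asm) nn_integral_cmult[symmetric]) (auto simp: ennreal_mult)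
qed (use g_bounded osc \<open>0 \<le> C\<close> in auto)

section \<open>Maximal couplings\<close>

lemma nn_integral_uniform_threshold:
  fixes r :: real and a b :: ennreal
  assumes "0 \<le> r" "r \<le> 1"
  shows "(\<integral>\<^sup>+u. (if u \<le> r then a else b) \<partial>uniform_measure lborel {0..1})
      = ennreal r * a + ennreal (1 - r) * b"
proof -
  have "(\<integral>\<^sup>+u. (if u \<le> r then a else b) \<partial>uniform_measure lborel {0..1::real})
      = (\<integral>\<^sup>+u. (if u \<le> r then a else b) * indicator {0..1} u \<partial>lborel) / emeasure lborel {0..1::real}"
    by (rule nn_integral_uniform_measure) auto
  also have "\<dots> = (\<integral>\<^sup>+u. a * indicator {0..r} u + b * indicator {r<..1} u \<partial>lborel)"
    using assms by (auto intro!: nn_integral_cong simp: divide_ennreal_def split: split_indicator)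
  also have "\<dots> = ennreal r * a + ennreal (1 - r) * b"
    using assms by (simp add: nn_integral_add nn_integral_cmult_indicator mult.commute)
  finally show ?thesis .
qed

lemma prob_diff_le_dTV:
  assumes "prob_space \<mu>" "prob_space \<nu>" "A \<in> sets \<mu>"
  shows "measure \<mu> A - measure \<nu> A \<le> dTV \<mu> \<nu>"
proof -
  have "\<bar>measure \<mu> A - measure \<nu> A\<bar> \<le> dTV \<mu> \<nu>"
    unfolding dTV_def
  proof (rule cSUP_upper)
    show "bdd_above ((\<lambda>A. \<bar>measure \<mu> A - measure \<nu> A\<bar>) ` sets \<mu>)"
    proof (rule bdd_aboveI2)
      fix B show "\<bar>measure \<mu> B - measure \<nu> B\<bar> \<le> 1"
        using prob_space.prob_le_1[OF assms(1), of B] prob_space.prob_le_1[OF assms(2), of B]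
          measure_nonneg[of \<mu> B] measure_nonneg[of \<nu> B] by linarith
    qed
  qed fact
  then show ?thesis
    by linarith
qed

locale density_pair =
  fixes \<sigma> :: "'a measure" and a b :: "'a \<Rightarrow> real"
  assumes a_measurable [measurable]: "a \<in> borel_measurable \<sigma>"
    and b_measurable [measurable]: "b \<in> borel_measurable \<sigma>"
    and a_nonneg: "\<And>x. 0 \<le> a x" and b_nonneg: "\<And>x. 0 \<le> b x"
    and nn_integral_a: "(\<integral>\<^sup>+x. ennreal (a x) \<partial>\<sigma>) = 1"
    and nn_integral_b: "(\<integral>\<^sup>+x. ennreal (b x) \<partial>\<sigma>) = 1"
begin

abbreviation \<mu> :: "'a measure" where "\<mu> \<equiv> density \<sigma> (\<lambda>x. ennreal (a x))"

abbreviation \<nu> :: "'a measure" where "\<nu> \<equiv> density \<sigma> (\<lambda>x. ennreal (b x))"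

definition overlap :: "'a \<Rightarrow> real" where
  "overlap x = min (a x) (b x)"

definition keep :: "'a \<Rightarrow> real" where
  "keep x = (if a x \<le> b x then 1 else b x / a x)"

definition excess :: ennreal where
  "excess = (\<integral>\<^sup>+x. ennreal (b x - overlap x) \<partial>\<sigma>)"

definition residual :: "'a measure" where
  "residual = (if excess = 0 then \<nu> else density \<sigma> (\<lambda>x. ennreal (b x - overlap x) / excess))"

definition maximal_kernel :: "'a \<Rightarrow> 'a measure" where
  "maximal_kernel y =
    distr (uniform_measure lborel {0..1} \<Otimes>\<^sub>M residual) \<sigma> (\<lambda>(u, z). if u \<le> keep y then y else z)"

lemma overlap_measurable [measurable]: "overlap \<in> borel_measurable \<sigma>"
  and keep_measurable [measurable]: "keep \<in> borel_measurable \<sigma>"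
  unfolding overlap_def keep_def by measurable

lemma overlap_bounds: "0 \<le> overlap x" "overlap x \<le> a x" "overlap x \<le> b x"
  using a_nonneg b_nonneg by (auto simp: overlap_def)

lemma keep_bounds: "0 \<le> keep x" "keep x \<le> 1"
  using a_nonneg[of x] b_nonneg[of x] by (auto simp: keep_def divide_simps)

lemma a_mult_keep: "a x * keep x = overlap x"
  using a_nonneg[of x] b_nonneg[of x] by (auto simp: keep_def overlap_def)

lemma prob_space_densities: "prob_space \<mu>" "prob_space \<nu>"
  using nn_integral_a nn_integral_b
  by (auto simp: emeasure_density cong: nn_integral_cong_simp intro!: prob_spaceI)

lemma sets_residual [measurable_cong]: "sets residual = sets \<sigma>"
  by (simp add: residual_def)

lemma nn_integral_overlap_split:
  assumes [measurable]: "f \<in> borel_measurable \<sigma>" and "\<And>x. overlap x \<le> f x"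
  shows "(\<integral>\<^sup>+x. ennreal (f x) \<partial>\<sigma>)
      = (\<integral>\<^sup>+x. ennreal (overlap x) \<partial>\<sigma>) + (\<integral>\<^sup>+x. ennreal (f x - overlap x) \<partial>\<sigma>)"
  using assms overlap_bounds(1) by (subst nn_integral_add[symmetric]) (auto simp flip: ennreal_plus)

lemma overlap_plus_excess: "(\<integral>\<^sup>+x. ennreal (overlap x) \<partial>\<sigma>) + excess = 1"
  using nn_integral_overlap_split[of b] overlap_bounds nn_integral_b by (simp add: excess_def)

lemma excess_le_1: "excess \<le> 1"
  using overlap_plus_excess by (metis le_iff_add add.commute)

lemma excess_less_top: "excess < \<top>"
  using excess_le_1 ennreal_one_less_top by (rule le_less_trans)

lemma excess_eq_a: "(\<integral>\<^sup>+x. ennreal (a x - overlap x) \<partial>\<sigma>) = excess"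
proof -
  have "(\<integral>\<^sup>+x. ennreal (overlap x) \<partial>\<sigma>) + (\<integral>\<^sup>+x. ennreal (a x - overlap x) \<partial>\<sigma>)
      = (\<integral>\<^sup>+x. ennreal (overlap x) \<partial>\<sigma>) + excess"
    using nn_integral_overlap_split[of a] overlap_bounds nn_integral_a overlap_plus_excess by simp
  moreover have "(\<integral>\<^sup>+x. ennreal (overlap x) \<partial>\<sigma>) \<noteq> \<top>"
    using overlap_plus_excess by (auto simp: top_add)
  ultimately show ?thesis
    by (simp add: ennreal_add_left_cancel)
qed

lemma nn_integral_residual:
  assumes [measurable]: "f \<in> borel_measurable \<sigma>"
  shows "excess * (\<integral>\<^sup>+y. f y \<partial>residual) = (\<integral>\<^sup>+y. ennreal (b y - overlap y) * f y \<partial>\<sigma>)"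
proof (cases "excess = 0")
  case True
  then have "AE y in \<sigma>. ennreal (b y - overlap y) = 0"
    unfolding excess_def by (subst (asm) nn_integral_0_iff_AE) auto
  then have "AE y in \<sigma>. ennreal (b y - overlap y) * f y = 0"
    by eventually_elim simp
  then have "(\<integral>\<^sup>+y. ennreal (b y - overlap y) * f y \<partial>\<sigma>) = 0"
    by (subst nn_integral_0_iff_AE) auto
  then show ?thesis
    using True by simp
next
  case False
  have "(\<integral>\<^sup>+y. f y \<partial>residual) = (\<integral>\<^sup>+y. inverse excess * (ennreal (b y - overlap y) * f y) \<partial>\<sigma>)"
    using False by (simp add: residual_def nn_integral_density divide_ennreal_def ac_simps)
  also have "\<dots> = inverse excess * (\<integral>\<^sup>+y. ennreal (b y - overlap y) * f y \<partial>\<sigma>)"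
    by (rule nn_integral_cmult) measurable
  finally have "excess * (\<integral>\<^sup>+y. f y \<partial>residual)
      = (excess / excess) * (\<integral>\<^sup>+y. ennreal (b y - overlap y) * f y \<partial>\<sigma>)"
    by (simp add: divide_ennreal_def mult.assoc)
  also have "excess / excess = 1"
    using False excess_less_top by (intro ennreal_divide_self)
  finally show ?thesis
    by simp
qed

lemma prob_space_residual: "prob_space residual"
proof (cases "excess = 0")
  case True
  then show ?thesis
    by (simp add: residual_def prob_space_densities)
next
  case False
  have "excess * emeasure residual (space residual) = excess * 1"
    using nn_integral_residual[of "\<lambda>_. 1"] by (simp add: excess_def)
  then show ?thesis
    unfolding ennreal_mult_cancel_left using False excess_less_top by (intro prob_spaceI) auto
qed

lemma maximal_kernel_measurable: "maximal_kernel \<in> \<sigma> \<rightarrow>\<^sub>M prob_algebra \<sigma>"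
proof -
  have "prob_space (uniform_measure lborel {0..1::real})"
    by (rule prob_space_uniform_measure) auto
  then have "(\<lambda>_. uniform_measure lborel {0..1::real} \<Otimes>\<^sub>M residual) \<in> \<sigma> \<rightarrow>\<^sub>M prob_algebra (borel \<Otimes>\<^sub>M \<sigma>)"
    using prob_space_residual sets_residual
    by (intro measurable_pair_prob measurable_const) (auto simp: space_prob_algebra)
  then show ?thesis
    unfolding maximal_kernel_def by (rule measurable_distr_prob_space2) (simp add: split_beta')
qed

lemma nn_integral_maximal_kernel:
  assumes y_in_space: "y \<in> space \<sigma>" and [measurable]: "f \<in> borel_measurable \<sigma>"
  shows "(\<integral>\<^sup>+z. f z \<partial>maximal_kernel y)
      = ennreal (keep y) * f y + ennreal (1 - keep y) * (\<integral>\<^sup>+z. f z \<partial>residual)"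
proof -
  interpret R: prob_space residual
    by (rule prob_space_residual)
  have [measurable]: "(\<lambda>(u, z). if u \<le> keep y then y else z)
      \<in> uniform_measure lborel {0..1::real} \<Otimes>\<^sub>M residual \<rightarrow>\<^sub>M \<sigma>"
    using y_in_space by simp
  have "(\<integral>\<^sup>+z. f z \<partial>maximal_kernel y)
      = (\<integral>\<^sup>+w. f (if fst w \<le> keep y then y else snd w) \<partial>(uniform_measure lborel {0..1::real} \<Otimes>\<^sub>M residual))"
    unfolding maximal_kernel_def by (subst nn_integral_distr) (auto simp: split_beta')
  also have "\<dots> = (\<integral>\<^sup>+u. \<integral>\<^sup>+z. f (if u \<le> keep y then y else z) \<partial>residual \<partial>uniform_measure lborel {0..1::real})"
    using y_in_space by (subst R.nn_integral_fst[symmetric]) (auto cong: if_cong)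
  also have "\<dots> = (\<integral>\<^sup>+u. (if u \<le> keep y then f y else (\<integral>\<^sup>+z. f z \<partial>residual)) \<partial>uniform_measure lborel {0..1::real})"
    by (intro nn_integral_cong) (simp add: R.emeasure_space_1)
  also have "\<dots> = ennreal (keep y) * f y + ennreal (1 - keep y) * (\<integral>\<^sup>+z. f z \<partial>residual)"
    by (rule nn_integral_uniform_threshold[OF keep_bounds])
  finally show ?thesis .
qed

lemma nn_integral_move: "(\<integral>\<^sup>+y. ennreal (1 - keep y) \<partial>\<mu>) = excess"
proof -
  have "(\<integral>\<^sup>+y. ennreal (1 - keep y) \<partial>\<mu>) = (\<integral>\<^sup>+y. ennreal (a y) * ennreal (1 - keep y) \<partial>\<sigma>)"
    by (subst nn_integral_density) auto
  also have "\<dots> = (\<integral>\<^sup>+y. ennreal (a y - overlap y) \<partial>\<sigma>)"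
    by (intro nn_integral_cong)
      (use a_nonneg keep_bounds in \<open>simp add: right_diff_distrib a_mult_keep flip: ennreal_mult\<close>)
  finally show ?thesis
    by (simp add: excess_eq_a)
qed

lemma bind_maximal_kernel: "\<mu> \<bind> maximal_kernel = \<nu>"
proof (rule measure_eqI)
  have in_prob_algebra: "\<mu> \<in> space (prob_algebra \<sigma>)"
    by (simp add: space_prob_algebra prob_space_densities)
  show sets: "sets (\<mu> \<bind> maximal_kernel) = sets \<nu>"
    by (simp add: sets_bind'[OF in_prob_algebra maximal_kernel_measurable])
  fix A assume "A \<in> sets (\<mu> \<bind> maximal_kernel)"
  then have A_sets [measurable]: "A \<in> sets \<sigma>"
    using sets by simp
  have sets_kernel: "sets (maximal_kernel y) = sets \<sigma>" for y
    by (simp add: maximal_kernel_def)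
  have "emeasure (\<mu> \<bind> maximal_kernel) A = (\<integral>\<^sup>+y. \<integral>\<^sup>+z. indicator A z \<partial>maximal_kernel y \<partial>\<mu>)"
    using A_sets
    by (subst emeasure_bind_prob_algebra[OF in_prob_algebra maximal_kernel_measurable A_sets])
      (simp add: sets_kernel)
  also have "\<dots> = (\<integral>\<^sup>+y. ennreal (keep y) * indicator A y + ennreal (1 - keep y) * emeasure residual A \<partial>\<mu>)"
    by (intro nn_integral_cong) (simp add: nn_integral_maximal_kernel sets_residual)
  also have "\<dots> = (\<integral>\<^sup>+y. ennreal (keep y) * indicator A y \<partial>\<mu>) + excess * emeasure residual A"
    unfolding nn_integral_move[symmetric] by (subst nn_integral_add) (auto simp: nn_integral_multc)
  also have "(\<integral>\<^sup>+y. ennreal (keep y) * indicator A y \<partial>\<mu>)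
      = (\<integral>\<^sup>+y. ennreal (a y) * (ennreal (keep y) * indicator A y) \<partial>\<sigma>)"
    by (rule nn_integral_density) measurable
  also have "\<dots> = (\<integral>\<^sup>+y. ennreal (overlap y) * indicator A y \<partial>\<sigma>)"
    by (intro nn_integral_cong)
      (use a_nonneg keep_bounds in \<open>simp add: a_mult_keep flip: ennreal_mult mult.assoc\<close>)
  also have "\<dots> + excess * emeasure residual A
      = (\<integral>\<^sup>+y. ennreal (overlap y) * indicator A y + ennreal (b y - overlap y) * indicator A y \<partial>\<sigma>)"
    using nn_integral_residual[of "indicator A"] by (simp add: nn_integral_add sets_residual)
  also have "\<dots> = (\<integral>\<^sup>+y. ennreal (b y) * indicator A y \<partial>\<sigma>)"
    by (intro nn_integral_cong)
      (use overlap_bounds in \<open>auto split: split_indicator simp flip: ennreal_plus\<close>)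
  also have "\<dots> = emeasure \<nu> A"
    by (rule emeasure_density[symmetric]) measurable
  finally show "emeasure (\<mu> \<bind> maximal_kernel) A = emeasure \<nu> A" .
qed

lemma emeasure_excess_set:
  "emeasure \<mu> {x \<in> space \<sigma>. b x < a x} = emeasure \<nu> {x \<in> space \<sigma>. b x < a x} + excess"
proof -
  let ?A = "{x \<in> space \<sigma>. b x < a x}"
  have "emeasure \<mu> ?A = (\<integral>\<^sup>+x. ennreal (a x) * indicator ?A x \<partial>\<sigma>)"
    by (rule emeasure_density) measurable
  also have "\<dots> = (\<integral>\<^sup>+x. ennreal (b x) * indicator ?A x + ennreal (a x - overlap x) \<partial>\<sigma>)"
    by (intro nn_integral_cong)
      (use a_nonneg b_nonneg in \<open>auto simp: overlap_def min_def split: split_indicator simp flip: ennreal_plus\<close>)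
  also have "\<dots> = (\<integral>\<^sup>+x. ennreal (b x) * indicator ?A x \<partial>\<sigma>) + excess"
    unfolding excess_eq_a[symmetric] by (rule nn_integral_add) measurable
  also have "(\<integral>\<^sup>+x. ennreal (b x) * indicator ?A x \<partial>\<sigma>) = emeasure \<nu> ?A"
    by (rule emeasure_density[symmetric]) measurable
  finally show ?thesis .
qed

lemma excess_le_dTV: "excess \<le> ennreal (dTV \<mu> \<nu>)"
proof -
  interpret \<mu>: prob_space \<mu> by (rule prob_space_densities)
  interpret \<nu>: prob_space \<nu> by (rule prob_space_densities)
  let ?A = "{x \<in> space \<sigma>. b x < a x}"
  obtain e where excess_eq: "excess = ennreal e" "0 \<le> e"
    using excess_less_top by (cases excess) auto
  then have "ennreal (measure \<mu> ?A) = ennreal (measure \<nu> ?A + e)"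
    using emeasure_excess_set by (simp add: \<mu>.emeasure_eq_measure \<nu>.emeasure_eq_measure)
  then have "e = measure \<mu> ?A - measure \<nu> ?A"
    using excess_eq(2) by (subst (asm) ennreal_inj) auto
  also have "\<dots> \<le> dTV \<mu> \<nu>"
    by (intro prob_diff_le_dTV prob_space_densities) simp
  finally show ?thesis
    by (simp add: excess_eq ennreal_leI)
qed

lemma nn_integral_maximal_kernel_le:
  assumes "y \<in> space \<sigma>" "f \<in> borel_measurable \<sigma>" and f_le_1: "\<And>z. f z \<le> 1"
  shows "(\<integral>\<^sup>+z. f z \<partial>maximal_kernel y) \<le> f y + ennreal (1 - keep y)"
proof -
  interpret residual: prob_space residual
    by (rule prob_space_residual)
  have "(\<integral>\<^sup>+z. f z \<partial>residual) \<le> (\<integral>\<^sup>+z. 1 \<partial>residual)"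
    by (intro nn_integral_mono f_le_1)
  then have residual_le: "(\<integral>\<^sup>+z. f z \<partial>residual) \<le> 1"
    by (simp add: residual.emeasure_space_1)
  have "(\<integral>\<^sup>+z. f z \<partial>maximal_kernel y)
      = ennreal (keep y) * f y + ennreal (1 - keep y) * (\<integral>\<^sup>+z. f z \<partial>residual)"
    by (rule nn_integral_maximal_kernel[OF assms(1,2)])
  also have "\<dots> \<le> 1 * f y + ennreal (1 - keep y) * 1"
    using keep_bounds residual_le
    by (intro add_mono mult_mono) (auto simp flip: ennreal_1 intro: ennreal_leI)
  finally show ?thesis
    by simp
qed

end

lemma prob_space_density_real:
  assumes "finite_measure \<sigma>" "prob_space \<mu>" "sets \<mu> = sets \<sigma>" "absolutely_continuous \<sigma> \<mu>"
  obtains a :: "'a \<Rightarrow> real" where "a \<in> borel_measurable \<sigma>" "\<And>x. 0 \<le> a x"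
    "\<mu> = density \<sigma> (\<lambda>x. ennreal (a x))"
proof -
  interpret \<sigma>: finite_measure \<sigma> by fact
  interpret \<mu>: prob_space \<mu> by fact
  obtain a :: "'a \<Rightarrow> real" where RN_deriv_eq: "a \<in> borel_measurable \<sigma>"
    "AE x in \<sigma>. RN_deriv \<sigma> \<mu> x = ennreal (a x)" "\<And>x. 0 \<le> a x"
    using \<sigma>.real_RN_deriv[OF \<mu>.finite_measure_axioms assms(4,3)] by metis
  have "\<mu> = density \<sigma> (RN_deriv \<sigma> \<mu>)"
    by (rule \<sigma>.density_RN_deriv[OF assms(4,3), symmetric])
  also have "\<dots> = density \<sigma> (\<lambda>x. ennreal (a x))"
    using RN_deriv_eq by (intro density_cong) auto
  finally show thesis
    using RN_deriv_eq by (intro that) auto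
qed

lemma common_density:
  assumes "prob_space \<mu>" "prob_space \<nu>" and sets: "sets \<nu> = sets \<mu>"
  obtains \<sigma> a b where "density_pair \<sigma> a b" "sets \<sigma> = sets \<mu>"
    "\<mu> = density \<sigma> (\<lambda>x. ennreal (a x))" "\<nu> = density \<sigma> (\<lambda>x. ennreal (b x))"
proof -
  interpret \<mu>: prob_space \<mu> by fact
  interpret \<nu>: prob_space \<nu> by fact
  define \<sigma> where "\<sigma> = sup_measure' \<mu> \<nu>"
  have sets_\<sigma>: "sets \<sigma> = sets \<mu>"
    by (simp add: \<sigma>_def sets)
  have "finite_measure \<sigma>"
  proof
    have "emeasure \<mu> A + emeasure \<nu> B \<le> 2" for A B
      using add_mono[OF \<mu>.measure_le_1 \<nu>.measure_le_1, of A B] by simp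
    then have "emeasure \<sigma> (space \<sigma>) \<le> 2"
      using sets unfolding \<sigma>_def by (subst emeasure_sup_measure') (auto intro!: SUP_least)
    then show "emeasure \<sigma> (space \<sigma>) \<noteq> \<infinity>"
      by (auto simp: top_unique)
  qed
  have "absolutely_continuous \<sigma> \<mu>" "absolutely_continuous \<sigma> \<nu>"
    unfolding absolutely_continuous_def null_sets_def \<sigma>_def
    using le_emeasure_sup_measure'1[OF sets] le_emeasure_sup_measure'2[OF sets] sets
    by (auto simp flip: le_zero_eq intro: order_trans)
  then obtain a b :: "'a \<Rightarrow> real" where
    density_a: "a \<in> borel_measurable \<sigma>" "\<And>x. 0 \<le> a x" "\<mu> = density \<sigma> (\<lambda>x. ennreal (a x))" and
    density_b: "b \<in> borel_measurable \<sigma>" "\<And>x. 0 \<le> b x" "\<nu> = density \<sigma> (\<lambda>x. ennreal (b x))"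
    using prob_space_density_real[OF \<open>finite_measure \<sigma>\<close>] assms sets_\<sigma> by metis
  have "(\<integral>\<^sup>+x. ennreal (f x) \<partial>\<sigma>) = 1"
    if "prob_space (density \<sigma> (\<lambda>x. ennreal (f x)))" "f \<in> borel_measurable \<sigma>" for f
    using prob_space.emeasure_space_1[OF that(1)] that(2)
    by (simp add: emeasure_density cong: nn_integral_cong_simp)
  then have "density_pair \<sigma> a b"
    using density_a density_b \<mu>.prob_space_axioms \<nu>.prob_space_axioms by unfold_locales auto
  then show thesis
    using sets_\<sigma> density_a(3) density_b(3) by (rule that)
qed

text \<open>The bound \<open>b\<close> is the probability of leaving y.\<close>

theorem maximal_coupling_kernel:
  fixes \<mu> \<nu> :: "'a measure"
  assumes "prob_space \<mu>" "prob_space \<nu>" "sets \<nu> = sets \<mu>"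
  obtains \<kappa> b where "\<kappa> \<in> \<mu> \<rightarrow>\<^sub>M prob_algebra \<mu>" "\<mu> \<bind> \<kappa> = \<nu>"
    "b \<in> borel_measurable \<mu>" "(\<integral>\<^sup>+y. b y \<partial>\<mu>) \<le> ennreal (dTV \<mu> \<nu>)"
    "\<And>y f. y \<in> space \<mu> \<Longrightarrow> f \<in> borel_measurable \<mu> \<Longrightarrow> \<forall>z. f z \<le> 1 \<Longrightarrow> (\<integral>\<^sup>+z. f z \<partial>\<kappa> y) \<le> f y + b y"
proof -
  obtain \<sigma> a b where "density_pair \<sigma> a b" and sets: "sets \<sigma> = sets \<mu>"
    and \<mu>_eq: "\<mu> = density \<sigma> (\<lambda>x. ennreal (a x))" and \<nu>_eq: "\<nu> = density \<sigma> (\<lambda>x. ennreal (b x))"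
    using common_density[OF assms] .
  interpret density_pair \<sigma> a b by fact
  have prob_algebra: "prob_algebra \<mu> = prob_algebra \<sigma>"
    unfolding prob_algebra_def by (simp add: subprob_algebra_cong[OF sets])
  show thesis
  proof (rule that[of maximal_kernel "\<lambda>y. ennreal (1 - keep y)"])
    show "maximal_kernel \<in> \<mu> \<rightarrow>\<^sub>M prob_algebra \<mu>"
      using maximal_kernel_measurable by (simp add: prob_algebra measurable_cong_sets[OF sets refl])
    show "\<mu> \<bind> maximal_kernel = \<nu>"
      using bind_maximal_kernel by (simp add: \<mu>_eq \<nu>_eq)
    show "(\<lambda>y. ennreal (1 - keep y)) \<in> borel_measurable \<mu>"
      by (simp add: \<mu>_eq)
    show "(\<integral>\<^sup>+y. ennreal (1 - keep y) \<partial>\<mu>) \<le> ennreal (dTV \<mu> \<nu>)"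
      using nn_integral_move excess_le_dTV by (simp add: \<mu>_eq \<nu>_eq)
    show "(\<integral>\<^sup>+z. f z \<partial>maximal_kernel y) \<le> f y + ennreal (1 - keep y)"
      if "y \<in> space \<mu>" "f \<in> borel_measurable \<mu>" "\<forall>z. f z \<le> 1" for y f
      using that
      by (intro nn_integral_maximal_kernel_le)
        (simp_all add: sets_eq_imp_space_eq[OF sets] measurable_cong_sets[OF sets refl])
  qed
qed

lemma coupling_change_second:
  fixes X Y :: "'w \<Rightarrow> 'a::topological_space" and \<nu> :: "'a measure"
  assumes prob_space_M: "prob_space M" and X_meas [measurable]: "X \<in> M \<rightarrow>\<^sub>M borel"
    and Y_meas [measurable]: "Y \<in> M \<rightarrow>\<^sub>M borel"
    and \<nu>: "borel_prob_space \<nu>" and dTV_le: "dTV (distr M borel Y) \<nu> \<le> e"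
  obtains c where "c \<in> couplings (distr M borel X) \<nu>"
    "\<And>g. g \<in> borel_measurable (borel \<Otimes>\<^sub>M borel) \<Longrightarrow> \<forall>z. g z \<le> 1 \<Longrightarrow>
      (\<integral>\<^sup>+z. g z \<partial>c) \<le> (\<integral>\<^sup>+\<omega>. g (X \<omega>, Y \<omega>) \<partial>M) + ennreal e"
proof -
  interpret M: prob_space M by fact
  interpret \<nu>: borel_prob_space \<nu> by fact
  interpret Y: borel_prob_space "distr M borel Y"
    by (simp add: borel_prob_space_iff M.prob_space_distr)
  have sets: "sets \<nu> = sets (distr M borel Y)"
    by simp
  obtain \<kappa> b where "\<kappa> \<in> distr M borel Y \<rightarrow>\<^sub>M prob_algebra (distr M borel Y)"
    and bind_\<kappa>: "distr M borel Y \<bind> \<kappa> = \<nu>" and "b \<in> borel_measurable (distr M borel Y)"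
    and b_le: "(\<integral>\<^sup>+y. b y \<partial>distr M borel Y) \<le> ennreal (dTV (distr M borel Y) \<nu>)"
    and leave: "\<And>y f. y \<in> space (distr M borel Y) \<Longrightarrow> f \<in> borel_measurable (distr M borel Y) \<Longrightarrow>
      \<forall>z. f z \<le> 1 \<Longrightarrow> (\<integral>\<^sup>+z. f z \<partial>\<kappa> y) \<le> f y + b y"
    by (rule maximal_coupling_kernel[OF Y.prob_space_axioms \<nu>.prob_space_axioms sets], rule that)
  then have kernel: "\<kappa> \<in> borel \<rightarrow>\<^sub>M prob_algebra borel" and b_meas [measurable]: "b \<in> borel_measurable borel"
    by (simp_all add: Y.measurable_iff_borel Y.prob_algebra_eq_borel)
  have bind: "M \<bind> (\<lambda>\<omega>. \<kappa> (Y \<omega>)) = \<nu>"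
    using bind_distr[OF Y_meas measurable_prob_algebraD[OF kernel] M.not_empty]
    by (simp add: bind_\<kappa>)
  note joint = prob_space_M X_meas measurable_compose[OF Y_meas kernel]
  show thesis
  proof (rule that)
    show "joint_law M X (\<lambda>\<omega>. \<kappa> (Y \<omega>)) \<in> couplings (distr M borel X) \<nu>"
      using joint_law_coupling[OF joint] by (simp only: bind)
    fix g :: "'a \<times> 'a \<Rightarrow> ennreal"
    assume [measurable]: "g \<in> borel_measurable (borel \<Otimes>\<^sub>M borel)" and g_le_1: "\<forall>z. g z \<le> 1"
    have "(\<integral>\<^sup>+z. g z \<partial>joint_law M X (\<lambda>\<omega>. \<kappa> (Y \<omega>))) \<le> (\<integral>\<^sup>+\<omega>. g (X \<omega>, Y \<omega>) + b (Y \<omega>) \<partial>M)"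
      by (subst nn_integral_joint_law[OF joint])
        (use g_le_1 in \<open>auto intro!: nn_integral_mono leave\<close>)
    also have "\<dots> = (\<integral>\<^sup>+\<omega>. g (X \<omega>, Y \<omega>) \<partial>M) + (\<integral>\<^sup>+\<omega>. b (Y \<omega>) \<partial>M)"
      by (rule nn_integral_add) measurable
    also have "(\<integral>\<^sup>+\<omega>. b (Y \<omega>) \<partial>M) \<le> ennreal e"
      using b_le dTV_le
      by (subst nn_integral_distr[symmetric, of Y M borel b]) (auto intro: order_trans ennreal_leI)
    finally show "(\<integral>\<^sup>+z. g z \<partial>joint_law M X (\<lambda>\<omega>. \<kappa> (Y \<omega>)))
        \<le> (\<integral>\<^sup>+\<omega>. g (X \<omega>, Y \<omega>) \<partial>M) + ennreal e"
      by (simp add: add_left_mono)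
  qed
qed

section \<open>Concave rate functions\<close>

lemma tangent_bound_of_antimono_derivative:
  fixes f g :: "real \<Rightarrow> real"
  assumes cont: "continuous_on {a..b} f"
    and deriv: "\<And>x. a < x \<Longrightarrow> x < b \<Longrightarrow> (f has_real_derivative g x) (at x)"
    and antimono: "\<And>x y. a \<le> x \<Longrightarrow> x \<le> y \<Longrightarrow> y \<le> b \<Longrightarrow> g y \<le> g x"
    and u_bounds: "a \<le> u" "u \<le> b" and z_bounds: "a \<le> z" "z \<le> b"
  shows "f z \<le> f u + g u * (z - u)"
proof -
  have mean_value: "\<exists>x. p < x \<and> x < r \<and> f r - f p = g x * (r - p)"
    if "a \<le> p" "p < r" "r \<le> b" for p r
  proof -
    have "continuous_on {p..r} f"
      using that by (intro continuous_on_subset[OF cont]) auto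
    moreover have "(f has_derivative (\<lambda>h. g x * h)) (at x)" if "p < x" "x < r" for x
      using deriv[of x] that \<open>a \<le> p\<close> \<open>r \<le> b\<close> by (simp add: has_field_derivative_def)
    ultimately show ?thesis
      using mvt[of p r f "\<lambda>x h. g x * h"] \<open>p < r\<close> by blast
  qed
  consider "z = u" | "u < z" | "z < u"
    by linarith
  then show ?thesis
  proof cases
    case 2
    then obtain x where intermediate: "u < x" "x < z" "f z - f u = g x * (z - u)"
      using mean_value[of u z] u_bounds z_bounds by blast
    then have "g x * (z - u) \<le> g u * (z - u)"
      using antimono[of u x] u_bounds z_bounds by (intro mult_right_mono) auto
    with intermediate(3) show ?thesis
      by linarith
  next
    case 3
    then obtain x where intermediate: "z < x" "x < u" "f u - f z = g x * (u - z)"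
      using mean_value[of z u] u_bounds z_bounds by blast
    then have "g u * (u - z) \<le> g x * (u - z)"
      using antimono[of x u] u_bounds z_bounds by (intro mult_right_mono) auto
    with intermediate(3) show ?thesis
      by (simp add: right_diff_distrib)
  qed simp
qed

locale concave_rate =
  fixes \<phi> :: "real \<Rightarrow> real"
  assumes concave: "concave_on {0..} \<phi>"
    and differentiable: "\<And>s. s \<ge> 0 \<Longrightarrow> \<phi> differentiable (at s within {0..})"
    and phi_nonneg: "\<And>s. s \<ge> 0 \<Longrightarrow> \<phi> s \<ge> 0"
    and mono: "mono_on {0..} \<phi>"
    and at_top: "filterlim \<phi> at_top at_top"
    and phi_0: "\<phi> 0 = 0"
begin

abbreviation \<phi>' :: "real \<Rightarrow> real" where "\<phi>' \<equiv> deriv \<phi>"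

abbreviation H :: "real \<Rightarrow> real" where "H \<equiv> H_phi \<phi>"

abbreviation H_inv :: "real \<Rightarrow> real" where "H_inv \<equiv> H_phi_inv \<phi>"

lemma phi_mono: "0 \<le> x \<Longrightarrow> x \<le> y \<Longrightarrow> \<phi> x \<le> \<phi> y"
  using mono_onD[OF mono, of x y] by auto

lemma phi_unbounded: "\<exists>z>x. \<phi> z > y"
proof -
  have "eventually (\<lambda>z. z > x \<and> \<phi> z > y) at_top"
    using at_top by (intro eventually_conj eventually_gt_at_top) (simp add: filterlim_at_top_dense)
  then show ?thesis
    by (auto dest: eventually_happens)
qed

lemma phi_slope_antimono:
  assumes "0 \<le> x" "x \<le> y"
  shows "x * \<phi> y \<le> y * \<phi> x"
proof (cases "y = 0")
  case False
  with assms have "y > 0"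
    by simp
  have "\<phi> ((1 - x / y) *\<^sub>R 0 + (x / y) *\<^sub>R y) \<ge> (1 - x / y) * \<phi> 0 + (x / y) * \<phi> y"
    using assms \<open>y > 0\<close> by (intro concave_onD[OF concave]) auto
  then have "x / y * \<phi> y \<le> \<phi> x"
    using \<open>y > 0\<close> by (simp add: phi_0)
  then show ?thesis
    using \<open>y > 0\<close> by (simp add: field_simps)
qed (use assms in simp)

lemma phi_pos:
  assumes "x > 0"
  shows "\<phi> x > 0"
proof -
  obtain z where z_large: "z > x" "\<phi> z > 0"
    using phi_unbounded by blast
  then have "0 < x * \<phi> z"
    using assms by simp
  also have "\<dots> \<le> z * \<phi> x"
    using z_large assms by (intro phi_slope_antimono) auto
  finally show ?thesis
    using z_large assms by (simp add: zero_less_mult_iff)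
qed

lemma phi_subadditive:
  assumes "0 \<le> a" "0 \<le> b"
  shows "\<phi> (a + b) \<le> \<phi> a + \<phi> b"
proof (cases "a + b = 0")
  case False
  then have "a + b > 0"
    using assms by simp
  have "a * \<phi> (a + b) \<le> (a + b) * \<phi> a" "b * \<phi> (a + b) \<le> (a + b) * \<phi> b"
    using assms by (auto intro: phi_slope_antimono)
  then have "(a + b) * \<phi> (a + b) \<le> (a + b) * (\<phi> a + \<phi> b)"
    by (simp add: algebra_simps)
  then show ?thesis
    using \<open>a + b > 0\<close> by simp
qed (use assms in \<open>auto simp: phi_0 add_nonneg_eq_0_iff\<close>)

lemma phi_deriv:
  assumes "u > 0"
  shows "(\<phi> has_real_derivative \<phi>' u) (at u)"
proof -
  have "at u within {0..} = at u"
    using assms by (intro at_within_interior) auto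
  then have "\<phi> differentiable at u"
    using differentiable[of u] assms by simp
  then show ?thesis
    by (simp add: DERIV_deriv_iff_real_differentiable)
qed

lemma phi_le_tangent:
  assumes "0 \<le> z" "0 < u"
  shows "\<phi> z \<le> \<phi> u + \<phi>' u * (z - u)"
proof -
  have "- \<phi> z - - \<phi> u \<ge> - \<phi>' u * (z - u)"
  proof (rule convex_on_imp_above_tangent)
    show "convex_on {0..} (\<lambda>x. - \<phi> x)"
      using concave by (simp add: concave_on_def)
    show "((\<lambda>x. - \<phi> x) has_field_derivative - \<phi>' u) (at u within {0..})"
      by (rule has_field_derivative_at_within) (intro DERIV_minus phi_deriv assms)
  qed (use assms in auto)
  then show ?thesis
    by (simp add: algebra_simps)
qed

lemma phi_deriv_antimono:
  assumes "0 < u" "u \<le> v"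
  shows "\<phi>' v \<le> \<phi>' u"
proof (cases "u = v")
  case False
  have "\<phi> v \<le> \<phi> u + \<phi>' u * (v - u)" "\<phi> u \<le> \<phi> v + \<phi>' v * (u - v)"
    using assms by (auto intro: phi_le_tangent)
  then have "0 \<le> (\<phi>' u - \<phi>' v) * (v - u)"
    by (simp add: algebra_simps)
  then show ?thesis
    using assms False by (simp add: zero_le_mult_iff)
qed simp

lemma phi_deriv_pos:
  assumes "0 < u"
  shows "0 < \<phi>' u"
proof -
  obtain z where z_large: "z > u" "\<phi> z > \<phi> u"
    using phi_unbounded by blast
  then have "0 < \<phi>' u * (z - u)"
    using phi_le_tangent[of z u] assms by simp
  then show ?thesis
    using z_large by (simp add: zero_less_mult_iff)
qed

lemma ex_phi_linear_bound: "\<exists>c>0. \<forall>z\<ge>0. \<phi> z \<le> c * z"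
proof -
  obtain l where "(\<phi> has_real_derivative l) (at 0 within {0..})"
    using differentiable[of 0] by (auto simp: real_differentiable_def)
  then have lim: "((\<lambda>h. \<phi> h / h) \<longlongrightarrow> l) (at_right 0)"
    by (simp add: has_field_derivative_iff phi_0 at_within_Ici_at_right)
  have "\<phi> z \<le> (\<bar>l\<bar> + 1) * z" if "z > 0" for z
  proof -
    have "eventually (\<lambda>h. h \<in> {0<..<z}) (at_right 0)"
      using that by (rule eventually_at_right_real)
    then have "eventually (\<lambda>h. \<phi> z / z \<le> \<phi> h / h) (at_right 0)"
    proof eventually_elim
      case (elim h)
      then show ?case
        using phi_slope_antimono[of h z] that by (simp add: field_simps)
    qed
    then have "\<phi> z / z \<le> l"
      by (rule tendsto_lowerbound[OF lim]) simp
    also have "\<dots> \<le> \<bar>l\<bar> + 1"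
      by linarith
    finally show ?thesis
      using that by (simp add: field_simps)
  qed
  then have "\<forall>z\<ge>0. \<phi> z \<le> (\<bar>l\<bar> + 1) * z"
    by (metis phi_0 less_eq_real_def mult_zero_right)
  then show ?thesis
    by (intro exI[of _ "\<bar>l\<bar> + 1"]) auto
qed

definition lin :: real where
  "lin = (SOME c. c > 0 \<and> (\<forall>z\<ge>0. \<phi> z \<le> c * z))"

lemma lin_pos: "0 < lin" and phi_le_linear: "0 \<le> z \<Longrightarrow> \<phi> z \<le> lin * z"
  using someI_ex[OF ex_phi_linear_bound] by (auto simp: lin_def)

lemma continuous_on_phi: "0 < a \<Longrightarrow> continuous_on {a..b} \<phi>"
  by (rule DERIV_continuous_on, rule has_field_derivative_at_within, rule phi_deriv) auto

lemma phi_comp_measurable: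
  assumes [measurable]: "f \<in> borel_measurable M" and "\<And>x. 0 \<le> f x"
  shows "(\<lambda>x. \<phi> (f x)) \<in> borel_measurable M"
proof -
  have [measurable]: "(\<lambda>u. \<phi> (max 0 u)) \<in> borel_measurable borel"
    by (intro borel_measurable_mono monoI phi_mono) auto
  have "(\<lambda>x. \<phi> (max 0 (f x))) \<in> borel_measurable M"
    by measurable
  then show ?thesis
    using assms(2) by (simp add: max_def)
qed

lemma continuous_on_inverse_phi: "0 < a \<Longrightarrow> continuous_on {a..b} (\<lambda>u. 1 / \<phi> u)"
  using phi_pos by (intro continuous_intros continuous_on_phi) (auto simp: less_le)

lemma H_1 [simp]: "H 1 = 0"
  by (simp add: H_phi_def)

lemma continuous_on_H: "1 \<le> a \<Longrightarrow> continuous_on {a..b} H"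
proof -
  have "continuous_on {1..b} H"
    unfolding H_phi_def[abs_def]
    by (intro indefinite_integral_continuous_1 integrable_continuous_real continuous_on_inverse_phi)
        simp
  then show "1 \<le> a \<Longrightarrow> continuous_on {a..b} H"
    by (rule continuous_on_subset) auto
qed

lemma H_deriv:
  assumes "1 < u"
  shows "(H has_real_derivative 1 / \<phi> u) (at u)"
proof -
  have "((\<lambda>u. integral {1..u} (\<lambda>u. 1 / \<phi> u)) has_real_derivative 1 / \<phi> u) (at u within {1..u+1})"
    using assms by (intro integral_has_real_derivative continuous_on_inverse_phi) auto
  moreover have "at u within {1..u+1} = at u"
    using assms by (intro at_within_interior) auto
  ultimately show ?thesis
    by (simp add: H_phi_def[abs_def])
qed

lemma H_strict_mono:
  assumes "1 \<le> x" "x < y"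
  shows "H x < H y"
proof (rule DERIV_pos_imp_increasing_open[OF assms(2)])
  show "\<exists>l. (H has_real_derivative l) (at u) \<and> 0 < l" if "x < u" "u < y" for u
    using that assms phi_pos[of u] by (intro exI[of _ "1 / \<phi> u"]) (auto intro: H_deriv)
qed (rule continuous_on_H[OF assms(1)])

lemma H_mono: "1 \<le> x \<Longrightarrow> x \<le> y \<Longrightarrow> H x \<le> H y"
  using H_strict_mono[of x y] by (cases "x = y") auto

lemma H_le_iff: "1 \<le> x \<Longrightarrow> 1 \<le> y \<Longrightarrow> H x \<le> H y \<longleftrightarrow> x \<le> y"
  using H_mono[of x y] H_strict_mono[of y x] by linarith

lemma H_nonneg: "1 \<le> x \<Longrightarrow> 0 \<le> H x"
  using H_mono[of 1 x] by simp

lemma ln_le_H: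
  assumes "1 \<le> x"
  shows "ln x / lin \<le> H x"
proof -
  have "H 1 - ln 1 / lin \<le> H x - ln x / lin"
  proof (rule DERIV_nonneg_imp_increasing_open[OF assms])
    fix u :: real assume u_bounds: "1 < u" "u < x"
    have "((\<lambda>u. H u - ln u / lin) has_real_derivative 1 / \<phi> u - 1 / u / lin) (at u)"
      using u_bounds lin_pos by (auto intro!: derivative_eq_intros H_deriv)
    moreover have "1 / u / lin \<le> 1 / \<phi> u"
      using u_bounds phi_le_linear[of u] lin_pos phi_pos[of u] by (simp add: field_simps)
    ultimately show "\<exists>y. ((\<lambda>u. H u - ln u / lin) has_real_derivative y) (at u) \<and> 0 \<le> y"
      by force
  qed (use lin_pos in \<open>auto intro!: continuous_intros continuous_on_H\<close>)
  then show ?thesis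
    by simp
qed

lemma H_inv:
  assumes "0 \<le> s"
  shows H_inv_ge_1: "1 \<le> H_inv s" and H_H_inv: "H (H_inv s) = s"
proof -
  let ?x = "exp (lin * s)"
  have "1 \<le> ?x" "s \<le> H ?x"
    using ln_le_H[of ?x] lin_pos assms by auto
  then obtain y where preimage: "1 \<le> y" "H y = s"
    using IVT'[of H 1 s ?x] assms continuous_on_H by auto
  have "H_inv s = y"
    unfolding H_phi_inv_def
  proof (rule the_equality)
    show "z = y" if "1 \<le> z \<and> H z = s" for z
      using that preimage H_le_iff[of z y] H_le_iff[of y z] by simp
  qed (use preimage in simp)
  then show "1 \<le> H_inv s" "H (H_inv s) = s"
    using preimage by auto
qed

lemma H_inv_mono: "0 \<le> s \<Longrightarrow> s \<le> t \<Longrightarrow> H_inv s \<le> H_inv t"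
  using H_inv[of s] H_inv[of t] H_le_iff[of "H_inv s" "H_inv t"] by simp

lemma phi_H_inv_pos: "0 \<le> s \<Longrightarrow> 0 < \<phi> (H_inv s)"
  using H_inv_ge_1[of s] by (intro phi_pos) simp

lemma phi_H_inv_mono: "0 \<le> s \<Longrightarrow> s \<le> t \<Longrightarrow> \<phi> (H_inv s) \<le> \<phi> (H_inv t)"
  using H_inv_ge_1[of s] by (intro phi_mono H_inv_mono) auto

lemma filterlim_phi_H_inv: "filterlim (\<lambda>s. \<phi> (H_inv s)) at_top at_top"
  unfolding filterlim_at_top
proof
  fix Z
  obtain z where z_large: "z > 1" "\<phi> z > Z"
    using phi_unbounded by blast
  show "eventually (\<lambda>s. Z \<le> \<phi> (H_inv s)) at_top"
    using eventually_ge_at_top[of "H z"]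
  proof eventually_elim
    case (elim s)
    then have "0 \<le> s"
      using H_nonneg[of z] z_large by simp
    then have "z \<le> H_inv s"
      using elim H_inv[of s] z_large H_le_iff[of z "H_inv s"] by simp
    then show ?case
      using phi_mono[of z "H_inv s"] z_large by simp
  qed
qed

lemma deriv_scaled_H_minus_ln_phi:
  assumes "1 < u"
  shows "((\<lambda>u. l * H u - ln (\<phi> u)) has_real_derivative (l - \<phi>' u) / \<phi> u) (at u)"
  using assms phi_pos[of u]
  by (auto intro!: derivative_eq_intros H_deriv phi_deriv simp: diff_divide_distrib)

lemma continuous_on_scaled_H_minus_ln_phi:
  assumes "1 \<le> a"
  shows "continuous_on {a..b} (\<lambda>u. l * H u - ln (\<phi> u))"
proof -
  have "\<phi> u \<noteq> 0" if "u \<in> {a..b}" for u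
    using phi_pos[of u] that assms by auto
  then show ?thesis
    using assms by (intro continuous_intros continuous_on_H continuous_on_phi) auto
qed

lemma ln_phi_ratio_le:
  assumes "1 \<le> s" "s \<le> R"
  shows "ln (\<phi> R / \<phi> s) \<le> \<phi>' s * (H R - H s)"
proof -
  have "\<phi>' s * H s - ln (\<phi> s) \<le> \<phi>' s * H R - ln (\<phi> R)"
  proof (rule DERIV_nonneg_imp_increasing_open[OF assms(2)])
    fix u assume u_bounds: "s < u" "u < R"
    have "0 \<le> (\<phi>' s - \<phi>' u) / \<phi> u"
      using u_bounds assms phi_pos[of u] phi_deriv_antimono[of s u] by simp
    then show "\<exists>y. ((\<lambda>u. \<phi>' s * H u - ln (\<phi> u)) has_real_derivative y) (at u) \<and> 0 \<le> y"
      using deriv_scaled_H_minus_ln_phi[of u] u_bounds assms by force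
  qed (rule continuous_on_scaled_H_minus_ln_phi[OF assms(1)])
  then show ?thesis
    using phi_pos[of s] phi_pos[of R] assms by (simp add: ln_div algebra_simps)
qed

lemma exp_H_over_phi_antimono:
  assumes "1 \<le> u" "u \<le> v" "v \<le> s" "l \<le> \<phi>' s"
  shows "exp (l * H v) / \<phi> v \<le> exp (l * H u) / \<phi> u"
proof -
  have "l * H v - ln (\<phi> v) \<le> l * H u - ln (\<phi> u)"
  proof (rule DERIV_nonpos_imp_decreasing_open[OF assms(2)])
    fix x assume x_bounds: "u < x" "x < v"
    have "(l - \<phi>' x) / \<phi> x \<le> 0"
      using x_bounds assms phi_pos[of x] phi_deriv_antimono[of x s] by (simp add: divide_nonpos_pos)
    then show "\<exists>y. ((\<lambda>u. l * H u - ln (\<phi> u)) has_real_derivative y) (at x) \<and> y \<le> 0"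
      using deriv_scaled_H_minus_ln_phi[of x] x_bounds assms by force
  qed (rule continuous_on_scaled_H_minus_ln_phi[OF assms(1)])
  then have "exp (l * H v - ln (\<phi> v)) \<le> exp (l * H u - ln (\<phi> u))"
    by simp
  then show ?thesis
    using assms phi_pos[of u] phi_pos[of v] by (simp add: exp_diff)
qed

definition exp_weight :: "real \<Rightarrow> real \<Rightarrow> real \<Rightarrow> real" where
  "exp_weight l s u = exp (l * H (min u s))"

lemma exp_weight_pos [simp]: "0 < exp_weight l s u"
  by (simp add: exp_weight_def)

lemma exp_weight_ge_1: "0 \<le> l \<Longrightarrow> 1 \<le> s \<Longrightarrow> 1 \<le> u \<Longrightarrow> 1 \<le> exp_weight l s u"
  unfolding exp_weight_def by (simp add: H_nonneg)

lemma exp_weight_mono: "0 \<le> l \<Longrightarrow> 1 \<le> s \<Longrightarrow> 1 \<le> u \<Longrightarrow> u \<le> v \<Longrightarrow> exp_weight l s u \<le> exp_weight l s v"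
  unfolding exp_weight_def by (auto intro!: mult_left_mono H_mono)

lemma exp_weight_le_tangent:
  assumes "1 \<le> u" "u \<le> s" "1 \<le> z" and l_bounds: "0 \<le> l" "l \<le> \<phi>' s"
  shows "exp_weight l s z \<le> exp_weight l s u + l * exp_weight l s u / \<phi> u * (z - u)"
proof -
  have "exp (l * H (min z s)) \<le> exp (l * H u) + l * (exp (l * H u) / \<phi> u) * (min z s - u)"
  proof (rule tangent_bound_of_antimono_derivative[where a=1 and b=s])
    show "continuous_on {1..s} (\<lambda>u. exp (l * H u))"
      by (intro continuous_intros continuous_on_H) simp
    show "((\<lambda>u. exp (l * H u)) has_real_derivative l * (exp (l * H x) / \<phi> x)) (at x)"
      if "1 < x" for x
      using that by (auto intro!: derivative_eq_intros H_deriv)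
    show "l * (exp (l * H y) / \<phi> y) \<le> l * (exp (l * H x) / \<phi> x)" if "1 \<le> x" "x \<le> y" "y \<le> s" for x y
      using that l_bounds by (intro mult_left_mono exp_H_over_phi_antimono)
  qed (use assms in auto)
  also have "\<dots> \<le> exp (l * H u) + l * (exp (l * H u) / \<phi> u) * (z - u)"
    using assms phi_pos[of u] by (intro add_left_mono mult_left_mono) auto
  finally show ?thesis
    using assms by (simp add: exp_weight_def)
qed

end

section \<open>Markov semigroups\<close>

lemma premetric_nonneg: "premetric \<theta> \<Longrightarrow> 0 \<le> \<theta> x y"
  and premetric_pos: "premetric \<theta> \<Longrightarrow> x \<noteq> y \<Longrightarrow> 0 < \<theta> x y"
  by (auto simp: premetric_def less_le)

lemma premetric_measurable:
  fixes \<theta> :: "'a::second_countable_topology \<Rightarrow> 'a \<Rightarrow> real"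
  assumes "premetric \<theta>"
  shows "(\<lambda>z. \<theta> (fst z) (snd z)) \<in> borel_measurable (borel \<Otimes>\<^sub>M borel)"
  unfolding borel_prod
  by (rule borel_measurableI_greater) (use assms in \<open>auto simp: premetric_def\<close>)

lemma has_markov_law_distr:
  assumes "has_markov_law P x M X" "0 \<le> t" "sets (P t x) = sets borel"
  shows "distr M borel (X t) = P t x"
proof (rule measure_eqI)
  have X_meas: "X t \<in> M \<rightarrow>\<^sub>M borel"
    using assms by (auto simp: has_markov_law_def)
  fix A assume "A \<in> sets (distr M borel (X t))"
  then have A_sets: "A \<in> sets borel"
    by simp
  have "emeasure M {\<omega>\<in>space M. \<forall>i<length [(t, A)]. X (\<Sum>j\<le>i. fst ([(t, A)] ! j)) \<omega> \<in> snd ([(t, A)] ! i)}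
      = mkv_fdd P x [(t, A)]"
    using assms(1)[unfolded has_markov_law_def, THEN conjunct2, THEN conjunct2, rule_format, of "[(t, A)]"]
      A_sets assms(2)
    by auto
  then have "emeasure M {\<omega>\<in>space M. X t \<omega> \<in> A} = (\<integral>\<^sup>+y. indicator A y \<partial>P t x)"
    by simp
  moreover have "X t -` A \<inter> space M = {\<omega>\<in>space M. X t \<omega> \<in> A}"
    by auto
  ultimately show "emeasure (distr M borel (X t)) A = emeasure (P t x) A"
    using A_sets assms(3) by (simp add: emeasure_distr[OF X_meas A_sets])
qed (simp add: assms)

locale markov_semigroup =
  fixes P :: "real \<Rightarrow> 'a::polish_space \<Rightarrow> 'a measure"
  assumes markov: "markov_tf P"
begin

abbreviation act :: "real \<Rightarrow> ('a \<Rightarrow> real) \<Rightarrow> 'a \<Rightarrow> real" where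
  "act t f x \<equiv> (\<integral>y. f y \<partial>P t x)"

abbreviation nn_act :: "real \<Rightarrow> ('a \<Rightarrow> real) \<Rightarrow> 'a \<Rightarrow> ennreal" where
  "nn_act t f x \<equiv> (\<integral>\<^sup>+y. ennreal (f y) \<partial>P t x)"

lemma borel_prob_space_P: "0 \<le> t \<Longrightarrow> borel_prob_space (P t x)"
  using markov by (auto simp: markov_tf_def borel_prob_space_iff)

lemma P_0: "P 0 x = return borel x"
  using markov by (auto simp: markov_tf_def)

lemma kernel_P: "0 \<le> t \<Longrightarrow> P t \<in> borel \<rightarrow>\<^sub>M prob_algebra borel"
  using markov by (intro measurable_prob_algebraI measurable_subprob_algebra)
    (auto simp: markov_tf_def prob_space_imp_subprob_space)

lemma subkernel_P: "0 \<le> t \<Longrightarrow> P t \<in> borel \<rightarrow>\<^sub>M subprob_algebra borel"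
  by (rule measurable_prob_algebraD[OF kernel_P])

lemma nn_act_measurable [measurable (raw)]:
  "0 \<le> t \<Longrightarrow> f \<in> borel_measurable borel \<Longrightarrow> nn_act t f \<in> borel_measurable borel"
  by (rule measurable_compose[OF subkernel_P nn_integral_measurable_subprob_algebra]) auto

lemma act_measurable: "0 \<le> t \<Longrightarrow> f \<in> borel_measurable borel \<Longrightarrow> act t f \<in> borel_measurable borel"
  by (rule measurable_compose[OF subkernel_P integral_measurable_subprob_algebra])

lemma abs_act_le: "0 \<le> t \<Longrightarrow> f \<in> borel_measurable borel \<Longrightarrow> (\<And>x. \<bar>f x\<bar> \<le> K) \<Longrightarrow> \<bar>act t f x\<bar> \<le> K"
  by (rule borel_prob_space.abs_integral_le[OF borel_prob_space_P])

lemma act_0: "f \<in> borel_measurable borel \<Longrightarrow> act 0 f x = f x"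
  by (simp add: P_0 integral_return)

context
  fixes \<mu> :: "'a measure" and t :: real
  assumes \<mu>: "borel_prob_space \<mu>" and t: "0 \<le> t"
begin

interpretation \<mu>: borel_prob_space \<mu> by (rule \<mu>)

lemma borel_prob_space_bind_P: "borel_prob_space (\<mu> \<bind> P t)"
  by (rule \<mu>.borel_prob_space_bind) (simp add: \<mu>.measurable_iff_borel kernel_P t)

lemma emeasure_bind_P: "A \<in> sets borel \<Longrightarrow> emeasure (\<mu> \<bind> P t) A = (\<integral>\<^sup>+x. emeasure (P t x) A \<partial>\<mu>)"
  by (rule emeasure_bind_prob_algebra[OF \<mu>.in_prob_algebra kernel_P[OF t]])

lemma nn_integral_bind_P:
  "f \<in> borel_measurable borel \<Longrightarrow> (\<integral>\<^sup>+y. f y \<partial>(\<mu> \<bind> P t)) = (\<integral>\<^sup>+x. \<integral>\<^sup>+y. f y \<partial>P t x \<partial>\<mu>)"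
  using subkernel_P[OF t] by (intro nn_integral_bind) (auto simp: \<mu>.measurable_iff_borel)

lemma integral_bind_P:
  fixes f :: "'a \<Rightarrow> real"
  assumes "f \<in> borel_measurable borel" "\<And>x. \<bar>f x\<bar> \<le> K"
  shows "(\<integral>y. f y \<partial>(\<mu> \<bind> P t)) = (\<integral>x. act t f x \<partial>\<mu>)"
proof (rule integral_bind[where K=borel and B'=1])
  show "AE x in \<mu>. emeasure (P t x) (space (P t x)) \<le> ennreal 1"
    using borel_prob_space_P[OF t]
    by (simp add: borel_prob_space.space_eq_UNIV borel_prob_space.emeasure_UNIV)
qed (use assms subkernel_P[OF t] in \<open>auto simp: \<mu>.measurable_iff_borel \<mu>.finite_measure_axioms\<close>)

end

lemma P_add:
  assumes "0 \<le> s" "0 \<le> t"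
  shows "P (s + t) x = P s x \<bind> P t"
proof (rule measure_eqI)
  have bind: "borel_prob_space (P s x \<bind> P t)" and borel_prob_space_P_add: "borel_prob_space (P (s + t) x)"
    using assms by (intro borel_prob_space_bind_P borel_prob_space_P; simp)+
  show "sets (P (s + t) x) = sets (P s x \<bind> P t)"
    by (simp add: borel_prob_space.sets_eq_borel[OF bind]
        borel_prob_space.sets_eq_borel[OF borel_prob_space_P_add])
  show "emeasure (P (s + t) x) A = emeasure (P s x \<bind> P t) A" if "A \<in> sets (P (s + t) x)" for A
    using that markov assms emeasure_bind_P[OF borel_prob_space_P[OF assms(1)] assms(2)]
    by (auto simp: markov_tf_def borel_prob_space.sets_eq_borel[OF borel_prob_space_P_add])
qed

lemma bind_P_add:
  assumes "borel_prob_space \<mu>" "0 \<le> s" "0 \<le> t"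
  shows "(\<mu> \<bind> P s) \<bind> P t = \<mu> \<bind> P (s + t)"
proof -
  have "P (s + t) = (\<lambda>x. P s x \<bind> P t)"
    using P_add[OF assms(2,3)] by auto
  then show ?thesis
    using assms subkernel_P
    by (subst bind_assoc[where N=borel and R=borel])
      (auto simp: borel_prob_space.measurable_iff_borel)
qed

lemma nn_integral_P_add:
  assumes "0 \<le> s" "0 \<le> t" "f \<in> borel_measurable borel"
  shows "(\<integral>\<^sup>+y. f y \<partial>P (s + t) x) = (\<integral>\<^sup>+z. \<integral>\<^sup>+y. f y \<partial>P t z \<partial>P s x)"
  using assms by (simp add: P_add nn_integral_bind_P borel_prob_space_P)

lemma act_add:
  assumes "0 \<le> s" "0 \<le> t" "f \<in> borel_measurable borel" "\<And>x. \<bar>f x\<bar> \<le> K"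
  shows "act (s + t) f x = act s (act t f) x"
  unfolding P_add[OF assms(1,2)]
  by (rule integral_bind_P[OF borel_prob_space_P[OF assms(1)] assms(2-4)])

end

section \<open>Contraction of weighted oscillations\<close>

definition trunc :: "real \<Rightarrow> ('a \<Rightarrow> 'a \<Rightarrow> real) \<Rightarrow> 'a \<Rightarrow> 'a \<Rightarrow> real" where
  "trunc N \<theta> x y = min 1 (N * \<theta> x y)"

definition osc_bound :: "('a::topological_space \<Rightarrow> 'a \<Rightarrow> real) \<Rightarrow> real \<Rightarrow> ('a \<Rightarrow> real) \<Rightarrow> ('a \<Rightarrow> real) \<Rightarrow> bool" where
  "osc_bound d q J g \<longleftrightarrow> g \<in> borel_measurable borel \<and> bounded (range g) \<and>
     (\<forall>u v. \<bar>g u - g v\<bar> \<le> d u v powr (1 - q) * (J u + J v) powr q)"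

lemma trunc_le_1: "trunc N \<theta> x y \<le> 1"
  by (simp add: trunc_def)

lemma trunc_nonneg: "premetric \<theta> \<Longrightarrow> 0 \<le> N \<Longrightarrow> 0 \<le> trunc N \<theta> x y"
  by (simp add: trunc_def premetric_nonneg)

lemma trunc_pos: "premetric \<theta> \<Longrightarrow> 0 < N \<Longrightarrow> x \<noteq> y \<Longrightarrow> 0 < trunc N \<theta> x y"
  by (simp add: trunc_def premetric_pos)

lemma trunc_mono: "premetric \<theta> \<Longrightarrow> M \<le> N \<Longrightarrow> trunc M \<theta> x y \<le> trunc N \<theta> x y"
  unfolding trunc_def by (intro min.mono order_refl mult_right_mono premetric_nonneg)

lemma trunc_measurable:
  fixes \<theta> :: "'a::second_countable_topology \<Rightarrow> 'a \<Rightarrow> real"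
  assumes "premetric \<theta>"
  shows "(\<lambda>z. trunc N \<theta> (fst z) (snd z)) \<in> borel_measurable (borel \<Otimes>\<^sub>M borel)"
  unfolding trunc_def using premetric_measurable[OF assms] by measurable

lemma coupling_contraction:
  fixes g J :: "'a::topological_space \<Rightarrow> real"
  assumes coupling: "c \<in> couplings \<mu> \<nu>" and q_bounds: "0 < q" "q < 1"
    and d_nonneg: "(\<lambda>z. d (fst z) (snd z)) \<in> borel_measurable (borel \<Otimes>\<^sub>M borel)" "\<And>x y. 0 \<le> d x y"
    and A_bounds: "(\<integral>\<^sup>+z. ennreal (d (fst z) (snd z)) \<partial>c) \<le> ennreal A" "0 < A"
    and J_nonneg: "J \<in> borel_measurable borel" "\<And>x. 0 \<le> J x"
    and B_bounds: "(\<integral>\<^sup>+u. ennreal (J u) \<partial>\<mu>) + (\<integral>\<^sup>+u. ennreal (J u) \<partial>\<nu>) \<le> ennreal B" "0 < B"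
    and osc_bound_g: "osc_bound d q J g"
  shows "\<bar>(\<integral>u. g u \<partial>\<mu>) - (\<integral>u. g u \<partial>\<nu>)\<bar> \<le> A powr (1 - q) * B powr q"
proof -
  note [measurable] = d_nonneg(1) J_nonneg(1)
  note [measurable_cong] = couplingsD(2)[OF coupling]
  obtain K where "\<And>x. \<bar>g x\<bar> \<le> K"
    using osc_bound_g by (auto simp: osc_bound_def bounded_iff)
  with coupling _ show ?thesis
  proof (rule abs_integral_diff_le_coupling)
    let ?\<Psi> = "\<lambda>z. d (fst z) (snd z) powr (1 - q) * (J (fst z) + J (snd z)) powr q"
    show "g \<in> borel_measurable borel" "\<bar>g u - g v\<bar> \<le> ?\<Psi> (u, v)" for u v
      using osc_bound_g by (auto simp: osc_bound_def)
    show "(\<integral>\<^sup>+z. ennreal (?\<Psi> z) \<partial>c) \<le> ennreal (A powr (1 - q) * B powr q)"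
    proof (rule nn_integral_Hoelder[OF couplingsD(1)[OF coupling] _ _ _ _ A_bounds _ B_bounds(2) q_bounds])
      show "(\<integral>\<^sup>+z. ennreal (J (fst z) + J (snd z)) \<partial>c) \<le> ennreal B"
        unfolding nn_integral_coupling_add[OF coupling J_nonneg] by (rule B_bounds(1))
    qed (use d_nonneg(2) J_nonneg(2) in auto)
  qed simp
qed

lemma nn_integral_product_le:
  fixes f :: "'a::topological_space \<times> 'a \<Rightarrow> real"
  assumes "borel_prob_space \<mu>" "borel_prob_space \<nu>" and D_sets: "D \<in> sets borel"
    and f_le: "\<And>z. f z \<le> 1" "\<And>z. z \<in> D \<times> D \<Longrightarrow> f z \<le> 1 / 2"
  shows "(\<integral>\<^sup>+z. ennreal (f z) \<partial>(\<mu> \<Otimes>\<^sub>M \<nu>)) \<le> ennreal (1 - measure \<mu> D * measure \<nu> D / 2)"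
proof -
  interpret \<mu>: borel_prob_space \<mu> by fact
  interpret \<nu>: borel_prob_space \<nu> by fact
  interpret pair_prob_space \<mu> \<nu> ..
  have [measurable]: "D \<times> D \<in> sets (\<mu> \<Otimes>\<^sub>M \<nu>)"
    using D_sets by (intro pair_measureI) simp_all
  have integrable: "integrable (\<mu> \<Otimes>\<^sub>M \<nu>) (\<lambda>z. indicator (D \<times> D) z / 2 :: real)"
    by (intro integrable_const_bound[where B=1]) (auto split: split_indicator)
  have "(\<integral>\<^sup>+z. ennreal (f z) \<partial>(\<mu> \<Otimes>\<^sub>M \<nu>)) \<le> (\<integral>\<^sup>+z. ennreal (1 - indicator (D \<times> D) z / 2) \<partial>(\<mu> \<Otimes>\<^sub>M \<nu>))"
    using f_le by (intro nn_integral_mono ennreal_leI) (auto split: split_indicator)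
  also have "\<dots> = ennreal (\<integral>z. 1 - indicator (D \<times> D) z / 2 \<partial>(\<mu> \<Otimes>\<^sub>M \<nu>))"
    using integrable by (intro nn_integral_eq_integral) (auto split: split_indicator)
  also have "(\<integral>z. 1 - indicator (D \<times> D) z / 2 \<partial>(\<mu> \<Otimes>\<^sub>M \<nu>)) = 1 - prob (D \<times> D) / 2"
    using integrable prob_space by (simp add: space_pair_measure)
  also have "prob (D \<times> D) = measure \<mu> D * measure \<nu> D"
    using D_sets by (simp add: measure_def \<nu>.emeasure_pair_measure_Times enn2real_mult)
  finally show ?thesis .
qed

lemma contraction_constants:
  fixes r L :: "real \<Rightarrow> real"
  assumes r_tendsto: "\<And>s. 0 \<le> s \<Longrightarrow> 0 \<le> r s" "(r \<longlongrightarrow> 0) at_top" and L_nonneg: "\<And>s. 0 \<le> s \<Longrightarrow> 0 \<le> L s"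
    and t_nonneg: "0 \<le> t"
  obtains N N' T where "1 \<le> N" "0 < N'" "0 \<le> T" "N * r T + L T \<le> N'" "N' * r t + L t \<le> N / 2"
proof -
  have "eventually (\<lambda>T. r T < 1 / (4 * (r t + 1)) \<and> 0 \<le> T) at_top"
    using r_tendsto(1)[OF t_nonneg]
    by (intro eventually_conj eventually_ge_at_top order_tendstoD(2)[OF r_tendsto(2)]) auto
  then obtain T where T_bounds: "r T < 1 / (4 * (r t + 1))" "0 \<le> T"
    by (auto dest: eventually_happens)
  have "r T * r t \<le> 1 / (4 * (r t + 1)) * (r t + 1)"
    using T_bounds r_tendsto(1)[OF T_bounds(2)] r_tendsto(1)[OF t_nonneg] by (intro mult_mono) auto
  also have "\<dots> = 1 / 4"
    using r_tendsto(1)[OF t_nonneg] by simp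
  finally have small: "r T * r t \<le> 1 / 4" .
  define N where "N = 1 + 4 * ((L T + 1) * r t + L t)"
  define N' where "N' = N * r T + L T + 1"
  have "1 \<le> N"
    using L_nonneg[OF T_bounds(2)] L_nonneg[OF t_nonneg] r_tendsto(1)[OF t_nonneg]
    by (simp add: N_def)
  then have "N * (r T * r t) \<le> N * (1 / 4)"
    using small by (intro mult_left_mono) auto
  then have "N' * r t + L t \<le> N / 2"
    by (simp add: N'_def algebra_simps) (simp add: N_def algebra_simps)
  moreover have "0 < N'"
    using \<open>1 \<le> N\<close> r_tendsto(1)[OF T_bounds(2)] L_nonneg[OF T_bounds(2)]
    by (simp add: N'_def add_nonneg_pos)
  ultimately show thesis
    using \<open>1 \<le> N\<close> T_bounds(2) by (intro that[of N N' T]) (auto simp: N'_def)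
qed

context markov_semigroup
begin

definition weight :: "real \<Rightarrow> ('a \<Rightarrow> real) \<Rightarrow> bool" where
  "weight T J \<longleftrightarrow> J \<in> borel_measurable borel \<and> (\<exists>j>0. \<forall>x. j \<le> J x) \<and> (\<forall>u. nn_act T J u < \<infinity>)"

definition contracts :: "real \<Rightarrow> ('a \<Rightarrow> 'a \<Rightarrow> real) \<Rightarrow> real \<Rightarrow> 'a \<Rightarrow> 'a \<Rightarrow> real \<Rightarrow> bool" where
  "contracts T d h x y A \<longleftrightarrow> (\<forall>q J g B. 0 < q \<longrightarrow> q < 1 \<longrightarrow> weight T J \<longrightarrow> osc_bound d q J g \<longrightarrow> 0 < B \<longrightarrow>
     nn_act h J x + nn_act h J y \<le> ennreal B \<longrightarrow> \<bar>act h g x - act h g y\<bar> \<le> A powr (1 - q) * B powr q)"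

lemma assumption_A_at_time:
  assumes "assumption_A TYPE('w) P \<theta> r L" "0 \<le> t"
  obtains M :: "'w measure" and X Y where "prob_space M" "X \<in> M \<rightarrow>\<^sub>M borel" "Y \<in> M \<rightarrow>\<^sub>M borel"
    "distr M borel X = P t x" "dTV (distr M borel Y) (P t y) \<le> L t * \<theta> x y"
    "(\<integral>\<^sup>+\<omega>. ennreal (\<theta> (X \<omega>) (Y \<omega>)) \<partial>M) \<le> ennreal (r t * \<theta> x y)"
proof -
  obtain M :: "'w measure" and X Y where markov_law: "has_markov_law P x M X"
    and "Y t \<in> M \<rightarrow>\<^sub>M borel" "dTV (distr M borel (Y t)) (P t y) \<le> L t * \<theta> x y"
      "(\<integral>\<^sup>+\<omega>. ennreal (\<theta> (X t \<omega>) (Y t \<omega>)) \<partial>M) \<le> ennreal (r t * \<theta> x y)"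
    using assms unfolding assumption_A_def
    by (elim conjE) (drule spec[of _ x], drule spec[of _ y], blast)
  moreover have "prob_space M" "X t \<in> M \<rightarrow>\<^sub>M borel"
    using markov_law assms(2) by (auto simp: has_markov_law_def)
  moreover have "distr M borel (X t) = P t x"
    using markov_law assms(2) borel_prob_space_P[OF assms(2)]
    by (simp add: has_markov_law_distr borel_prob_space.sets_eq_borel)
  ultimately show thesis
    by (intro that)
qed

lemma assumption_A_coupling:
  assumes assumption_A: "assumption_A TYPE('w) P \<theta> r L" and premetric: "premetric \<theta>"
    and t_nonneg: "0 \<le> t"
    and N_nonneg: "0 \<le> N" and N'_ge: "N * r t + L t \<le> N'"
  obtains c where "c \<in> couplings (P t x) (P t y)"
    "(\<integral>\<^sup>+z. ennreal (trunc N \<theta> (fst z) (snd z)) \<partial>c) \<le> ennreal (trunc N' \<theta> x y)"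
proof -
  note [measurable] = trunc_measurable[OF premetric, of N]
  have \<theta>_nonneg: "0 \<le> \<theta> x y" for x y
    by (rule premetric_nonneg[OF premetric])
  have rates_nonneg: "0 \<le> r t" "0 \<le> L t"
    using assumption_A t_nonneg by (auto simp: assumption_A_def)
  obtain M :: "'w measure" and X Y where prob_space_M: "prob_space M"
    and X_meas: "X \<in> M \<rightarrow>\<^sub>M borel" and Y_meas: "Y \<in> M \<rightarrow>\<^sub>M borel" and X_law: "distr M borel X = P t x"
    and Y_law: "dTV (distr M borel Y) (P t y) \<le> L t * \<theta> x y"
    and distance_le: "(\<integral>\<^sup>+\<omega>. ennreal (\<theta> (X \<omega>) (Y \<omega>)) \<partial>M) \<le> ennreal (r t * \<theta> x y)"
    by (rule assumption_A_at_time[OF assumption_A t_nonneg])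
  obtain c where coupling: "c \<in> couplings (distr M borel X) (P t y)" and cost:
    "\<And>g. g \<in> borel_measurable (borel \<Otimes>\<^sub>M borel) \<Longrightarrow> \<forall>z. g z \<le> 1 \<Longrightarrow>
       (\<integral>\<^sup>+z. g z \<partial>c) \<le> (\<integral>\<^sup>+\<omega>. g (X \<omega>, Y \<omega>) \<partial>M) + ennreal (L t * \<theta> x y)"
    by (rule coupling_change_second[OF prob_space_M X_meas Y_meas borel_prob_space_P[OF t_nonneg]
        Y_law], rule that)
  have "(\<integral>\<^sup>+z. ennreal (trunc N \<theta> (fst z) (snd z)) \<partial>c)
      \<le> (\<integral>\<^sup>+\<omega>. ennreal (trunc N \<theta> (X \<omega>) (Y \<omega>)) \<partial>M) + ennreal (L t * \<theta> x y)"
    using cost[of "\<lambda>z. ennreal (trunc N \<theta> (fst z) (snd z))"] by (simp add: trunc_le_1)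
  also have "(\<integral>\<^sup>+\<omega>. ennreal (trunc N \<theta> (X \<omega>) (Y \<omega>)) \<partial>M)
      \<le> (\<integral>\<^sup>+\<omega>. ennreal N * ennreal (\<theta> (X \<omega>) (Y \<omega>)) \<partial>M)"
    using N_nonneg \<theta>_nonneg
    by (intro nn_integral_mono) (auto simp: trunc_def simp flip: ennreal_mult intro!: ennreal_leI)
  also have "\<dots> = ennreal N * (\<integral>\<^sup>+\<omega>. ennreal (\<theta> (X \<omega>) (Y \<omega>)) \<partial>M)"
    using measurable_compose[OF measurable_Pair[OF X_meas Y_meas] premetric_measurable[OF premetric]]
    by (intro nn_integral_cmult) simp
  also have "\<dots> \<le> ennreal N * ennreal (r t * \<theta> x y)"
    by (intro mult_left_mono distance_le) auto
  also have "\<dots> + ennreal (L t * \<theta> x y) = ennreal ((N * r t + L t) * \<theta> x y)"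
    using rates_nonneg N_nonneg \<theta>_nonneg[of x y]
    by (simp add: algebra_simps flip: ennreal_mult ennreal_plus)
  also have "\<dots> \<le> ennreal (N' * \<theta> x y)"
    by (intro ennreal_leI mult_right_mono N'_ge \<theta>_nonneg)
  finally have "(\<integral>\<^sup>+z. ennreal (trunc N \<theta> (fst z) (snd z)) \<partial>c) \<le> ennreal (N' * \<theta> x y)"
    by (simp add: add_right_mono)
  moreover have "(\<integral>\<^sup>+z. ennreal (trunc N \<theta> (fst z) (snd z)) \<partial>c) \<le> (\<integral>\<^sup>+z. ennreal 1 \<partial>c)"
    by (intro nn_integral_mono ennreal_leI trunc_le_1)
  ultimately show thesis
    using coupling prob_space.emeasure_space_1[OF couplingsD(1)[OF coupling]]
    by (intro that[of c]) (auto simp: X_law trunc_def min_def)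
qed

lemma osc_bound_act:
  assumes premetric: "premetric \<theta>" and T_nonneg: "0 \<le> T" and N_bounds: "0 \<le> N" "0 < N'"
    and q_bounds: "0 < q" "q < 1"
    and coupling: "\<And>u v. \<exists>c\<in>couplings (P T u) (P T v).
      (\<integral>\<^sup>+z. ennreal (trunc N \<theta> (fst z) (snd z)) \<partial>c) \<le> ennreal (trunc N' \<theta> u v)"
    and J_ge: "J \<in> borel_measurable borel" "0 < j" "\<And>x. j \<le> J x"
    and J_act: "\<And>u. nn_act T J u = ennreal (J' u)" "\<And>u. 0 < J' u"
    and osc_bound_g: "osc_bound (trunc N \<theta>) q J g"
  shows "osc_bound (trunc N' \<theta>) q J' (act T g)"
proof -
  obtain K where g_bound: "\<And>x. \<bar>g x\<bar> \<le> K" and g_meas: "g \<in> borel_measurable borel"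
    using osc_bound_g by (auto simp: osc_bound_def bounded_iff)
  have "\<bar>act T g u - act T g v\<bar> \<le> trunc N' \<theta> u v powr (1 - q) * (J' u + J' v) powr q" for u v
  proof (cases "u = v")
    case False
    obtain c where "c \<in> couplings (P T u) (P T v)"
      "(\<integral>\<^sup>+z. ennreal (trunc N \<theta> (fst z) (snd z)) \<partial>c) \<le> ennreal (trunc N' \<theta> u v)"
      using coupling by blast
    then show ?thesis
    proof (rule coupling_contraction[OF _ q_bounds trunc_measurable[OF premetric]
          trunc_nonneg[OF premetric N_bounds(1)] _ trunc_pos[OF premetric N_bounds(2) False]
          J_ge(1) _ _ _ osc_bound_g])
      show "nn_act T J u + nn_act T J v \<le> ennreal (J' u + J' v)" "0 < J' u + J' v"
        using J_act(2)[of u] J_act(2)[of v] by (simp_all add: J_act(1) less_imp_le)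
      show "0 \<le> J x" for x
        using J_ge(2) J_ge(3)[of x] by linarith
    qed
  qed simp
  then show ?thesis
    using act_measurable[OF T_nonneg g_meas] abs_act_le[OF T_nonneg g_meas g_bound]
    by (auto simp: osc_bound_def bounded_iff)
qed

lemma contracts_by_couplings:
  assumes premetric: "premetric \<theta>" and T_nonneg: "0 \<le> T" and t_nonneg: "0 \<le> t"
    and N_bounds: "0 \<le> N" "0 < N'"
    and coupling: "\<And>u v. \<exists>c\<in>couplings (P T u) (P T v).
      (\<integral>\<^sup>+z. ennreal (trunc N \<theta> (fst z) (snd z)) \<partial>c) \<le> ennreal (trunc N' \<theta> u v)"
    and coupling_xy: "c \<in> couplings (P t x) (P t y)"
      "(\<integral>\<^sup>+z. ennreal (trunc N' \<theta> (fst z) (snd z)) \<partial>c) \<le> ennreal A" "0 < A"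
  shows "contracts T (trunc N \<theta>) (t + T) x y A"
  unfolding contracts_def
proof (intro allI impI)
  fix q J g B
  assume q_bounds: "0 < q"
    "q < 1" and weight: "weight T J" and osc_bound_g: "osc_bound (trunc N \<theta>) q J g"
    and B_bounds: "0 < B" "nn_act (t + T) J x + nn_act (t + T) J y \<le> ennreal B"
  obtain j where J_meas [measurable]: "J \<in> borel_measurable borel" and j_le_J: "0 < j" "\<And>x. j \<le> J x"
    and J_fin: "\<And>u. nn_act T J u < \<infinity>"
    using weight by (auto simp: weight_def)
  obtain K where g_bound: "\<And>x. \<bar>g x\<bar> \<le> K" and g_meas: "g \<in> borel_measurable borel"
    using osc_bound_g by (auto simp: osc_bound_def bounded_iff)
  define J' where "J' u = enn2real (nn_act T J u)" for u
  have nn_act_J: "nn_act T J u = ennreal (J' u)" for u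
    using J_fin[of u] by (simp add: J'_def)
  have J'_meas: "J' \<in> borel_measurable borel"
    unfolding J'_def using nn_act_measurable[OF T_nonneg J_meas] by measurable
  have J'_pos: "0 < J' u" for u
  proof -
    interpret borel_prob_space "P T u"
      by (rule borel_prob_space_P[OF T_nonneg])
    have "(\<integral>\<^sup>+z. ennreal j \<partial>P T u) \<le> nn_act T J u"
      by (intro nn_integral_mono ennreal_leI j_le_J)
    then have "j \<le> J' u"
      using j_le_J(1) by (simp add: nn_act_J ennreal_le_iff2)
    with j_le_J(1) show ?thesis
      by simp
  qed
  have "osc_bound (trunc N' \<theta>) q J' (act T g)"
    by (rule osc_bound_act[OF premetric T_nonneg N_bounds q_bounds coupling J_meas j_le_J nn_act_J
        J'_pos osc_bound_g])
  moreover have "nn_act t J' x + nn_act t J' y \<le> ennreal B"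
    using B_bounds(2) by (simp add: nn_integral_P_add[OF t_nonneg T_nonneg] flip: nn_act_J)
  ultimately have "\<bar>act t (act T g) x - act t (act T g) y\<bar> \<le> A powr (1 - q) * B powr q"
    using trunc_nonneg[OF premetric, of N'] N_bounds(2) J'_pos
    by (intro coupling_contraction[OF coupling_xy(1) q_bounds trunc_measurable[OF premetric] _
        coupling_xy(2,3) J'_meas _ _ B_bounds(1)])
      (auto simp: less_imp_le)
  then show "\<bar>act (t + T) g x - act (t + T) g y\<bar> \<le> A powr (1 - q) * B powr q"
    using act_add[OF t_nonneg T_nonneg g_meas g_bound] by simp
qed

lemma assumption_B1_product_coupling:
  assumes "0 \<le> t" and N_pos: "0 < N" and assumption_B1: "assumption_B1 P \<theta> S t"
  obtains \<kappa> where "0 < \<kappa>" "\<kappa> < 1" "\<And>x y. x \<in> S \<Longrightarrow> y \<in> S \<Longrightarrow>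
    (\<integral>\<^sup>+z. ennreal (trunc N \<theta> (fst z) (snd z)) \<partial>(P t x \<Otimes>\<^sub>M P t y)) \<le> ennreal (1 - \<kappa>)"
proof -
  obtain D m where D_sets: "D \<in> sets borel"
    and D_reachable: "m > 0" "\<And>x. x \<in> S \<Longrightarrow> m \<le> measure (P t x) D"
    and small: "\<And>x y. x \<in> D \<Longrightarrow> y \<in> D \<Longrightarrow> \<theta> x y \<le> 1 / (2 * N)"
    using assumption_B1[unfolded assumption_B1_def, rule_format, of "1 / (2 * N)"] N_pos by auto
  define \<kappa> where "\<kappa> = (min m 1)\<^sup>2 / 2"
  show thesis
  proof (rule that)
    show "0 < \<kappa>" "\<kappa> < 1"
      using D_reachable power_le_one[of "min m 1" 2] by (auto simp: \<kappa>_def)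
    fix x y assume in_S: "x \<in> S" "y \<in> S"
    have "trunc N \<theta> u v \<le> 1 / 2" if "u \<in> D" "v \<in> D" for u v
      using small[OF that] N_pos by (simp add: trunc_def min_le_iff_disj field_simps)
    then have "(\<integral>\<^sup>+z. ennreal (trunc N \<theta> (fst z) (snd z)) \<partial>(P t x \<Otimes>\<^sub>M P t y))
        \<le> ennreal (1 - measure (P t x) D * measure (P t y) D / 2)"
      using D_sets by (intro nn_integral_product_le borel_prob_space_P \<open>0 \<le> t\<close> trunc_le_1) auto
    also have "min m 1 * min m 1 \<le> measure (P t x) D * measure (P t y) D"
      using D_reachable(1) D_reachable(2)[OF in_S(1)] D_reachable(2)[OF in_S(2)]
      by (intro mult_mono) auto
    then have "ennreal (1 - measure (P t x) D * measure (P t y) D / 2) \<le> ennreal (1 - \<kappa>)"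
      by (intro ennreal_leI) (simp add: \<kappa>_def power2_eq_square)
    finally show "(\<integral>\<^sup>+z. ennreal (trunc N \<theta> (fst z) (snd z)) \<partial>(P t x \<Otimes>\<^sub>M P t y))
        \<le> ennreal (1 - \<kappa>)" .
  qed
qed

theorem local_and_small_set_contraction:
  assumes assumption_A: "assumption_A TYPE('w) P \<theta> r L" and premetric: "premetric \<theta>"
    and t_nonneg: "0 \<le> t"
  obtains N T where "1 \<le> N" "0 \<le> T"
    "\<And>x y. x \<noteq> y \<Longrightarrow> contracts T (trunc N \<theta>) (t + T) x y (trunc (N / 2) \<theta> x y)"
    "\<And>S. assumption_B1 P \<theta> S t \<Longrightarrow>
      \<exists>\<kappa>. 0 < \<kappa> \<and> \<kappa> < 1 \<and> (\<forall>x\<in>S. \<forall>y\<in>S. contracts T (trunc N \<theta>) (t + T) x y (1 - \<kappa>))"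
proof -
  have rates: "\<And>s. 0 \<le> s \<Longrightarrow> 0 \<le> r s" "(r \<longlongrightarrow> 0) at_top" "\<And>s. 0 \<le> s \<Longrightarrow> 0 \<le> L s"
    using assumption_A by (auto simp: assumption_A_def)
  obtain N N' T where N_ge_1: "1 \<le> N" and N'_pos: "0 < N'" and T_nonneg: "0 \<le> T"
    and at_T: "N * r T + L T \<le> N'" and at_t: "N' * r t + L t \<le> N / 2"
    using contraction_constants[OF rates t_nonneg] .
  have N_nonneg: "0 \<le> N"
    using N_ge_1 by simp
  have coupling: "\<exists>c\<in>couplings (P T u) (P T v).
      (\<integral>\<^sup>+z. ennreal (trunc N \<theta> (fst z) (snd z)) \<partial>c) \<le> ennreal (trunc N' \<theta> u v)" for u v
    by (rule assumption_A_coupling[OF assumption_A premetric T_nonneg N_nonneg at_T]) blast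
  note contracts = contracts_by_couplings[OF premetric T_nonneg t_nonneg N_nonneg N'_pos coupling]
  show thesis
  proof (rule that[OF N_ge_1 T_nonneg])
    fix x y :: 'a assume "x \<noteq> y"
    obtain c where "c \<in> couplings (P t x) (P t y)"
      "(\<integral>\<^sup>+z. ennreal (trunc N' \<theta> (fst z) (snd z)) \<partial>c) \<le> ennreal (trunc (N / 2) \<theta> x y)"
      using assumption_A_coupling[OF assumption_A premetric t_nonneg less_imp_le[OF N'_pos] at_t] .
    then show "contracts T (trunc N \<theta>) (t + T) x y (trunc (N / 2) \<theta> x y)"
      using N_ge_1 by (intro contracts trunc_pos[OF premetric _ \<open>x \<noteq> y\<close>]) auto
  next
    fix S assume "assumption_B1 P \<theta> S t"
    then obtain \<kappa> where "0 < \<kappa>" "\<kappa> < 1" and small: "\<And>x y. x \<in> S \<Longrightarrow> y \<in> S \<Longrightarrow>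
        (\<integral>\<^sup>+z. ennreal (trunc N' \<theta> (fst z) (snd z)) \<partial>(P t x \<Otimes>\<^sub>M P t y)) \<le> ennreal (1 - \<kappa>)"
      using assumption_B1_product_coupling[OF t_nonneg N'_pos] by metis
    then have "contracts T (trunc N \<theta>) (t + T) x y (1 - \<kappa>)" if "x \<in> S" "y \<in> S" for x y
      using that
      by (intro contracts[OF product_coupling[OF borel_prob_space_P[OF t_nonneg]
          borel_prob_space_P[OF t_nonneg]] small]) auto
    with \<open>0 < \<kappa>\<close> \<open>\<kappa> < 1\<close> show "\<exists>\<kappa>. 0 < \<kappa> \<and> \<kappa> < 1 \<and> (\<forall>x\<in>S. \<forall>y\<in>S. contracts T (trunc N \<theta>) (t + T) x y (1 - \<kappa>))"
      by blast
  qed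
qed

end

section \<open>Discrete-time Lyapunov drift\<close>

lemma nn_integral_le_affine:
  fixes f v :: "'a \<Rightarrow> real"
  assumes "prob_space M" and v_meas [measurable]: "v \<in> borel_measurable M"
    and v_nonneg: "\<And>z. 0 \<le> v z"
    and m_bounds: "(\<integral>\<^sup>+z. ennreal (v z) \<partial>M) \<le> ennreal m" "0 \<le> m"
    and f_le: "\<And>z. 0 \<le> f z" "\<And>z. f z \<le> a + b * v z" and b_nonneg: "0 \<le> b"
  shows "(\<integral>\<^sup>+z. ennreal (f z) \<partial>M) \<le> ennreal (a + b * m)"
proof -
  interpret prob_space M by fact
  have integrable_v: "integrable M v"
    using m_bounds v_nonneg by (intro integrableI_bounded) (auto intro: le_less_trans)
  have "ennreal (\<integral>z. v z \<partial>M) \<le> ennreal m"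
    using m_bounds(1) nn_integral_eq_integral[OF integrable_v] v_nonneg by simp
  then have mean_le: "(\<integral>z. v z \<partial>M) \<le> m"
    using m_bounds(2) by (simp add: ennreal_le_iff)
  have "(\<integral>\<^sup>+z. ennreal (f z) \<partial>M) \<le> (\<integral>\<^sup>+z. ennreal (a + b * v z) \<partial>M)"
    by (intro nn_integral_mono ennreal_leI f_le)
  also have "\<dots> = ennreal (\<integral>z. a + b * v z \<partial>M)"
    using integrable_v order_trans[OF f_le] by (intro nn_integral_eq_integral) auto
  also have "(\<integral>z. a + b * v z \<partial>M) = a + b * (\<integral>z. v z \<partial>M)"
    using integrable_v by (simp add: prob_space)
  also have "ennreal \<dots> \<le> ennreal (a + b * m)"
    using mean_le b_nonneg by (intro ennreal_leI) (simp add: mult_left_mono)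
  finally show ?thesis .
qed

lemma (in markov_semigroup) nn_act_le_affine:
  assumes t_nonneg: "0 \<le> t" and v_nonneg: "v \<in> borel_measurable borel" "\<And>z. 0 \<le> v z"
    and m_bounds: "nn_act t v x \<le> ennreal m" "0 \<le> m"
    and f_le: "\<And>z. 0 \<le> f z" "\<And>z. f z \<le> a + b * v z" and b_nonneg: "0 \<le> b"
  shows "nn_act t f x \<le> ennreal (a + b * m)"
proof -
  interpret borel_prob_space "P t x"
    by (rule borel_prob_space_P[OF t_nonneg])
  show ?thesis
    using v_nonneg
    by (intro nn_integral_le_affine[OF prob_space_axioms _ _ m_bounds f_le b_nonneg])
      (auto simp: measurable_iff_borel)
qed

locale lyapunov_semigroup = markov_semigroup P + concave_rate \<phi>
  for P :: "real \<Rightarrow> 'a::polish_space \<Rightarrow> 'a measure" and \<phi> :: "real \<Rightarrow> real" +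
  fixes V :: "'a \<Rightarrow> real" and K :: real
  assumes V_measurable [measurable]: "V \<in> borel_measurable borel" and V_nonneg: "\<And>x. 0 \<le> V x"
    and K_pos: "0 < K"
    and lyapunov: "\<And>t x. 0 \<le> t \<Longrightarrow>
      nn_act t V x + (\<integral>\<^sup>+s\<in>{0..t}. nn_act s (\<lambda>y. \<phi> (V y)) x \<partial>lborel) \<le> ennreal (V x + K * t)"
begin

lemma phi_V_measurable [measurable]: "(\<lambda>x. \<phi> (V x)) \<in> borel_measurable borel"
  by (rule phi_comp_measurable[OF V_measurable V_nonneg])

lemma phi_V_nonneg: "0 \<le> \<phi> (V x)"
  by (rule phi_nonneg[OF V_nonneg])

lemma nn_act_V_le: "0 \<le> t \<Longrightarrow> nn_act t V x \<le> ennreal (V x + K * t)"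
  by (rule order_trans[OF _ lyapunov]) simp_all

lemma nn_act_phi_V_le:
  assumes "0 \<le> t"
  shows "nn_act t (\<lambda>y. \<phi> (V y)) x \<le> ennreal (\<phi> (V x) + lin * K * t)"
proof (cases "t = 0")
  case True
  then show ?thesis
    by (simp add: P_0 nn_integral_return)
next
  case False
  define u where "u = V x + K * t"
  have u_pos: "u > 0"
    using False assms K_pos V_nonneg[of x] by (simp add: u_def add_nonneg_pos)
  have "nn_act t (\<lambda>y. \<phi> (V y)) x \<le> ennreal ((\<phi> u - \<phi>' u * u) + \<phi>' u * u)"
  proof (rule nn_act_le_affine[OF assms V_measurable V_nonneg])
    show "\<phi> (V z) \<le> (\<phi> u - \<phi>' u * u) + \<phi>' u * V z" for z
      using phi_le_tangent[OF V_nonneg u_pos, of z] by (simp add: algebra_simps)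
  qed (use nn_act_V_le[OF assms, of x] u_pos phi_V_nonneg phi_deriv_pos[OF u_pos] in \<open>auto
      simp: u_def\<close>)
  also have "\<dots> \<le> ennreal (\<phi> (V x) + lin * K * t)"
  proof (rule ennreal_leI)
    have "\<phi> u \<le> \<phi> (V x) + \<phi> (K * t)"
      unfolding u_def using assms K_pos V_nonneg by (intro phi_subadditive) auto
    also have "\<phi> (K * t) \<le> lin * (K * t)"
      using assms K_pos by (intro phi_le_linear) auto
    finally show "(\<phi> u - \<phi>' u * u) + \<phi>' u * u \<le> \<phi> (V x) + lin * K * t"
      by simp
  qed
  finally show ?thesis .
qed

lemma nn_act_phi_V_quasi_mono:
  assumes "0 \<le> s" "s \<le> t"
  shows "nn_act t (\<lambda>y. \<phi> (V y)) x \<le> nn_act s (\<lambda>y. \<phi> (V y)) x + ennreal (lin * K * t)"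
proof -
  interpret borel_prob_space "P s x"
    by (rule borel_prob_space_P[OF assms(1)])
  have "nn_act t (\<lambda>y. \<phi> (V y)) x = (\<integral>\<^sup>+z. nn_act (t - s) (\<lambda>y. \<phi> (V y)) z \<partial>P s x)"
    using nn_integral_P_add[of s "t - s" "\<lambda>y. ennreal (\<phi> (V y))" x] assms by simp
  also have "\<dots> \<le> (\<integral>\<^sup>+z. ennreal (\<phi> (V z)) + ennreal (lin * K * t) \<partial>P s x)"
  proof (rule nn_integral_mono)
    fix z
    have "nn_act (t - s) (\<lambda>y. \<phi> (V y)) z \<le> ennreal (\<phi> (V z) + lin * K * (t - s))"
      using assms by (intro nn_act_phi_V_le) auto
    also have "\<dots> \<le> ennreal (\<phi> (V z) + lin * K * t)"
      using assms lin_pos K_pos by (intro ennreal_leI) auto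
    also have "\<dots> = ennreal (\<phi> (V z)) + ennreal (lin * K * t)"
      using assms lin_pos K_pos phi_V_nonneg by (intro ennreal_plus) auto
    finally show "nn_act (t - s) (\<lambda>y. \<phi> (V y)) z \<le> ennreal (\<phi> (V z)) + ennreal (lin * K * t)" .
  qed
  also have "\<dots> = nn_act s (\<lambda>y. \<phi> (V y)) x + ennreal (lin * K * t)"
    by (subst nn_integral_add) auto
  finally show ?thesis .
qed

text \<open>The integrand of the Lyapunov inequality need not be measurable in time, so its integral
  is only a lower integral; quasi-monotonicity is what bounds it from below.\<close>

lemma nn_integral_time_ge:
  assumes h_pos: "0 < h" and G_eq: "nn_act h (\<lambda>y. \<phi> (V y)) x = ennreal G" "0 \<le> G"
  shows "ennreal (max 0 (G - lin * K * h) * h) \<le> (\<integral>\<^sup>+s\<in>{0..h}. nn_act s (\<lambda>y. \<phi> (V y)) x \<partial>lborel)"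
proof -
  have "ennreal (max 0 (G - lin * K * h) * h)
      = (\<integral>\<^sup>+s. ennreal (max 0 (G - lin * K * h)) * indicator {0..h} s \<partial>lborel)"
    using h_pos by (simp add: nn_integral_cmult_indicator ennreal_mult)
  also have "\<dots> \<le> (\<integral>\<^sup>+s\<in>{0..h}. nn_act s (\<lambda>y. \<phi> (V y)) x \<partial>lborel)"
  proof (rule nn_integral_mono)
    fix s
    show "ennreal (max 0 (G - lin * K * h)) * indicator {0..h} s
        \<le> nn_act s (\<lambda>y. \<phi> (V y)) x * indicator {0..h} s"
    proof (cases "s \<in> {0..h}")
      case True
      then have "nn_act s (\<lambda>y. \<phi> (V y)) x < \<infinity>"
        using nn_act_phi_V_le[of s x] by (auto intro: le_less_trans)
      then obtain F where F_eq: "nn_act s (\<lambda>y. \<phi> (V y)) x = ennreal F" "0 \<le> F"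
        by (cases "nn_act s (\<lambda>y. \<phi> (V y)) x") auto
      have "ennreal G \<le> ennreal F + ennreal (lin * K * h)"
        using nn_act_phi_V_quasi_mono[of s h x] True by (simp add: F_eq G_eq)
      then have "G \<le> F + lin * K * h"
        using F_eq(2) lin_pos K_pos h_pos by (simp add: ennreal_le_iff flip: ennreal_plus)
      then show ?thesis
        using True F_eq by (simp add: ennreal_leI)
    qed simp
  qed
  finally show ?thesis .
qed

definition drift_const :: "real \<Rightarrow> real" where
  "drift_const h = K * h + lin * K * h\<^sup>2"

lemma drift_const_pos: "0 < h \<Longrightarrow> 0 < drift_const h"
  using K_pos lin_pos by (simp add: drift_const_def add_pos_nonneg)

lemma discrete_drift:
  assumes h_pos: "0 < h"
  shows "nn_act h (\<lambda>y. V y + h * \<phi> (V y)) x \<le> ennreal (V x + drift_const h)"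
proof -
  interpret borel_prob_space "P h x"
    using h_pos by (intro borel_prob_space_P) simp
  have "nn_act h (\<lambda>y. \<phi> (V y)) x < \<infinity>" "nn_act h V x < \<infinity>"
    using nn_act_phi_V_le[of h x] nn_act_V_le[of h x] h_pos by (auto intro: le_less_trans)
  then obtain G W where G_eq: "nn_act h (\<lambda>y. \<phi> (V y)) x = ennreal G" "0 \<le> G"
    and nn_act_V: "nn_act h V x = ennreal W" "0 \<le> W"
    by (cases "nn_act h (\<lambda>y. \<phi> (V y)) x"; cases "nn_act h V x") auto
  have "ennreal W + ennreal (max 0 (G - lin * K * h) * h) \<le> ennreal (V x + K * h)"
    using lyapunov[of h x] nn_integral_time_ge[OF h_pos G_eq] h_pos
    by (auto simp: nn_act_V intro: order_trans add_left_mono)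
  then have "W + max 0 (G - lin * K * h) * h \<le> V x + K * h"
    using nn_act_V(2) h_pos V_nonneg[of x] K_pos by (simp add: ennreal_le_iff flip: ennreal_plus)
  moreover have "(G - lin * K * h) * h \<le> max 0 (G - lin * K * h) * h"
    using h_pos by (intro mult_right_mono) auto
  ultimately have "W + h * G \<le> V x + drift_const h"
    by (simp add: drift_const_def algebra_simps power2_eq_square)
  moreover have "nn_act h (\<lambda>y. V y + h * \<phi> (V y)) x
      = (\<integral>\<^sup>+y. ennreal (V y) + ennreal h * ennreal (\<phi> (V y)) \<partial>P h x)"
    using V_nonneg phi_V_nonneg h_pos by (intro nn_integral_cong) (simp add: ennreal_mult)
  moreover have "\<dots> = ennreal (W + h * G)"
    using nn_act_V G_eq h_pos by (subst nn_integral_add) (auto simp: nn_integral_cmult ennreal_mult)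
  ultimately show ?thesis
    by (simp add: ennreal_leI)
qed

text \<open>Adding \<open>h * \<phi> (V x)\<close> turns the time integral into a drift over one step of length h; the
  constant A makes \<open>\<phi> \<circ> shifted A h\<close> large.\<close>

definition shifted :: "real \<Rightarrow> real \<Rightarrow> 'a \<Rightarrow> real" where
  "shifted A h x = A + V x + h * \<phi> (V x)"

lemma shifted_measurable [measurable]: "shifted A h \<in> borel_measurable borel"
  unfolding shifted_def by measurable

lemma shifted_ge: "0 \<le> h \<Longrightarrow> A + V x \<le> shifted A h x"
  by (simp add: shifted_def phi_V_nonneg)

lemma phi_shifted_le:
  assumes "0 \<le> A" "0 \<le> h"
  shows "\<phi> (shifted A h x) \<le> \<phi> A + (1 + h * lin) * \<phi> (V x)"
proof -
  have "\<phi> (shifted A h x) \<le> \<phi> (A + V x) + \<phi> (h * \<phi> (V x))"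
    unfolding shifted_def using assms V_nonneg phi_V_nonneg by (intro phi_subadditive) auto
  also have "\<dots> \<le> (\<phi> A + \<phi> (V x)) + lin * (h * \<phi> (V x))"
    using assms V_nonneg phi_V_nonneg by (intro add_mono phi_subadditive phi_le_linear) auto
  finally show ?thesis
    by (simp add: algebra_simps)
qed

lemma nn_act_shifted_finite:
  assumes "0 \<le> A" "0 \<le> h" "0 \<le> t"
  shows "nn_act t (shifted A h) x < \<infinity>"
proof -
  have "nn_act t (shifted A h) x \<le> ennreal (A + (1 + h * lin) * (V x + K * t))"
  proof (rule nn_act_le_affine[OF assms(3) V_measurable V_nonneg nn_act_V_le[OF assms(3)]])
    show "0 \<le> shifted A h z" for z
      using shifted_ge[OF assms(2), of A z] assms(1) V_nonneg[of z] by linarith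
    have "h * \<phi> (V z) \<le> h * (lin * V z)" for z
      using assms(2) V_nonneg by (intro mult_left_mono phi_le_linear)
    then show "shifted A h z \<le> A + (1 + h * lin) * V z" for z
      by (simp add: shifted_def algebra_simps)
  qed (use assms lin_pos K_pos V_nonneg[of x] in auto)
  then show ?thesis
    by (rule le_less_trans) simp
qed

lemma nn_act_shifted_le:
  assumes "0 \<le> A" "0 < h"
  shows "nn_act h (shifted A h) x \<le> ennreal (A + V x + drift_const h)"
proof -
  have "nn_act h (shifted A h) x \<le> ennreal (A + 1 * (V x + drift_const h))"
  proof (rule nn_act_le_affine[where v="\<lambda>y. V y + h * \<phi> (V y)"])
    show "0 \<le> V x + drift_const h"
      using V_nonneg[of x] drift_const_pos[OF assms(2)] by simp
  qed (use assms V_nonneg phi_V_nonneg discrete_drift[OF assms(2)] in \<open>auto simp: shifted_def\<close>)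
  then show ?thesis
    by (simp add: add.assoc)
qed

lemma shifted_drift_constants:
  assumes h_pos: "0 < h"
  obtains A M \<eta> where "1 \<le> A" "0 < M" "0 < \<eta>" "drift_const h \<le> \<eta> / 4 * \<phi> A"
    "\<And>x. M \<le> shifted A h x \<Longrightarrow> drift_const h + \<eta> * \<phi> (shifted A h x) \<le> h * \<phi> (V x)"
proof -
  define \<eta> where "\<eta> = h / (2 * (1 + h * lin))"
  have lin': "0 < 1 + h * lin"
    using h_pos lin_pos by (simp add: add_pos_pos)
  then have \<eta>_pos: "0 < \<eta>"
    using h_pos by (simp add: \<eta>_def)
  obtain A where A_large: "A > 1" "\<phi> A > 4 * drift_const h / \<eta>"
    using phi_unbounded by blast
  obtain z where z_large: "z > 0" "\<phi> z > 2 * (drift_const h + \<eta> * \<phi> A) / h"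
    using phi_unbounded by blast
  show thesis
  proof (rule that[of A "A + z + h * \<phi> z" \<eta>])
    show "1 \<le> A" "0 < \<eta>" "drift_const h \<le> \<eta> / 4 * \<phi> A"
      using A_large \<eta>_pos by (auto simp: field_simps)
    show "0 < A + z + h * \<phi> z"
      using A_large z_large h_pos phi_nonneg[of z] by (simp add: add_pos_nonneg)
    fix x assume large: "A + z + h * \<phi> z \<le> shifted A h x"
    have "z \<le> V x"
    proof (rule ccontr)
      assume "\<not> z \<le> V x"
      then have "V x < z" "h * \<phi> (V x) \<le> h * \<phi> z"
        using V_nonneg[of x] h_pos by (auto intro!: phi_mono)
      with large show False
        by (simp add: shifted_def)
    qed
    then have "\<phi> z \<le> \<phi> (V x)"
      using z_large by (intro phi_mono) auto
    then have "2 * (drift_const h + \<eta> * \<phi> A) / h \<le> \<phi> (V x)"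
      using z_large by linarith
    then have V_large: "2 * (drift_const h + \<eta> * \<phi> A) \<le> h * \<phi> (V x)"
      using h_pos by (simp add: field_simps)
    have "\<eta> * \<phi> (shifted A h x) \<le> \<eta> * (\<phi> A + (1 + h * lin) * \<phi> (V x))"
      using \<eta>_pos A_large h_pos by (intro mult_left_mono phi_shifted_le) auto
    also have "\<dots> = \<eta> * \<phi> A + h * \<phi> (V x) / 2"
      using lin' by (simp add: \<eta>_def field_simps)
    finally show "drift_const h + \<eta> * \<phi> (shifted A h x) \<le> h * \<phi> (V x)"
      using V_large by (simp add: distrib_left)
  qed
qed

lemma exists_shifted_drift:
  assumes h_pos: "0 < h"
  obtains A M \<eta> where "1 \<le> A" "0 < M" "0 < \<eta>" "\<And>x. drift_const h \<le> \<eta> / 4 * \<phi> (shifted A h x)"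
    "\<And>x. M \<le> shifted A h x \<Longrightarrow> \<eta> * \<phi> (shifted A h x) \<le> shifted A h x"
    "\<And>x. M \<le> shifted A h x \<Longrightarrow>
      nn_act h (shifted A h) x \<le> ennreal (shifted A h x - \<eta> * \<phi> (shifted A h x))"
proof -
  obtain A M \<eta> where A_ge_1: "1 \<le> A" and M_pos: "0 < M"
    and \<eta>_bounds: "0 < \<eta>" "drift_const h \<le> \<eta> / 4 * \<phi> A"
    and large: "\<And>x. M \<le> shifted A h x \<Longrightarrow> drift_const h + \<eta> * \<phi> (shifted A h x) \<le> h * \<phi> (V x)"
    using shifted_drift_constants[OF h_pos] by metis
  show thesis
  proof (rule that[OF A_ge_1 M_pos \<eta>_bounds(1)])
    have A_le: "A \<le> shifted A h x" for x
      using shifted_ge[of h A x] h_pos V_nonneg[of x] by simp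
    show "drift_const h \<le> \<eta> / 4 * \<phi> (shifted A h x)" for x
      using \<eta>_bounds A_ge_1 by (intro order_trans[OF \<eta>_bounds(2)] mult_left_mono phi_mono A_le) auto
    fix x assume "M \<le> shifted A h x"
    from large[OF this] have drift:
      "A + V x + drift_const h \<le> shifted A h x - \<eta> * \<phi> (shifted A h x)"
      by (simp add: shifted_def)
    then show "\<eta> * \<phi> (shifted A h x) \<le> shifted A h x"
      using A_ge_1 V_nonneg[of x] drift_const_pos[OF h_pos] by linarith
    show "nn_act h (shifted A h) x \<le> ennreal (shifted A h x - \<eta> * \<phi> (shifted A h x))"
      using h_pos A_ge_1 drift by (intro order_trans[OF nn_act_shifted_le] ennreal_leI) auto
  qed
qed

end

section \<open>Contraction of the skeleton chain\<close>

locale subgeometric_chain = markov_semigroup P + concave_rate \<phi>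
  for P :: "real \<Rightarrow> 'a::polish_space \<Rightarrow> 'a measure" and \<phi> :: "real \<Rightarrow> real" +
  fixes \<theta> :: "'a \<Rightarrow> 'a \<Rightarrow> real" and N T h M k \<eta> \<kappa> :: real and v :: "'a \<Rightarrow> real"
  assumes h_pos: "0 < h" and N_ge_1: "1 \<le> N" and T_nonneg: "0 \<le> T"
    and premetric_\<theta>: "premetric \<theta>" and bdist_le_\<theta>: "\<And>x y. bdist x y \<le> \<theta> x y"
    and local_contraction: "\<And>x y. x \<noteq> y \<Longrightarrow> contracts T (trunc N \<theta>) h x y (trunc (N / 2) \<theta> x y)"
    and \<kappa>_bounds: "0 < \<kappa>" "\<kappa> < 1"
    and small_set: "\<And>x y. v x \<le> M \<Longrightarrow> v y \<le> M \<Longrightarrow> contracts T (trunc N \<theta>) h x y (1 - \<kappa>)"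
    and v_measurable [measurable]: "v \<in> borel_measurable borel" and v_ge_1: "\<And>x. 1 \<le> v x"
    and \<eta>_pos: "0 < \<eta>" and k_pos: "0 < k" and k_le: "\<And>x. k \<le> \<eta> / 4 * \<phi> (v x)"
    and growth: "\<And>x. nn_act h v x \<le> ennreal (v x + k)"
    and drift: "\<And>x. M \<le> v x \<Longrightarrow> \<eta> * \<phi> (v x) \<le> v x"
      "\<And>x. M \<le> v x \<Longrightarrow> nn_act h v x \<le> ennreal (v x - \<eta> * \<phi> (v x))"
    and nn_act_v_finite: "\<And>x. nn_act T v x < \<infinity>"
begin

lemma h_nonneg: "0 \<le> h"
  using h_pos by simp

lemma time_nonneg: "0 \<le> real n * h"
  using h_pos by simp

lemma act_Suc_times:
  assumes "f \<in> borel_measurable borel" "\<And>x. \<bar>f x\<bar> \<le> B"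
  shows "act (real (Suc n) * h) f x = act h (act (real n * h) f) x"
  using act_add[OF h_nonneg time_nonneg assms, of n x] by (simp add: algebra_simps)

lemma v_nonneg: "0 \<le> v x"
  using v_ge_1[of x] by simp

lemma phi_v_pos: "0 < \<phi> (v x)"
  using v_ge_1[of x] by (intro phi_pos) simp

lemma phi_v_measurable [measurable]: "(\<lambda>x. \<phi> (v x)) \<in> borel_measurable borel"
  by (rule phi_comp_measurable[OF v_measurable v_nonneg])

lemma trunc_N_nonneg: "0 \<le> trunc N \<theta> x y"
  using N_ge_1 by (intro trunc_nonneg premetric_\<theta>) simp

lemma bdist_le_trunc: "bdist x y \<le> trunc N \<theta> x y"
proof -
  have "1 * \<theta> x y \<le> N * \<theta> x y"
    by (intro mult_right_mono N_ge_1 premetric_nonneg premetric_\<theta>)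
  then show ?thesis
    using bdist_le_\<theta>[of x y] by (simp add: trunc_def)
qed

lemma exp_weight_v_measurable:
  assumes "0 \<le> l" "1 \<le> s"
  shows "(\<lambda>x. exp_weight l s (v x)) \<in> borel_measurable borel"
proof -
  have [measurable]: "(\<lambda>u. exp_weight l s (max 1 u)) \<in> borel_measurable borel"
    using assms by (intro borel_measurable_mono monoI exp_weight_mono) auto
  have "(\<lambda>x. exp_weight l s (max 1 (v x))) \<in> borel_measurable borel"
    by measurable
  then show ?thesis
    using v_ge_1 by (simp add: max_def)
qed

end

locale lyapunov_weight = subgeometric_chain P \<phi> \<theta> N T h M k \<eta> \<kappa> v
  for P :: "real \<Rightarrow> 'a::polish_space \<Rightarrow> 'a measure" and \<phi> \<theta> N T h M k \<eta> \<kappa> v +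
  fixes q l s \<beta> \<Lambda> :: real
  assumes q_bounds: "0 < q" "q < 1" and l_bounds: "0 < l" "l \<le> \<phi>' s" "\<eta> / 4 * l < 1"
    and s_ge_1: "1 \<le> s" and \<beta>_pos: "0 < \<beta>"
    and growth_factor: "1 + 2 * \<beta> * k \<le> \<Lambda>" "1 + \<eta> / 4 * l \<le> \<Lambda> * (1 - \<eta> / 4 * l)"
      "\<Lambda> powr q \<le> 2 powr (1 - q)" "(1 - \<kappa>) powr (1 - q) * \<Lambda> powr q \<le> 1"
begin

abbreviation b :: real where "b \<equiv> 1 - \<eta> / 4 * l"

abbreviation w :: "'a \<Rightarrow> real" where "w x \<equiv> exp_weight l s (v x)"

definition J :: "nat \<Rightarrow> 'a \<Rightarrow> real" where
  "J n x = b ^ n * w x + (1 / 2 + \<beta> * v x) / (\<beta> * s)"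

lemma b_bounds: "0 < b" "b \<le> 1"
  using l_bounds \<eta>_pos by auto

lemma b_power_nonneg: "0 \<le> b ^ n"
  using b_bounds by simp

lemma \<beta>s_pos: "0 < \<beta> * s"
  using \<beta>_pos s_ge_1 by simp

lemma \<Lambda>_pos: "0 < \<Lambda>"
proof -
  have "0 < 1 + 2 * \<beta> * k"
    using \<beta>_pos k_pos by (simp add: add_pos_pos)
  then show ?thesis
    using growth_factor(1) by linarith
qed

lemma w_ge_1: "1 \<le> w x"
  using l_bounds s_ge_1 v_ge_1 by (intro exp_weight_ge_1) auto

lemma J_ge_linear: "(1 / 2 + \<beta> * v x) / (\<beta> * s) \<le> J n x"
  using b_power_nonneg w_ge_1[of x] by (simp add: J_def)

lemma J_ge: "1 / (2 * \<beta> * s) \<le> J n x"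
proof -
  have "1 / (2 * \<beta> * s) = (1 / 2) / (\<beta> * s)"
    by simp
  also have "\<dots> \<le> (1 / 2 + \<beta> * v x) / (\<beta> * s)"
    using \<beta>_pos \<beta>s_pos v_nonneg[of x] by (intro divide_right_mono) auto
  finally show ?thesis
    using J_ge_linear[of x n] by linarith
qed

lemma J_pos: "0 < J n x"
proof -
  have "0 < 1 / (2 * \<beta> * s)"
    using \<beta>_pos s_ge_1 by simp
  then show ?thesis
    using J_ge[of n x] by linarith
qed

lemma J_measurable [measurable]: "J n \<in> borel_measurable borel"
proof -
  have [measurable]: "(\<lambda>x. w x) \<in> borel_measurable borel"
    using l_bounds s_ge_1 by (intro exp_weight_v_measurable) auto
  show ?thesis
    unfolding J_def by measurable
qed

lemma nn_act_J_le:
  assumes t_nonneg: "0 \<le> t" and m_bounds: "nn_act t v x \<le> ennreal m" "0 \<le> m"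
    and w_le: "0 \<le> a1" "\<And>z. w z \<le> a0 + a1 * v z"
  shows "nn_act t (J n) x \<le> ennreal (b ^ n * (a0 + a1 * m) + (1 / 2 + \<beta> * m) / (\<beta> * s))"
proof -
  have "nn_act t (J n) x \<le> ennreal ((b ^ n * a0 + (1 / 2) / (\<beta> * s)) + (b ^ n * a1 + 1 / s) * m)"
  proof (rule nn_act_le_affine[OF t_nonneg v_measurable v_nonneg m_bounds])
    show "0 \<le> J n z" for z
      using J_pos[of n z] by simp
    show "0 \<le> b ^ n * a1 + 1 / s"
      using b_power_nonneg w_le(1) s_ge_1 by simp
    fix z
    have "b ^ n * w z \<le> b ^ n * (a0 + a1 * v z)"
      by (intro mult_left_mono w_le b_power_nonneg)
    then show "J n z \<le> (b ^ n * a0 + (1 / 2) / (\<beta> * s)) + (b ^ n * a1 + 1 / s) * v z"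
      using \<beta>_pos by (simp add: J_def distrib_left distrib_right add_divide_distrib mult.assoc)
  qed
  also have "(b ^ n * a0 + (1 / 2) / (\<beta> * s)) + (b ^ n * a1 + 1 / s) * m
      = b ^ n * (a0 + a1 * m) + (1 / 2 + \<beta> * m) / (\<beta> * s)"
    using \<beta>_pos by (simp add: distrib_left distrib_right add_divide_distrib mult.assoc)
  finally show ?thesis .
qed

lemma nn_act_J_le_tangent:
  assumes "0 \<le> t" "nn_act t v x \<le> ennreal m" "0 \<le> m" "1 \<le> u" "u \<le> s"
  shows "nn_act t (J n) x \<le> ennreal (b ^ n * (exp_weight l s u + l * exp_weight l s u / \<phi> u * (m - u))
    + (1 / 2 + \<beta> * m) / (\<beta> * s))"
proof -
  define a where "a = l * exp_weight l s u / \<phi> u"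
  have "0 \<le> a"
    using l_bounds phi_pos[of u] assms by (simp add: a_def less_imp_le)
  moreover have "w z \<le> exp_weight l s u - a * u + a * v z" for z
    using exp_weight_le_tangent[of u s "v z" l] assms l_bounds v_ge_1
    by (simp add: a_def right_diff_distrib)
  ultimately have "nn_act t (J n) x
      \<le> ennreal (b ^ n * (exp_weight l s u - a * u + a * m) + (1 / 2 + \<beta> * m) / (\<beta> * s))"
    by (intro nn_act_J_le assms)
  also have "exp_weight l s u - a * u + a * m = exp_weight l s u + a * (m - u)"
    by (simp add: right_diff_distrib)
  finally show ?thesis
    unfolding a_def .
qed

lemma weight_J: "weight T (J n)"
  unfolding weight_def
proof (intro conjI J_measurable exI[of _ "1 / (2 * \<beta> * s)"] allI J_ge)
  show "0 < 1 / (2 * \<beta> * s)"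
    using \<beta>_pos s_ge_1 by simp
  fix x
  obtain m where "nn_act T v x \<le> ennreal m" "0 \<le> m"
    using nn_act_v_finite[of x] by (cases "nn_act T v x") auto
  from nn_act_J_le_tangent[OF T_nonneg this order_refl s_ge_1] show "nn_act T (J n) x < \<infinity>"
    by (rule le_less_trans) simp
qed

lemma nn_act_J_growth:
  "nn_act h (J n) x \<le> ennreal (b ^ n * ((1 + \<eta> / 4 * l) * w x) + (1 / 2 + \<beta> * (v x + k)) / (\<beta> * s))"
proof (cases "v x \<le> s")
  case True
  have "nn_act h (J n) x
      \<le> ennreal (b ^ n * (w x + l * w x / \<phi> (v x) * (v x + k - v x)) + (1 / 2 + \<beta> * (v x + k)) / (\<beta> * s))"
    using v_ge_1[of x] k_pos True by (intro nn_act_J_le_tangent h_nonneg growth) auto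
  also have "\<dots> \<le> ennreal (b ^ n * ((1 + \<eta> / 4 * l) * w x) + (1 / 2 + \<beta> * (v x + k)) / (\<beta> * s))"
  proof (intro ennreal_leI add_right_mono mult_left_mono b_power_nonneg)
    have "k / \<phi> (v x) \<le> \<eta> / 4"
      using k_le[of x] phi_v_pos[of x] by (simp add: pos_divide_le_eq)
    then have "(l * w x) * (k / \<phi> (v x)) \<le> (l * w x) * (\<eta> / 4)"
      using l_bounds by (intro mult_left_mono) (auto simp: less_imp_le)
    then show "w x + l * w x / \<phi> (v x) * (v x + k - v x) \<le> (1 + \<eta> / 4 * l) * w x"
      by (simp add: algebra_simps)
  qed
  finally show ?thesis .
next
  case False
  have "w z \<le> w x" for z
    using False l_bounds s_ge_1 v_ge_1 unfolding exp_weight_def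
    by (auto intro!: mult_left_mono H_mono)
  then have "nn_act h (J n) x
      \<le> ennreal (b ^ n * (w x + 0 * (v x + k)) + (1 / 2 + \<beta> * (v x + k)) / (\<beta> * s))"
    using v_nonneg[of x] k_pos by (intro nn_act_J_le h_nonneg growth) auto
  also have "\<dots> \<le> ennreal (b ^ n * ((1 + \<eta> / 4 * l) * w x) + (1 / 2 + \<beta> * (v x + k)) / (\<beta> * s))"
    using l_bounds \<eta>_pos
    by (intro ennreal_leI add_right_mono mult_left_mono b_power_nonneg) (simp add: less_imp_le)
  finally show ?thesis .
qed

lemma nn_act_J_decay:
  assumes "M \<le> v x" "v x \<le> s"
  shows "nn_act h (J n) x
      \<le> ennreal (b ^ n * ((1 - \<eta> * l) * w x) + (1 / 2 + \<beta> * (v x - \<eta> * \<phi> (v x))) / (\<beta> * s))"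
proof -
  have "nn_act h (J n) x \<le> ennreal (b ^ n * (w x + l * w x / \<phi> (v x) * (v x - \<eta> * \<phi> (v x) - v x))
      + (1 / 2 + \<beta> * (v x - \<eta> * \<phi> (v x))) / (\<beta> * s))"
    using v_ge_1[of x] assms drift[OF assms(1)] by (intro nn_act_J_le_tangent h_nonneg) auto
  also have "w x + l * w x / \<phi> (v x) * (v x - \<eta> * \<phi> (v x) - v x) = (1 - \<eta> * l) * w x"
    using phi_v_pos[of x] by (simp add: field_simps)
  finally show ?thesis .
qed

lemma nn_act_J_le_factor: "nn_act h (J n) x \<le> ennreal (\<Lambda> * J (Suc n) x)"
proof (rule order_trans[OF nn_act_J_growth ennreal_leI])
  have "(1 + \<eta> / 4 * l) * w x \<le> \<Lambda> * b * w x"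
    by (intro mult_right_mono growth_factor(2)) (simp add: less_imp_le)
  then have exponential: "b ^ n * ((1 + \<eta> / 4 * l) * w x) \<le> b ^ n * (\<Lambda> * b * w x)"
    by (intro mult_left_mono b_power_nonneg)
  have "(1 + 2 * \<beta> * k) * (1 / 2 + \<beta> * v x) \<le> \<Lambda> * (1 / 2 + \<beta> * v x)"
    using growth_factor(1) \<beta>_pos v_nonneg[of x] by (intro mult_right_mono) auto
  moreover have "0 \<le> 2 * \<beta> * k * (\<beta> * v x)"
    using \<beta>_pos k_pos v_nonneg[of x] by simp
  ultimately have "1 / 2 + \<beta> * (v x + k) \<le> \<Lambda> * (1 / 2 + \<beta> * v x)"
    by (simp add: algebra_simps)
  then have "(1 / 2 + \<beta> * (v x + k)) / (\<beta> * s) \<le> \<Lambda> * (1 / 2 + \<beta> * v x) / (\<beta> * s)"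
    using \<beta>s_pos by (intro divide_right_mono) auto
  with exponential show "b ^ n * ((1 + \<eta> / 4 * l) * w x) + (1 / 2 + \<beta> * (v x + k)) / (\<beta> * s)
      \<le> \<Lambda> * J (Suc n) x"
    by (simp add: J_def distrib_left mult_ac)
qed

lemma J_add: "J n x + J n y
    = b ^ n * (w x + w y) + ((1 / 2 + \<beta> * v x) + (1 / 2 + \<beta> * v y)) / (\<beta> * s)"
  by (simp add: J_def distrib_left add_divide_distrib)

lemma nn_act_J_le_imp_pos:
  assumes "nn_act h (J n) x \<le> ennreal B"
  shows "0 < B"
proof -
  interpret borel_prob_space "P h x"
    by (rule borel_prob_space_P[OF h_nonneg])
  have "ennreal (1 / (2 * \<beta> * s)) = (\<integral>\<^sup>+u. ennreal (1 / (2 * \<beta> * s)) \<partial>P h x)"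
    by (simp add: emeasure_space_1)
  also have "\<dots> \<le> nn_act h (J n) x"
    by (intro nn_integral_mono ennreal_leI J_ge)
  also note assms
  finally have "1 / (2 * \<beta> * s) \<le> B \<or> 1 / (2 * \<beta> * s) \<le> 0"
    by (auto simp: ennreal_le_iff2)
  moreover have "0 < 1 / (2 * \<beta> * s)"
    using \<beta>_pos s_ge_1 by simp
  ultimately show ?thesis
    by linarith
qed

lemma nn_act_J_pair_decay:
  assumes "M \<le> v x" "v x \<le> s" "v y \<le> v x"
  shows "nn_act h (J n) x + nn_act h (J n) y \<le> ennreal (J (Suc n) x + J (Suc n) y)"
proof -
  define X where "X = b ^ n * ((1 - \<eta> * l) * w x) + (1 / 2 + \<beta> * (v x - \<eta> * \<phi> (v x))) / (\<beta> * s)"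
  define Y where "Y = b ^ n * ((1 + \<eta> / 4 * l) * w y) + (1 / 2 + \<beta> * (v y + k)) / (\<beta> * s)"
  have nn_act_x_le: "nn_act h (J n) x \<le> ennreal X" and nn_act_y_le: "nn_act h (J n) y \<le> ennreal Y"
    unfolding X_def Y_def by (fact nn_act_J_decay[OF assms(1,2)], fact nn_act_J_growth)
  have "w y \<le> w x"
    using assms l_bounds s_ge_1 v_ge_1 by (intro exp_weight_mono) auto
  then have "\<eta> * l * w y \<le> \<eta> * l * w x"
    using l_bounds \<eta>_pos by (intro mult_left_mono) auto
  moreover have "0 \<le> \<eta> * l * w x"
    using l_bounds \<eta>_pos by (simp add: less_imp_le)
  ultimately have "(1 - \<eta> * l) * w x + (1 + \<eta> / 4 * l) * w y \<le> b * (w x + w y)"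
    by (simp add: algebra_simps)
  then have exponential: "b ^ n * ((1 - \<eta> * l) * w x + (1 + \<eta> / 4 * l) * w y)
      \<le> b ^ n * (b * (w x + w y))"
    by (intro mult_left_mono b_power_nonneg)
  have "0 \<le> \<eta> * \<phi> (v x)"
    using \<eta>_pos phi_v_pos[of x] by (simp add: less_imp_le)
  then have "k \<le> \<eta> * \<phi> (v x)"
    using k_le[of x] by linarith
  then have "\<beta> * k \<le> \<beta> * (\<eta> * \<phi> (v x))"
    using \<beta>_pos by simp
  then have linear: "((1 / 2 + \<beta> * (v x - \<eta> * \<phi> (v x))) + (1 / 2 + \<beta> * (v y + k))) / (\<beta> * s)
      \<le> ((1 / 2 + \<beta> * v x) + (1 / 2 + \<beta> * v y)) / (\<beta> * s)"
    using \<beta>s_pos by (intro divide_right_mono) (auto simp: algebra_simps)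
  have "X + Y = b ^ n * ((1 - \<eta> * l) * w x + (1 + \<eta> / 4 * l) * w y)
      + ((1 / 2 + \<beta> * (v x - \<eta> * \<phi> (v x))) + (1 / 2 + \<beta> * (v y + k))) / (\<beta> * s)"
    unfolding X_def Y_def distrib_left add_divide_distrib by simp
  also have "\<dots> \<le> J (Suc n) x + J (Suc n) y"
    using exponential linear unfolding J_add by (simp add: ac_simps)
  finally have "ennreal X + ennreal Y \<le> ennreal (J (Suc n) x + J (Suc n) y)"
    using nn_act_J_le_imp_pos[OF nn_act_x_le] nn_act_J_le_imp_pos[OF nn_act_y_le]
    by (simp add: ennreal_leI less_imp_le flip: ennreal_plus)
  then show ?thesis
    using add_mono[OF nn_act_x_le nn_act_y_le] by (rule order_trans[rotated])
qed

lemma osc_bound_bLip: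
  assumes bLip: "bLip f"
  shows "osc_bound (trunc N \<theta>) q (J 0) f"
proof -
  have "\<bar>f x - f y\<bar> \<le> trunc N \<theta> x y powr (1 - q) * (J 0 x + J 0 y) powr q" for x y
  proof -
    have "\<bar>f x - f y\<bar> \<le> trunc N \<theta> x y"
      using bLip_abs_diff_le[OF bLip] bdist_le_trunc by (rule order_trans)
    also have "\<dots> \<le> trunc N \<theta> x y powr (1 - q)"
      using powr_mono'[of "1 - q" 1 "trunc N \<theta> x y"] q_bounds trunc_N_nonneg[of x y]
        trunc_le_1[of N \<theta> x y]
      by (cases "trunc N \<theta> x y = 0") auto
    also have "\<dots> \<le> trunc N \<theta> x y powr (1 - q) * (J 0 x + J 0 y) powr q"
    proof -
      have "0 \<le> (1 / 2 + \<beta> * v x) / (\<beta> * s)"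
        using \<beta>_pos \<beta>s_pos v_nonneg[of x] by (intro divide_nonneg_pos) auto
      then have "1 \<le> J 0 x + J 0 y"
        using w_ge_1[of x] J_pos[of 0 y] by (simp add: J_def)
      then have "1 \<le> (J 0 x + J 0 y) powr q"
        using q_bounds by (intro ge_one_powr_ge_zero) auto
      then show ?thesis
        by (simp add: mult_le_cancel_left1)
    qed
    finally show ?thesis .
  qed
  then show ?thesis
    using bLip_measurable[OF bLip] bLip_bounded[OF bLip] by (simp add: osc_bound_def)
qed

lemma one_le_J_outside:
  assumes "s < max (v x) (v y)"
  shows "1 \<le> (J n x + J n y) powr q"
proof -
  have "\<beta> * s \<le> \<beta> * (v x + v y)"
    using assms \<beta>_pos v_nonneg[of x] v_nonneg[of y] by (intro mult_left_mono) auto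
  then have "1 \<le> (1 / 2 + \<beta> * v x) / (\<beta> * s) + (1 / 2 + \<beta> * v y) / (\<beta> * s)"
    using \<beta>s_pos by (simp add: le_divide_eq algebra_simps flip: add_divide_distrib)
  also have "\<dots> \<le> J n x + J n y"
    by (intro add_mono J_ge_linear)
  finally show ?thesis
    using q_bounds by (intro ge_one_powr_ge_zero) auto
qed

context
  fixes n :: nat and g :: "'a \<Rightarrow> real"
  assumes osc_bound_g: "osc_bound (trunc N \<theta>) q (J n) g"
begin

lemma contracts_J:
  assumes "contracts T (trunc N \<theta>) h x y A" "nn_act h (J n) x + nn_act h (J n) y \<le> ennreal B"
    "0 < B"
  shows "\<bar>act h g x - act h g y\<bar> \<le> A powr (1 - q) * B powr q"
  using assms q_bounds weight_J osc_bound_g unfolding contracts_def by blast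

lemma contracts_J_factor:
  assumes "contracts T (trunc N \<theta>) h x y A"
  shows "\<bar>act h g x - act h g y\<bar> \<le> A powr (1 - q) * (\<Lambda> powr q * (J (Suc n) x + J (Suc n) y) powr q)"
proof -
  have "nn_act h (J n) x + nn_act h (J n) y \<le> ennreal (\<Lambda> * J (Suc n) x) + ennreal (\<Lambda> * J (Suc n) y)"
    by (intro add_mono nn_act_J_le_factor)
  then have "nn_act h (J n) x + nn_act h (J n) y \<le> ennreal (\<Lambda> * (J (Suc n) x + J (Suc n) y))"
    using \<Lambda>_pos J_pos[of "Suc n"] by (simp add: distrib_left less_imp_le flip: ennreal_plus)
  moreover have "0 < \<Lambda> * (J (Suc n) x + J (Suc n) y)"
    using \<Lambda>_pos J_pos by (simp add: add_pos_pos)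
  ultimately have "\<bar>act h g x - act h g y\<bar>
      \<le> A powr (1 - q) * (\<Lambda> * (J (Suc n) x + J (Suc n) y)) powr q"
    by (intro contracts_J assms)
  then show ?thesis
    using \<Lambda>_pos J_pos[of "Suc n" x] J_pos[of "Suc n" y] by (simp add: powr_mult)
qed

lemma osc_step_near:
  assumes "x \<noteq> y" "N * \<theta> x y < 1"
  shows "\<bar>act h g x - act h g y\<bar> \<le> trunc N \<theta> x y powr (1 - q) * (J (Suc n) x + J (Suc n) y) powr q"
proof -
  have trunc_eq: "0 < N * \<theta> x y" "trunc N \<theta> x y = N * \<theta> x y" "trunc (N / 2) \<theta> x y = N * \<theta> x y / 2"
    using assms premetric_pos[OF premetric_\<theta>] N_ge_1 by (auto simp: trunc_def)
  have "\<bar>act h g x - act h g y\<bar>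
      \<le> (N * \<theta> x y / 2) powr (1 - q) * (\<Lambda> powr q * (J (Suc n) x + J (Suc n) y) powr q)"
    using contracts_J_factor[OF local_contraction[OF assms(1)]] by (simp add: trunc_eq)
  also have "\<dots> = (N * \<theta> x y) powr (1 - q) * (J (Suc n) x + J (Suc n) y) powr q * (\<Lambda> powr q / 2 powr (1 - q))"
    using trunc_eq(1) by (simp add: powr_divide)
  also have "\<dots> \<le> (N * \<theta> x y) powr (1 - q) * (J (Suc n) x + J (Suc n) y) powr q * 1"
    using growth_factor(3) by (intro mult_left_mono) (auto simp: divide_le_eq)
  finally show ?thesis
    by (simp add: trunc_eq)
qed

lemma osc_step_small_set:
  assumes "v x \<le> M" "v y \<le> M"
  shows "\<bar>act h g x - act h g y\<bar> \<le> (J (Suc n) x + J (Suc n) y) powr q"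
proof -
  have "\<bar>act h g x - act h g y\<bar>
      \<le> ((1 - \<kappa>) powr (1 - q) * \<Lambda> powr q) * (J (Suc n) x + J (Suc n) y) powr q"
    using contracts_J_factor[OF small_set[OF assms]] by simp
  also have "\<dots> \<le> 1 * (J (Suc n) x + J (Suc n) y) powr q"
    by (intro mult_right_mono growth_factor(4)) simp
  finally show ?thesis
    by simp
qed

lemma osc_step_drift:
  assumes "x \<noteq> y" "M \<le> max (v x) (v y)" "max (v x) (v y) \<le> s"
  shows "\<bar>act h g x - act h g y\<bar> \<le> (J (Suc n) x + J (Suc n) y) powr q"
proof -
  have "nn_act h (J n) x + nn_act h (J n) y \<le> ennreal (J (Suc n) x + J (Suc n) y)"
    using assms nn_act_J_pair_decay[of x y n] nn_act_J_pair_decay[of y x n]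
    by (cases "v y \<le> v x") (auto simp: add.commute max_def split: if_splits)
  then have "\<bar>act h g x - act h g y\<bar>
      \<le> trunc (N / 2) \<theta> x y powr (1 - q) * (J (Suc n) x + J (Suc n) y) powr q"
    using J_pos by (intro contracts_J local_contraction assms) (auto simp: add_pos_pos)
  also have "\<dots> \<le> 1 * (J (Suc n) x + J (Suc n) y) powr q"
    using q_bounds N_ge_1 trunc_nonneg[OF premetric_\<theta>, of "N / 2"]
    by (intro mult_right_mono powr_le1) (auto simp: trunc_le_1)
  finally show ?thesis
    by simp
qed

lemma osc_step_far:
  assumes "x \<noteq> y" and abs_le_1: "\<bar>act h g x - act h g y\<bar> \<le> 1"
  shows "\<bar>act h g x - act h g y\<bar> \<le> (J (Suc n) x + J (Suc n) y) powr q"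
proof -
  consider "v x \<le> M" "v y \<le> M" | "M \<le> max (v x) (v y)" "max (v x) (v y) \<le> s" | "s < max (v x) (v y)"
    by linarith
  then show ?thesis
  proof cases
    case 1
    then show ?thesis
      by (rule osc_step_small_set)
  next
    case 2
    then show ?thesis
      by (rule osc_step_drift[OF assms(1)])
  next
    case 3
    then show ?thesis
      by (intro order_trans[OF abs_le_1] one_le_J_outside)
  qed
qed

end

theorem osc_bound_iterate:
  assumes bLip: "bLip f"
  shows "osc_bound (trunc N \<theta>) q (J n) (act (real n * h) f)"
proof (induction n)
  case 0
  have "act 0 f = f"
    using act_0[OF bLip_measurable[OF bLip]] by auto
  then show ?case
    using osc_bound_bLip[OF bLip] by simp
next
  case (Suc n)
  let ?g' = "act (real (Suc n) * h) f"
  note g' = act_Suc_times[OF bLip_measurable[OF bLip] bLip_abs_le[OF bLip]]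
  have "\<bar>?g' x - ?g' y\<bar> \<le> trunc N \<theta> x y powr (1 - q) * (J (Suc n) x + J (Suc n) y) powr q" for x y
  proof (cases "x = y \<or> N * \<theta> x y < 1")
    case True
    then show ?thesis
      unfolding g' using osc_step_near[OF Suc] True by (cases "x = y") auto
  next
    case False
    have "\<bar>?g' x - ?g' y\<bar> \<le> 1"
      by (intro abs_integral_bLip_diff_le_1 borel_prob_space_P time_nonneg bLip)
    then have "\<bar>?g' x - ?g' y\<bar> \<le> (J (Suc n) x + J (Suc n) y) powr q"
      unfolding g' using False by (intro osc_step_far[OF Suc]) auto
    then show ?thesis
      using False by (simp add: trunc_def)
  qed
  moreover have "?g' \<in> borel_measurable borel"
    by (intro act_measurable time_nonneg bLip_measurable bLip)
  moreover have "bounded (range ?g')"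
    using abs_act_le[OF time_nonneg bLip_measurable[OF bLip] bLip_abs_le[OF bLip], of "Suc n"]
    unfolding bounded_iff by auto
  ultimately show ?case
    unfolding osc_bound_def by blast
qed

lemma abs_act_diff_le_J:
  assumes bLip: "bLip f"
  shows "\<bar>act (real n * h) f x - act (real n * h) f y\<bar> \<le> (J n x + J n y) powr q"
proof -
  have "\<bar>act (real n * h) f x - act (real n * h) f y\<bar>
      \<le> trunc N \<theta> x y powr (1 - q) * (J n x + J n y) powr q"
    using osc_bound_iterate[OF bLip] by (simp add: osc_bound_def)
  also have "\<dots> \<le> 1 * (J n x + J n y) powr q"
    using q_bounds trunc_N_nonneg[of x y] trunc_le_1[of N \<theta> x y]
    by (intro mult_right_mono powr_le1) auto
  finally show ?thesis
    by simp
qed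

end

section \<open>Subgeometric contraction\<close>

lemma weighted_geometric_mean:
  fixes a c q :: real
  assumes "0 < a" "a \<le> c" "0 < q" "q < 1"
  obtains p where "a \<le> p" "p \<le> c" "a / p = (a / c) powr q" "c / p = (c / a) powr (1 - q)"
proof
  define p where "p = a powr (1 - q) * c powr q"
  have pos: "0 < c"
    using assms by simp
  have split: "z = z powr (1 - q) * z powr q" if "0 < z" for z
    using that by (simp flip: powr_add)
  have "a powr (1 - q) * a powr q \<le> p"
    unfolding p_def using assms by (intro mult_left_mono powr_mono2) auto
  then show "a \<le> p"
    using split[OF assms(1)] by simp
  have "p \<le> c powr (1 - q) * c powr q"
    unfolding p_def using assms by (intro mult_right_mono powr_mono2) auto
  then show "p \<le> c"
    using split[OF pos] by simp
  have "a / p = (a powr (1 - q) * a powr q) / p"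
    using split[OF assms(1)] by simp
  then show "a / p = (a / c) powr q"
    using assms pos by (simp add: p_def powr_divide)
  have "c / p = (c powr (1 - q) * c powr q) / p"
    using split[OF pos] by simp
  then show "c / p = (c / a) powr (1 - q)"
    using assms pos by (simp add: p_def powr_divide)
qed

lemma growth_factor_compensated_by_contraction:
  fixes q \<kappa> :: real
  assumes q_bounds: "0 < q" "q < 1" and \<kappa>_bounds: "0 < \<kappa>" "\<kappa> < 1"
  obtains \<Lambda> :: real where "1 < \<Lambda>" "\<Lambda> powr q \<le> 2 powr (1 - q)" "(1 - \<kappa>) powr (1 - q) * \<Lambda> powr q \<le> 1"
proof
  define m where "m = min 2 (1 / (1 - \<kappa>))"
  have m_bounds: "1 < m" "m \<le> 2" "(1 - \<kappa>) * m \<le> 1"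
    using \<kappa>_bounds by (auto simp: m_def min_def field_simps)
  let ?\<Lambda> = "m powr ((1 - q) / q)"
  have powr_q: "?\<Lambda> powr q = m powr (1 - q)"
    using q_bounds by (simp add: powr_powr)
  show "1 < ?\<Lambda>"
    using m_bounds q_bounds by simp
  show "?\<Lambda> powr q \<le> 2 powr (1 - q)"
    unfolding powr_q using m_bounds q_bounds by (intro powr_mono2) auto
  have "(1 - \<kappa>) powr (1 - q) * m powr (1 - q) = ((1 - \<kappa>) * m) powr (1 - q)"
    using m_bounds \<kappa>_bounds by (simp add: powr_mult)
  also have "\<dots> \<le> 1"
    using m_bounds \<kappa>_bounds q_bounds by (intro powr_le1) auto
  finally show "(1 - \<kappa>) powr (1 - q) * ?\<Lambda> powr q \<le> 1"
    by (simp add: powr_q)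
qed

lemma less_1_if_balanced:
  fixes e \<Lambda> :: real
  assumes "0 < \<Lambda>" "e * (1 + \<Lambda>) \<le> \<Lambda> - 1"
  shows "e < 1"
proof (rule ccontr)
  assume "\<not> e < 1"
  then have "1 * (1 + \<Lambda>) \<le> e * (1 + \<Lambda>)"
    using assms(1) by (intro mult_right_mono) auto
  with assms(2) show False
    by simp
qed

lemma one_minus_power_le_exp:
  fixes x :: real
  assumes "x \<le> 1"
  shows "(1 - x) ^ n \<le> exp (- (x * real n))"
proof -
  have "(1 - x) ^ n \<le> exp (- x) ^ n"
    using assms exp_ge_add_one_self[of "- x"] by (intro power_mono) auto
  then show ?thesis
    by (simp add: mult.commute flip: exp_of_nat_mult)
qed

lemma (in concave_rate) exp_weight_decay:
  assumes s_bounds: "1 \<le> s" "s \<le> R" and u_bounds: "1 \<le> u" "u \<le> R" and q_less_1: "q < 1"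
    and \<epsilon>_pos: "0 < \<epsilon>"
    and l_eq: "l = \<epsilon> * \<phi>' s" "a * l \<le> 1" and ratio: "0 < \<rho>" "\<phi> R / \<phi> s = \<rho> powr (1 - q)"
    and time_large: "(1 + 1 / (\<epsilon> * (1 - q))) * H R \<le> a * real n"
  shows "(1 - a * l) ^ n * exp_weight l s u \<le> 1 / \<rho>"
proof -
  have l_pos: "0 < l"
    using \<epsilon>_pos phi_deriv_pos[of s] s_bounds by (simp add: l_eq)
  have "(1 - q) * ln \<rho> = ln (\<phi> R / \<phi> s)"
    using ratio by (simp add: ln_powr)
  also have "\<dots> \<le> \<phi>' s * (H R - H s)"
    by (rule ln_phi_ratio_le[OF s_bounds])
  also have "\<dots> \<le> \<phi>' s * H R"
    using phi_deriv_pos[of s] s_bounds H_nonneg[OF s_bounds(1)] by (intro mult_left_mono) auto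
  finally have "ln \<rho> \<le> \<phi>' s * H R / (1 - q)"
    using q_less_1 by (simp add: field_simps)
  moreover have "l * ((1 + 1 / (\<epsilon> * (1 - q))) * H R) \<le> l * (a * real n)"
    using time_large l_pos by simp
  moreover have "l * ((1 + 1 / (\<epsilon> * (1 - q))) * H R) = l * H R + \<phi>' s * H R / (1 - q)"
    using \<epsilon>_pos by (simp add: l_eq distrib_left distrib_right)
  ultimately have exponent: "l * H R - a * l * real n \<le> - ln \<rho>"
    by (simp add: mult.assoc mult.left_commute)
  have "(1 - a * l) ^ n * exp_weight l s u \<le> exp (- (a * l * real n)) * exp (l * H R)"
    using s_bounds u_bounds l_eq(2) l_pos
    by (intro mult_mono one_minus_power_le_exp)
      (auto simp: exp_weight_def intro!: mult_left_mono H_mono)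
  also have "\<dots> \<le> exp (- ln \<rho>)"
    using exponent by (simp flip: exp_add)
  also have "\<dots> = 1 / \<rho>"
    using ratio by (simp add: exp_minus inverse_eq_divide)
  finally show ?thesis .
qed

lemma (in lyapunov_weight) J_add_le:
  assumes V0_bounds: "1 \<le> V0" "v x \<le> V0" "v y \<le> V0" "V0 \<le> s" and s_le_R: "s \<le> R"
    and ratio: "\<phi> R / \<phi> s = (\<phi> R / \<phi> V0) powr (1 - q)"
    and l_eq: "0 < \<epsilon>" "l = \<epsilon> * \<phi>' s"
    and time_large: "(1 + 1 / (\<epsilon> * (1 - q))) * H R \<le> \<eta> / 4 * real n"
  shows "J n x + J n y \<le> (2 + (1 + 2 * \<beta>) / \<beta>) * (\<phi> V0 / \<phi> s)"
proof -
  have pos: "0 < \<phi> V0" "0 < \<phi> s" "0 < \<phi> R"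
    using V0_bounds s_le_R by (auto intro!: phi_pos)
  have exponential: "b ^ n * w z \<le> \<phi> V0 / \<phi> s" if "v z \<le> V0" for z
  proof -
    have "b ^ n * w z \<le> 1 / (\<phi> R / \<phi> V0)"
      by (rule exp_weight_decay[OF s_ge_1 s_le_R v_ge_1 _ q_bounds(2) l_eq _ _ ratio time_large])
        (use that V0_bounds s_le_R l_bounds pos in auto)
    also have "\<dots> = \<phi> V0 / \<phi> R"
      by simp
    also have "\<dots> \<le> \<phi> V0 / \<phi> s"
      using pos phi_mono[OF _ s_le_R] s_ge_1 by (intro divide_left_mono) auto
    finally show ?thesis .
  qed
  have "\<beta> * (v x + v y) \<le> \<beta> * (2 * V0)"
    using V0_bounds \<beta>_pos by (intro mult_left_mono) auto
  then have "((1 / 2 + \<beta> * v x) + (1 / 2 + \<beta> * v y)) / (\<beta> * s) \<le> (1 + 2 * \<beta>) * V0 / (\<beta> * s)"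
    using V0_bounds(1) \<beta>s_pos by (intro divide_right_mono) (auto simp: algebra_simps)
  also have "\<dots> = (1 + 2 * \<beta>) / \<beta> * (V0 / s)"
    by simp
  also have "\<dots> \<le> (1 + 2 * \<beta>) / \<beta> * (\<phi> V0 / \<phi> s)"
  proof (rule mult_left_mono)
    show "V0 / s \<le> \<phi> V0 / \<phi> s"
      using phi_slope_antimono[of V0 s] V0_bounds s_ge_1 pos by (simp add: field_simps)
  qed (use \<beta>_pos in simp)
  finally have linear: "((1 / 2 + \<beta> * v x) + (1 / 2 + \<beta> * v y)) / (\<beta> * s)
      \<le> (1 + 2 * \<beta>) / \<beta> * (\<phi> V0 / \<phi> s)" .
  have "(2 + (1 + 2 * \<beta>) / \<beta>) * (\<phi> V0 / \<phi> s)
      = \<phi> V0 / \<phi> s + \<phi> V0 / \<phi> s + (1 + 2 * \<beta>) / \<beta> * (\<phi> V0 / \<phi> s)"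
    by (simp only: distrib_right)
  then show ?thesis
    using exponential[OF V0_bounds(2)] exponential[OF V0_bounds(3)] linear
    unfolding J_add distrib_left
    by linarith
qed

context subgeometric_chain
begin

lemma exists_lyapunov_weight:
  assumes q_bounds: "0 < q" "q < 1"
  obtains \<beta> \<epsilon> \<Lambda> where "0 < \<beta>" "0 < \<epsilon>"
    "\<And>s. 1 \<le> s \<Longrightarrow> lyapunov_weight P \<phi> \<theta> N T h M k \<eta> \<kappa> v q (\<epsilon> * \<phi>' s) s \<beta> \<Lambda>"
proof -
  obtain \<Lambda> :: real where \<Lambda>_bounds: "1 < \<Lambda>" "\<Lambda> powr q \<le> 2 powr (1 - q)"
    "(1 - \<kappa>) powr (1 - q) * \<Lambda> powr q \<le> 1"
    by (rule growth_factor_compensated_by_contraction[OF q_bounds \<kappa>_bounds])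
  define \<beta> where "\<beta> = (\<Lambda> - 1) / (2 * k)"
  define d where "d = \<eta> / 4 * (1 + \<Lambda>) * \<phi>' 1"
  define \<epsilon> where "\<epsilon> = min 1 ((\<Lambda> - 1) / d)"
  have "0 < d"
    using \<eta>_pos \<Lambda>_bounds phi_deriv_pos[of 1] by (simp add: d_def)
  then have \<epsilon>_bounds: "0 < \<epsilon>" "\<epsilon> \<le> 1" "\<epsilon> * d \<le> \<Lambda> - 1"
    using \<Lambda>_bounds by (auto simp: \<epsilon>_def min_def field_simps)
  show thesis
  proof (rule that[of \<beta> \<epsilon> \<Lambda>])
    show \<beta>_pos: "0 < \<beta>"
      using \<Lambda>_bounds k_pos by (simp add: \<beta>_def)
    fix s :: real
    assume s_ge_1: "1 \<le> s"
    define l where "l = \<epsilon> * \<phi>' s"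
    have deriv: "0 < \<phi>' s" "\<phi>' s \<le> \<phi>' 1"
      using s_ge_1 by (auto intro!: phi_deriv_pos phi_deriv_antimono)
    have l_bounds: "0 < l" "l \<le> \<phi>' s"
      using \<epsilon>_bounds deriv by (auto simp: l_def mult_left_le_one_le)
    have "\<eta> / 4 * (1 + \<Lambda>) * (\<epsilon> * \<phi>' s) \<le> \<eta> / 4 * (1 + \<Lambda>) * (\<epsilon> * \<phi>' 1)"
      using \<eta>_pos \<Lambda>_bounds \<epsilon>_bounds deriv by (intro mult_left_mono) auto
    also have "\<dots> \<le> \<Lambda> - 1"
      using \<epsilon>_bounds(3) by (simp add: d_def mult_ac)
    finally have growth_le: "\<eta> / 4 * l * (1 + \<Lambda>) \<le> \<Lambda> - 1"
      by (simp add: l_def mult_ac)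
    then have "\<eta> / 4 * l < 1"
      using \<Lambda>_bounds by (intro less_1_if_balanced[of \<Lambda>]) auto
    moreover have "1 + \<eta> / 4 * l \<le> \<Lambda> * (1 - \<eta> / 4 * l)"
      using growth_le by (simp add: field_simps)
    moreover have "1 + 2 * \<beta> * k \<le> \<Lambda>"
      using k_pos by (simp add: \<beta>_def field_simps)
    ultimately show "lyapunov_weight P \<phi> \<theta> N T h M k \<eta> \<kappa> v q (\<epsilon> * \<phi>' s) s \<beta> \<Lambda>"
      using q_bounds l_bounds s_ge_1 \<beta>_pos \<Lambda>_bounds unfolding l_def by unfold_locales auto
  qed (rule \<epsilon>_bounds(1))
qed

text \<open>The level s of the weight is chosen with \<open>\<phi> s\<close> the weighted geometric mean of \<open>\<phi> V0\<close> and
  \<open>\<phi> R\<close>, which balances the exponential and the linear part of the weight.\<close>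

lemma abs_act_diff_le_interpolated:
  assumes q_bounds: "0 < q" "q < 1" and \<beta>_pos: "0 < \<beta>" and \<epsilon>_pos: "0 < \<epsilon>"
    and weight: "\<And>s. 1 \<le> s \<Longrightarrow> lyapunov_weight P \<phi> \<theta> N T h M k \<eta> \<kappa> v q (\<epsilon> * \<phi>' s) s \<beta> \<Lambda>"
    and V0_bounds: "1 \<le> V0" "v x \<le> V0" "v y \<le> V0" "V0 \<le> R"
    and time_large: "(1 + 1 / (\<epsilon> * (1 - q))) * H R \<le> \<eta> / 4 * real n" and bLip: "bLip f"
  shows "\<bar>act (real n * h) f x - act (real n * h) f y\<bar>
      \<le> ((2 + (1 + 2 * \<beta>) / \<beta>) * (\<phi> V0 / \<phi> R) powr q) powr q"
proof -
  have "0 < \<phi> V0" "\<phi> V0 \<le> \<phi> R"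
    using V0_bounds by (auto intro!: phi_pos phi_mono)
  then obtain p where geometric_mean: "\<phi> V0 \<le> p" "p \<le> \<phi> R" "\<phi> V0 / p = (\<phi> V0 / \<phi> R) powr q"
      "\<phi> R / p = (\<phi> R / \<phi> V0) powr (1 - q)"
    using weighted_geometric_mean q_bounds by metis
  moreover have "continuous_on {V0..R} \<phi>"
    using V0_bounds by (intro continuous_on_phi) simp
  ultimately obtain s where level: "V0 \<le> s" "s \<le> R" "\<phi> s = p"
    using IVT'[of \<phi> V0 p R] V0_bounds by auto
  interpret lyapunov_weight P \<phi> \<theta> N T h M k \<eta> \<kappa> v q "\<epsilon> * \<phi>' s" s \<beta> \<Lambda>
    using level V0_bounds by (intro weight) simp
  have "\<bar>act (real n * h) f x - act (real n * h) f y\<bar> \<le> (J n x + J n y) powr q"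
    by (rule abs_act_diff_le_J[OF bLip])
  also have "\<dots> \<le> ((2 + (1 + 2 * \<beta>) / \<beta>) * (\<phi> V0 / \<phi> s)) powr q"
  proof (rule powr_mono2)
    show "J n x + J n y \<le> (2 + (1 + 2 * \<beta>) / \<beta>) * (\<phi> V0 / \<phi> s)"
      using level geometric_mean V0_bounds
      by (intro J_add_le[OF _ _ _ _ _ _ \<epsilon>_pos refl time_large]) auto
  qed (use q_bounds J_pos[of n x] J_pos[of n y] in auto)
  finally show ?thesis
    by (simp add: level geometric_mean)
qed

lemma abs_act_diff_le_phi_ratio:
  assumes q_bounds: "0 < q" "q < 1" and \<beta>_pos: "0 < \<beta>" and \<epsilon>_pos: "0 < \<epsilon>"
    and weight: "\<And>s. 1 \<le> s \<Longrightarrow> lyapunov_weight P \<phi> \<theta> N T h M k \<eta> \<kappa> v q (\<epsilon> * \<phi>' s) s \<beta> \<Lambda>"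
    and R_ge_1: "1 \<le> R" and time_large: "(1 + 1 / (\<epsilon> * (1 - q))) * H R \<le> \<eta> / 4 * real n"
    and bLip: "bLip f"
  shows "\<bar>act (real n * h) f x - act (real n * h) f y\<bar>
    \<le> (2 + (1 + 2 * \<beta>) / \<beta>) powr q * ((\<phi> (v x) + \<phi> (v y)) / \<phi> R) powr (q * q)"
proof -
  define a where "a = 2 + (1 + 2 * \<beta>) / \<beta>"
  have "1 \<le> a"
    using \<beta>_pos by (simp add: a_def)
  then have prefactor: "1 \<le> a powr q"
    using q_bounds by (intro ge_one_powr_ge_zero) auto
  define V0 where "V0 = max (v x) (v y)"
  have V0_bounds: "1 \<le> V0" "v x \<le> V0" "v y \<le> V0"
    using v_ge_1[of x] by (auto simp: V0_def)
  have phi_pos': "0 < \<phi> V0" "0 < \<phi> R"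
    using V0_bounds R_ge_1 by (auto intro!: phi_pos)
  have "\<bar>act (real n * h) f x - act (real n * h) f y\<bar> \<le> a powr q * (\<phi> V0 / \<phi> R) powr (q * q)"
  proof (cases "V0 \<le> R")
    case True
    from abs_act_diff_le_interpolated[OF q_bounds \<beta>_pos \<epsilon>_pos weight V0_bounds True time_large bLip]
    show ?thesis
      using \<open>1 \<le> a\<close> phi_pos' by (simp add: a_def powr_mult powr_powr)
  next
    case False
    have "\<bar>act (real n * h) f x - act (real n * h) f y\<bar> \<le> 1"
      by (intro abs_integral_bLip_diff_le_1 borel_prob_space_P time_nonneg bLip)
    also have "1 \<le> (\<phi> V0 / \<phi> R) powr (q * q)"
      using q_bounds phi_pos' False R_ge_1 phi_mono[of R V0] by (intro ge_one_powr_ge_zero) auto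
    finally show ?thesis
      using prefactor by (simp add: mult_le_cancel_right1 order_trans)
  qed
  also have "\<dots> \<le> a powr q * ((\<phi> (v x) + \<phi> (v y)) / \<phi> R) powr (q * q)"
    using prefactor q_bounds phi_pos' phi_v_pos[of x] phi_v_pos[of y]
    by (intro mult_left_mono powr_mono2 divide_right_mono) (auto simp: V0_def max_def)
  finally show ?thesis
    by (simp add: a_def)
qed

theorem subgeometric_contraction:
  assumes "0 < \<delta>" "\<delta> < 1"
  obtains C c where "0 < C" "0 < c" "\<And>n f x y. bLip f \<Longrightarrow>
    \<bar>act (real n * h) f x - act (real n * h) f y\<bar>
        \<le> C * ((\<phi> (v x) + \<phi> (v y)) / \<phi> (H_inv (c * real n))) powr \<delta>"
proof -
  define q where "q = sqrt \<delta>"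
  have q_bounds: "0 < q" "q < 1" "q * q = \<delta>"
    using assms by (auto simp: q_def)
  obtain \<beta> \<epsilon> \<Lambda> where \<beta>_pos: "0 < \<beta>" and \<epsilon>_pos: "0 < \<epsilon>"
    and weight: "\<And>s. 1 \<le> s \<Longrightarrow> lyapunov_weight P \<phi> \<theta> N T h M k \<eta> \<kappa> v q (\<epsilon> * \<phi>' s) s \<beta> \<Lambda>"
    using exists_lyapunov_weight[OF q_bounds(1,2)] by metis
  define r where "r = 1 + 1 / (\<epsilon> * (1 - q))"
  define c where "c = \<eta> / 4 / r"
  have r_pos: "0 < r"
    using \<epsilon>_pos q_bounds by (simp add: r_def add_pos_pos)
  then have c_pos: "0 < c"
    using \<eta>_pos by (simp add: c_def)
  have "0 < 2 + (1 + 2 * \<beta>) / \<beta>"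
    using \<beta>_pos by (intro add_pos_pos divide_pos_pos) auto
  then have prefactor: "0 < (2 + (1 + 2 * \<beta>) / \<beta>) powr q"
    by simp
  show thesis
  proof (rule that[OF prefactor c_pos])
    fix n :: nat and f :: "'a \<Rightarrow> real" and x y
    assume bLip: "bLip f"
    have "1 \<le> H_inv (c * real n)" "H (H_inv (c * real n)) = c * real n"
      using c_pos by (auto simp: H_inv_ge_1 H_H_inv)
    moreover from this have "r * H (H_inv (c * real n)) \<le> \<eta> / 4 * real n"
      using r_pos by (simp add: c_def)
    ultimately show "\<bar>act (real n * h) f x - act (real n * h) f y\<bar>
        \<le> (2 + (1 + 2 * \<beta>) / \<beta>) powr q * ((\<phi> (v x) + \<phi> (v y)) / \<phi> (H_inv (c * real n))) powr \<delta>"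
      using abs_act_diff_le_phi_ratio[OF q_bounds(1,2) \<beta>_pos \<epsilon>_pos weight _ _ bLip]
      by (simp add: r_def q_bounds(3))
  qed
qed

end

section \<open>Invariant measures of the skeleton chain\<close>

context subgeometric_chain
begin

definition moment_le :: "real \<Rightarrow> 'a measure \<Rightarrow> bool" where
  "moment_le m \<mu> \<longleftrightarrow> borel_prob_space \<mu> \<and> 0 < m \<and> (\<integral>\<^sup>+x. ennreal (\<phi> (v x)) \<partial>\<mu>) \<le> ennreal m"

lemma moment_le_P_0: "moment_le (\<phi> (v x)) (P 0 x)"
  using phi_v_pos borel_prob_space_P[of 0 x] by (simp add: moment_le_def P_0 nn_integral_return)

lemma moment_le_P_h: "moment_le (lin * (v x + k)) (P h x)"
  unfolding moment_le_def
proof (intro conjI borel_prob_space_P h_nonneg)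
  show "0 < lin * (v x + k)"
    using lin_pos v_nonneg[of x] k_pos by (simp add: add_nonneg_pos)
  have "nn_act h (\<lambda>y. \<phi> (v y)) x \<le> ennreal (0 + lin * (v x + k))"
    using v_nonneg[of x] k_pos lin_pos phi_v_pos
    by (intro nn_act_le_affine[OF h_nonneg v_measurable v_nonneg growth])
      (auto simp: phi_le_linear v_nonneg less_imp_le)
  then show "nn_act h (\<lambda>y. \<phi> (v y)) x \<le> ennreal (lin * (v x + k))"
    by simp
qed

definition contracts_laws :: "real \<Rightarrow> real \<Rightarrow> real \<Rightarrow> bool" where
  "contracts_laws \<delta> C c \<longleftrightarrow> 0 < C \<and> 0 < c \<and>
    (\<forall>n f \<mu> \<nu> m m'. bLip f \<longrightarrow> moment_le m \<mu> \<longrightarrow> moment_le m' \<nu> \<longrightarrow>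
      \<bar>(\<integral>x. act (real n * h) f x \<partial>\<mu>) - (\<integral>x. act (real n * h) f x \<partial>\<nu>)\<bar>
        \<le> C * ((m + m') / \<phi> (H_inv (c * real n))) powr \<delta>)"

lemma contracts_lawsD:
  assumes "contracts_laws \<delta> C c"
  shows "0 < C" "0 < c"
    and "bLip f \<Longrightarrow> moment_le m \<mu> \<Longrightarrow> moment_le m' \<nu> \<Longrightarrow>
      \<bar>(\<integral>x. act (real n * h) f x \<partial>\<mu>) - (\<integral>x. act (real n * h) f x \<partial>\<nu>)\<bar>
        \<le> C * ((m + m') / \<phi> (H_inv (c * real n))) powr \<delta>"
  using assms by (auto simp: contracts_laws_def)

theorem exists_contracts_laws:
  assumes \<delta>_bounds: "0 < \<delta>" "\<delta> < 1"
  obtains C c where "contracts_laws \<delta> C c"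
proof -
  obtain C c where C_pos: "0 < C" and c_pos: "0 < c" and contraction: "\<And>n f x y. bLip f \<Longrightarrow>
      \<bar>act (real n * h) f x - act (real n * h) f y\<bar>
        \<le> C * ((\<phi> (v x) + \<phi> (v y)) / \<phi> (H_inv (c * real n))) powr \<delta>"
    using subgeometric_contraction[OF \<delta>_bounds] by metis
  have "contracts_laws \<delta> C c"
    unfolding contracts_laws_def
  proof (intro conjI allI impI)
    fix n :: nat and f :: "'a \<Rightarrow> real" and \<mu> \<nu> :: "'a measure" and m m' :: real
    assume bLip: "bLip f" and moments: "moment_le m \<mu>" "moment_le m' \<nu>"
    define \<rho> where "\<rho> = \<phi> (H_inv (c * real n))"
    have \<rho>_pos: "0 < \<rho>"
      using c_pos by (simp add: \<rho>_def phi_H_inv_pos)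
    have "\<bar>(\<integral>x. act (real n * h) f x \<partial>\<mu>) - (\<integral>x. act (real n * h) f x \<partial>\<nu>)\<bar>
        \<le> C / \<rho> powr \<delta> * (m + m') powr \<delta>"
    proof (rule abs_integral_diff_le_powr)
      show "act (real n * h) f \<in> borel_measurable borel"
        by (intro act_measurable time_nonneg bLip_measurable bLip)
      show "\<bar>act (real n * h) f x\<bar> \<le> \<bar>f undefined\<bar> + 1" for x
        by (intro abs_act_le time_nonneg bLip_measurable bLip_abs_le bLip)
      show "\<bar>act (real n * h) f x - act (real n * h) f y\<bar>
          \<le> C / \<rho> powr \<delta> * (\<phi> (v x) + \<phi> (v y)) powr \<delta>"
        for x y
        using contraction[OF bLip, of n x y] \<rho>_pos phi_v_pos[of x] phi_v_pos[of y]
        by (simp add: powr_divide flip: \<rho>_def)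
    qed (use moments C_pos \<delta>_bounds phi_v_pos in \<open>auto simp: moment_le_def less_imp_le\<close>)
    then show "\<bar>(\<integral>x. act (real n * h) f x \<partial>\<mu>) - (\<integral>x. act (real n * h) f x \<partial>\<nu>)\<bar>
        \<le> C * ((m + m') / \<phi> (H_inv (c * real n))) powr \<delta>"
      using moments \<rho>_pos by (simp add: moment_le_def powr_divide flip: \<rho>_def)
  qed (use C_pos c_pos in auto)
  then show thesis
    by (rule that)
qed

lemma contraction_rate_tendsto_0:
  assumes "0 < c" "0 < \<delta>" "0 \<le> m"
  shows "(\<lambda>n. C * (m / \<phi> (H_inv (c * real n))) powr \<delta>) \<longlonglongrightarrow> 0"
proof -
  have "filterlim (\<lambda>n. c * real n) at_top sequentially"
    using assms
    by (intro filterlim_tendsto_pos_mult_at_top[OF tendsto_const] filterlim_real_sequentially)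
  then have "filterlim (\<lambda>n. \<phi> (H_inv (c * real n))) at_top sequentially"
    by (rule filterlim_compose[OF filterlim_phi_H_inv])
  then have "(\<lambda>n. m / \<phi> (H_inv (c * real n))) \<longlonglongrightarrow> 0"
    by (intro tendsto_divide_0[OF tendsto_const] filterlim_at_top_imp_at_infinity)
  then have "(\<lambda>n. (m / \<phi> (H_inv (c * real n))) powr \<delta>) \<longlonglongrightarrow> 0 powr \<delta>"
    using assms phi_H_inv_pos
    by (intro tendsto_powr') (auto intro!: always_eventually divide_nonneg_pos simp: less_imp_le)
  then show ?thesis
    using tendsto_mult_right_zero by force
qed

definition drift_excess :: real where
  "drift_excess = k + \<eta> * \<phi> (max 1 M)"

lemma drift_excess_pos: "0 < drift_excess"
proof -
  have "0 < \<phi> (max 1 M)"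
    by (rule phi_pos) simp
  then show ?thesis
    using \<eta>_pos k_pos by (simp add: drift_excess_def add_pos_pos)
qed

lemma nn_act_v_plus_phi_le: "nn_act h v x + ennreal (\<eta> * \<phi> (v x)) \<le> ennreal (v x + drift_excess)"
proof -
  have pos: "0 \<le> \<eta> * \<phi> (v x)"
    using \<eta>_pos phi_v_pos[of x] by simp
  show ?thesis
  proof (cases "M \<le> v x")
    case True
    have "nn_act h v x + ennreal (\<eta> * \<phi> (v x))
        \<le> ennreal (v x - \<eta> * \<phi> (v x)) + ennreal (\<eta> * \<phi> (v x))"
      by (intro add_right_mono drift True)
    also have "\<dots> = ennreal (v x)"
      using drift(1)[OF True] pos by (simp flip: ennreal_plus)
    also have "\<dots> \<le> ennreal (v x + drift_excess)"
      using drift_excess_pos by (intro ennreal_leI) simp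
    finally show ?thesis .
  next
    case False
    then have "\<eta> * \<phi> (v x) \<le> \<eta> * \<phi> (max 1 M)"
      using \<eta>_pos v_nonneg[of x] by (intro mult_left_mono phi_mono) auto
    then have excess: "v x + k + \<eta> * \<phi> (v x) \<le> v x + drift_excess"
      by (simp add: drift_excess_def)
    have "nn_act h v x + ennreal (\<eta> * \<phi> (v x)) \<le> ennreal (v x + k) + ennreal (\<eta> * \<phi> (v x))"
      by (intro add_right_mono growth)
    also have "\<dots> = ennreal (v x + k + \<eta> * \<phi> (v x))"
      using pos v_nonneg[of x] k_pos by (intro ennreal_plus[symmetric]) auto
    also have "\<dots> \<le> ennreal (v x + drift_excess)"
      by (rule ennreal_leI[OF excess])
    finally show ?thesis .
  qed
qed

lemma sum_nn_act_phi_v_le: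
  "nn_act (real n * h) v x + ennreal \<eta> * (\<Sum>j<n. nn_act (real j * h) (\<lambda>y. \<phi> (v y)) x)
    \<le> ennreal (v x + real n * drift_excess)"
proof (induction n)
  case 0
  then show ?case
    by (simp add: P_0 nn_integral_return)
next
  case (Suc n)
  interpret borel_prob_space "P (real n * h) x"
    by (rule borel_prob_space_P[OF time_nonneg])
  let ?I = "\<lambda>j. nn_act (real j * h) (\<lambda>y. \<phi> (v y)) x"
  have "nn_act (real (Suc n) * h) v x = (\<integral>\<^sup>+y. nn_act h v y \<partial>P (real n * h) x)"
    using nn_integral_P_add[OF time_nonneg h_nonneg, of "\<lambda>y. ennreal (v y)" n x]
    by (simp add: algebra_simps)
  moreover have "ennreal \<eta> * ?I n = (\<integral>\<^sup>+y. ennreal (\<eta> * \<phi> (v y)) \<partial>P (real n * h) x)"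
    using \<eta>_pos phi_v_pos by (simp add: ennreal_mult less_imp_le nn_integral_cmult)
  ultimately have "nn_act (real (Suc n) * h) v x + ennreal \<eta> * ?I n
      = (\<integral>\<^sup>+y. nn_act h v y + ennreal (\<eta> * \<phi> (v y)) \<partial>P (real n * h) x)"
    using nn_act_measurable[OF h_nonneg v_measurable]
    by (subst nn_integral_add) (auto simp: measurable_iff_borel)
  also have "\<dots> \<le> (\<integral>\<^sup>+y. ennreal (v y) + ennreal drift_excess \<partial>P (real n * h) x)"
    using nn_act_v_plus_phi_le v_nonneg drift_excess_pos
    by (intro nn_integral_mono) (simp flip: ennreal_plus)
  also have "\<dots> = nn_act (real n * h) v x + ennreal drift_excess"
    by (subst nn_integral_add) auto
  finally have step: "nn_act (real (Suc n) * h) v x + ennreal \<eta> * ?I n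
      \<le> nn_act (real n * h) v x + ennreal drift_excess" .
  have "nn_act (real (Suc n) * h) v x + ennreal \<eta> * (\<Sum>j<Suc n. ?I j)
      = (nn_act (real (Suc n) * h) v x + ennreal \<eta> * ?I n) + ennreal \<eta> * (\<Sum>j<n. ?I j)"
    by (simp add: distrib_left ac_simps)
  also have "\<dots> \<le> (nn_act (real n * h) v x + ennreal drift_excess) + ennreal \<eta> * (\<Sum>j<n. ?I j)"
    by (intro add_right_mono step)
  also have "\<dots> = (nn_act (real n * h) v x + ennreal \<eta> * (\<Sum>j<n. ?I j)) + ennreal drift_excess"
    by (simp add: ac_simps)
  also have "\<dots> \<le> ennreal (v x + real n * drift_excess) + ennreal drift_excess"
    by (intro add_right_mono Suc.IH)
  also have "\<dots> = ennreal (v x + real (Suc n) * drift_excess)"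
    using drift_excess_pos v_nonneg[of x] by (simp add: algebra_simps flip: ennreal_plus)
  finally show ?case .
qed

text \<open>If all moments from time n on exceeded \<open>(drift_excess + 1) / \<eta>\<close>, then their sum would outgrow the
  linear bound above.\<close>

lemma frequently_moment_le: "\<exists>j\<ge>n. moment_le ((drift_excess + 1) / \<eta>) (P (real j * h) x)"
proof (rule ccontr)
  define B where "B = (drift_excess + 1) / \<eta>"
  have B_eq: "0 < B" "\<eta> * B = drift_excess + 1"
    using drift_excess_pos \<eta>_pos by (auto simp: B_def)
  assume "\<not> (\<exists>j\<ge>n. moment_le ((drift_excess + 1) / \<eta>) (P (real j * h) x))"
  then have "\<not> moment_le B (P (real j * h) x)" if "n \<le> j" for j
    using that by (auto simp: B_def)
  then have large: "ennreal B \<le> nn_act (real j * h) (\<lambda>y. \<phi> (v y)) x" if "n \<le> j" for j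
    using that B_eq(1) borel_prob_space_P[OF time_nonneg, of j x] unfolding moment_le_def
    by fastforce
  define i where "i = nat \<lceil>v x + real n * drift_excess\<rceil> + 1"
  have "ennreal (real i * (drift_excess + 1)) = ennreal \<eta> * (\<Sum>j\<in>{n..<n + i}. ennreal B)"
    using B_eq \<eta>_pos drift_excess_pos
    by (simp add: ennreal_of_nat_eq_real_of_nat mult_ac flip: ennreal_mult)
  also have "\<dots> \<le> ennreal \<eta> * (\<Sum>j\<in>{n..<n + i}. nn_act (real j * h) (\<lambda>y. \<phi> (v y)) x)"
    by (intro mult_left_mono sum_mono large) auto
  also have "\<dots> \<le> ennreal \<eta> * (\<Sum>j<n + i. nn_act (real j * h) (\<lambda>y. \<phi> (v y)) x)"
    by (intro mult_left_mono sum_mono2) auto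
  also have "\<dots>
      \<le> nn_act (real (n + i) * h) v x + ennreal \<eta> * (\<Sum>j<n + i. nn_act (real j * h) (\<lambda>y. \<phi> (v y)) x)"
    by simp
  also have "\<dots> \<le> ennreal (v x + real (n + i) * drift_excess)"
    by (rule sum_nn_act_phi_v_le)
  finally have "real i * (drift_excess + 1) \<le> v x + real (n + i) * drift_excess"
    using v_nonneg[of x] drift_excess_pos by (subst (asm) ennreal_le_iff) auto
  then have "real i \<le> v x + real n * drift_excess"
    by (simp add: algebra_simps)
  then show False
    unfolding i_def by linarith
qed

lemma nn_act_min_v_le:
  "nn_act h (\<lambda>y. min (v y) r) x + ennreal (\<eta> * (\<phi> (v x) * indicator {x. v x \<le> r} x))
      \<le> ennreal (min (v x) r) + ennreal drift_excess"
proof (cases "v x \<le> r")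
  case True
  have "nn_act h (\<lambda>y. min (v y) r) x \<le> nn_act h v x"
    by (intro nn_integral_mono ennreal_leI) simp
  then have "nn_act h (\<lambda>y. min (v y) r) x + ennreal (\<eta> * \<phi> (v x)) \<le> ennreal (v x + drift_excess)"
    by (intro order_trans[OF add_right_mono nn_act_v_plus_phi_le])
  then show ?thesis
    using True v_nonneg[of x] drift_excess_pos by simp
next
  case False
  interpret borel_prob_space "P h x"
    by (rule borel_prob_space_P[OF h_nonneg])
  have "nn_act h (\<lambda>y. min (v y) r) x \<le> (\<integral>\<^sup>+y. ennreal r \<partial>P h x)"
    by (intro nn_integral_mono ennreal_leI) simp
  then show ?thesis
    using False by (simp add: min_def add_increasing2)
qed

text \<open>Truncating v at level r makes it integrable under \<open>\<pi>\<close>, so that it cancels by invariance.\<close>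

lemma truncated_moment_le_invariant:
  assumes \<pi>: "borel_prob_space \<pi>" and invariant: "\<pi> \<bind> P h = \<pi>"
  shows "(\<integral>\<^sup>+x. ennreal (\<phi> (v x) * indicator {x. v x \<le> r} x) \<partial>\<pi>) \<le> ennreal (drift_excess / \<eta>)"
proof -
  interpret borel_prob_space \<pi>
    by (rule \<pi>)
  let ?v = "\<lambda>y. min (v y) r" and ?f = "\<lambda>x. \<phi> (v x) * indicator {x. v x \<le> r} x"
  have [measurable]: "nn_act h ?v \<in> borel_measurable borel"
    by (intro nn_act_measurable h_nonneg) measurable
  have "(\<integral>\<^sup>+x. ennreal (?v x) \<partial>\<pi>) \<le> (\<integral>\<^sup>+x. ennreal r \<partial>\<pi>)"
    by (intro nn_integral_mono ennreal_leI) simp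
  then have finite: "(\<integral>\<^sup>+x. ennreal (?v x) \<partial>\<pi>) \<noteq> \<top>"
    by (auto simp: top_unique)
  have "ennreal \<eta> * (\<integral>\<^sup>+x. ennreal (?f x) \<partial>\<pi>) = (\<integral>\<^sup>+x. ennreal \<eta> * ennreal (?f x) \<partial>\<pi>)"
    by (rule nn_integral_cmult[symmetric]) measurable
  also have "\<dots> = (\<integral>\<^sup>+x. ennreal (\<eta> * ?f x) \<partial>\<pi>)"
    using \<eta>_pos phi_v_pos by (simp add: ennreal_mult' less_imp_le)
  finally have "(\<integral>\<^sup>+x. ennreal (?v x) \<partial>\<pi>) + ennreal \<eta> * (\<integral>\<^sup>+x. ennreal (?f x) \<partial>\<pi>)
      = (\<integral>\<^sup>+x. nn_act h ?v x \<partial>\<pi>) + (\<integral>\<^sup>+x. ennreal (\<eta> * ?f x) \<partial>\<pi>)"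
    using nn_integral_bind_P[OF \<pi> h_nonneg, of "\<lambda>x. ennreal (?v x)"] by (simp add: invariant)
  also have "\<dots> = (\<integral>\<^sup>+x. nn_act h ?v x + ennreal (\<eta> * ?f x) \<partial>\<pi>)"
    by (rule nn_integral_add[symmetric]) measurable
  also have "\<dots> \<le> (\<integral>\<^sup>+x. ennreal (?v x) + ennreal drift_excess \<partial>\<pi>)"
    by (intro nn_integral_mono nn_act_min_v_le)
  also have "\<dots> = (\<integral>\<^sup>+x. ennreal (?v x) \<partial>\<pi>) + ennreal drift_excess"
    by (subst nn_integral_add) auto
  finally have "ennreal \<eta> * (\<integral>\<^sup>+x. ennreal (?f x) \<partial>\<pi>) \<le> ennreal drift_excess"
    using finite by (simp add: ennreal_add_left_cancel_le)
  also have "ennreal drift_excess = ennreal \<eta> * ennreal (drift_excess / \<eta>)"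
    using \<eta>_pos drift_excess_pos by (simp flip: ennreal_mult)
  finally show ?thesis
    using \<eta>_pos by (simp add: ennreal_mult_le_mult_iff)
qed

lemma moment_le_invariant:
  assumes \<pi>: "borel_prob_space \<pi>" and invariant: "\<pi> \<bind> P h = \<pi>"
  shows "moment_le (drift_excess / \<eta>) \<pi>"
proof -
  interpret borel_prob_space \<pi>
    by (rule \<pi>)
  define F where "F i x = ennreal (\<phi> (v x) * indicator {x. v x \<le> real i} x)" for i x
  have "(\<lambda>i. F i x) \<longlonglongrightarrow> ennreal (\<phi> (v x))" for x
  proof (rule tendsto_eventually, use eventually_ge_at_top[of "nat \<lceil>v x\<rceil>"] in eventually_elim)
    fix i assume "nat \<lceil>v x\<rceil> \<le> i"
    then have "v x \<le> real i"
      by linarith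
    then show "F i x = ennreal (\<phi> (v x))"
      by (simp add: F_def)
  qed
  then have "(\<integral>\<^sup>+x. ennreal (\<phi> (v x)) \<partial>\<pi>) = (\<integral>\<^sup>+x. liminf (\<lambda>i. F i x) \<partial>\<pi>)"
    by (intro nn_integral_cong lim_imp_Liminf[symmetric]) simp_all
  also have "\<dots> \<le> liminf (\<lambda>i. \<integral>\<^sup>+x. F i x \<partial>\<pi>)"
    unfolding F_def by (rule nn_integral_liminf) measurable
  also have "\<dots> \<le> limsup (\<lambda>i. \<integral>\<^sup>+x. F i x \<partial>\<pi>)"
    by (rule Liminf_le_Limsup) simp
  also have "\<dots> \<le> ennreal (drift_excess / \<eta>)"
    unfolding F_def
    by (intro Limsup_bounded always_eventually allI truncated_moment_le_invariant assms)
  finally show ?thesis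
    using \<pi> \<eta>_pos drift_excess_pos by (simp add: moment_le_def)
qed

lemma bind_P_skeleton:
  assumes "borel_prob_space \<pi>" "\<pi> \<bind> P h = \<pi>"
  shows "\<pi> \<bind> P (real n * h) = \<pi>"
proof (induction n)
  case 0
  have "P 0 = return borel"
    using P_0 by auto
  then show ?case
    using assms(1) by (simp add: bind_return'' borel_prob_space.sets_eq_borel)
next
  case (Suc n)
  have "\<pi> \<bind> P (real (Suc n) * h) = (\<pi> \<bind> P (real n * h)) \<bind> P h"
    by (simp add: bind_P_add[OF assms(1) time_nonneg h_nonneg] distrib_right add.commute)
  then show ?case
    by (simp add: Suc assms)
qed

lemma integral_act_invariant:
  assumes "borel_prob_space \<pi>" "\<pi> \<bind> P h = \<pi>" and bLip: "bLip f"
  shows "(\<integral>x. act (real n * h) f x \<partial>\<pi>) = (\<integral>x. f x \<partial>\<pi>)"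
  using integral_bind_P[OF assms(1) time_nonneg bLip_measurable[OF bLip] bLip_abs_le[OF bLip], of n]
  by (simp add: bind_P_skeleton[OF assms(1,2)])

lemma invariant_unique:
  assumes \<pi>_invariant: "borel_prob_space \<pi>" "\<pi> \<bind> P h = \<pi>"
    and \<pi>'_invariant: "borel_prob_space \<pi>'" "\<pi>' \<bind> P h = \<pi>'"
  shows "\<pi> = \<pi>'"
proof (rule measure_eqI_bLip[OF \<pi>_invariant(1) \<pi>'_invariant(1)])
  fix f :: "'a \<Rightarrow> real"
  assume bLip: "bLip f"
  let ?B = "drift_excess / \<eta>"
  obtain C c where contracts: "contracts_laws (1 / 2) C c"
    by (rule exists_contracts_laws[of "1 / 2"]) simp_all
  note c = contracts_lawsD(2)[OF contracts] and contraction = contracts_lawsD(3)[OF contracts]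
  have "\<bar>(\<integral>x. f x \<partial>\<pi>) - (\<integral>x. f x \<partial>\<pi>')\<bar> \<le> C * ((?B + ?B) / \<phi> (H_inv (c * real n))) powr (1 / 2)"
    for n
    using contraction[OF bLip
        moment_le_invariant[OF \<pi>_invariant] moment_le_invariant[OF \<pi>'_invariant], of n]
    by (simp add: integral_act_invariant[OF \<pi>_invariant bLip] integral_act_invariant[OF \<pi>'_invariant
        bLip])
  moreover have "(\<lambda>n. C * ((?B + ?B) / \<phi> (H_inv (c * real n))) powr (1 / 2)) \<longlonglongrightarrow> 0"
    using drift_excess_pos \<eta>_pos by (intro contraction_rate_tendsto_0 c) auto
  ultimately have "\<bar>(\<integral>x. f x \<partial>\<pi>) - (\<integral>x. f x \<partial>\<pi>')\<bar> \<le> 0"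
    by (intro LIMSEQ_le_const) auto
  then show "(\<integral>x. f x \<partial>\<pi>) = (\<integral>x. f x \<partial>\<pi>')"
    by simp
qed

lemma exists_times_with_bounded_moment_increments:
  assumes "rate \<longlonglongrightarrow> (0::real)"
  obtains t :: "nat \<Rightarrow> nat" where "\<And>i. rate (t i) \<le> (1 / 2) ^ i" "\<And>i. t i < t (Suc i)"
    "\<And>i. moment_le ((drift_excess + 1) / \<eta>) (P (real (t (Suc i) - t i) * h) x)"
proof -
  let ?good = "\<lambda>j. moment_le ((drift_excess + 1) / \<eta>) (P (real j * h) x)"
  have small: "\<exists>n0. \<forall>n\<ge>n0. rate n \<le> (1 / 2) ^ i" for i
    using order_tendstoD(2)[OF assms, of "(1 / 2) ^ i"] by (force simp: eventually_sequentially)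
  have "\<exists>t. \<forall>i. rate (t i) \<le> (1 / 2) ^ i \<and> (t i < t (Suc i) \<and> ?good (t (Suc i) - t i))"
  proof (rule dependent_nat_choice)
    show "\<exists>n. rate n \<le> (1 / 2) ^ 0"
      using small[of 0] by blast
    fix n i :: nat
    obtain n0 where small_from_n0: "\<And>n. n0 \<le> n \<Longrightarrow> rate n \<le> (1 / 2) ^ Suc i"
      using small[of "Suc i"] by blast
    obtain j where "max n0 1 \<le> j" "?good j"
      using frequently_moment_le[of "max n0 1" x] by auto
    then show "\<exists>n'. rate n' \<le> (1 / 2) ^ Suc i \<and> (n < n' \<and> ?good (n' - n))"
      using small_from_n0[of "n + j"] by (intro exI[of _ "n + j"]) auto
  qed
  then show thesis
    using that by blast
qed

text \<open>Consecutive times differ by a time at which the moment is bounded, so that the contraction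
  makes the laws of the skeleton chain at these times a Cauchy sequence.\<close>

lemma exists_convergent_times:
  obtains \<pi> t where "borel_prob_space \<pi>" "strict_mono (t :: nat \<Rightarrow> nat)"
    "\<And>g::'a \<Rightarrow> real. continuous_on UNIV g \<Longrightarrow> bounded (range g) \<Longrightarrow>
      (\<lambda>i. act (real (t i) * h) g x) \<longlonglongrightarrow> (\<integral>z. g z \<partial>\<pi>)"
proof -
  obtain C c where contracts: "contracts_laws (1 / 2) C c"
    by (rule exists_contracts_laws[of "1 / 2"]) simp_all
  note c = contracts_lawsD(2)[OF contracts] and contraction = contracts_lawsD(3)[OF contracts]
  define B where "B = (drift_excess + 1) / \<eta>"
  define rate where "rate n = C * ((\<phi> (v x) + B) / \<phi> (H_inv (c * real n))) powr (1 / 2)" for n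
  have rate_tendsto_0: "rate \<longlonglongrightarrow> 0"
    unfolding rate_def using drift_excess_pos \<eta>_pos phi_v_pos[of x]
    by (intro contraction_rate_tendsto_0 c) (auto simp: B_def less_imp_le)
  obtain t where times: "\<And>i. rate (t i) \<le> (1 / 2) ^ i" "\<And>i. t i < t (Suc i)"
    and moment: "\<And>i. moment_le B (P (real (t (Suc i) - t i) * h) x)"
    unfolding B_def
    by (rule exists_times_with_bounded_moment_increments[where x=x, OF rate_tendsto_0])
      (rule that[unfolded B_def])
  have "act (real (t i) * h) f x - act (real (t (Suc i)) * h) f x \<le> (1 / 2) ^ i"
    if bLip: "bLip f" for i f
  proof -
    have "real (t (Suc i)) * h = real (t (Suc i) - t i) * h + real (t i) * h"
      using times(2)[of i] by (simp add: of_nat_diff flip: distrib_right)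
    then have "act (real (t (Suc i)) * h) f x
        = (\<integral>y. act (real (t i) * h) f y \<partial>P (real (t (Suc i) - t i) * h) x)"
      by (simp only: act_add[OF time_nonneg time_nonneg bLip_measurable[OF bLip]
          bLip_abs_le[OF bLip]])
    moreover have "act (real (t i) * h) f x = (\<integral>y. act (real (t i) * h) f y \<partial>P 0 x)"
      by (intro act_0[symmetric] act_measurable time_nonneg bLip_measurable bLip)
    ultimately have "\<bar>act (real (t i) * h) f x - act (real (t (Suc i)) * h) f x\<bar> \<le> rate (t i)"
      using contraction[OF bLip moment_le_P_0 moment] by (simp add: rate_def)
    then show ?thesis
      using times(1)[of i] by linarith
  qed
  then have "\<exists>\<pi>. borel_prob_space \<pi> \<and> (\<forall>g::'a \<Rightarrow> real. continuous_on UNIV g \<longrightarrow> bounded (range g) \<longrightarrow>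
      (\<lambda>i. act (real (t i) * h) g x) \<longlonglongrightarrow> (\<integral>z. g z \<partial>\<pi>))"
    by (intro weak_limit_if_summable_dual_distance[where b="\<lambda>i. (1 / 2) ^ i"] borel_prob_space_P
        time_nonneg)
      (auto intro: summable_geometric)
  then show thesis
    using that times(2) by (auto simp: strict_mono_Suc_iff)
qed

lemma asymptotically_invariant:
  assumes bLip: "bLip f"
  shows "(\<lambda>n. act (real n * h) (act h f) x - act (real n * h) f x) \<longlonglongrightarrow> 0"
proof -
  note meas = bLip_measurable[OF bLip] and bound = bLip_abs_le[OF bLip]
  obtain C c where contracts: "contracts_laws (1 / 2) C c"
    by (rule exists_contracts_laws[of "1 / 2"]) simp_all
  let ?rate = "\<lambda>n. C * ((lin * (v x + k) + \<phi> (v x)) / \<phi> (H_inv (c * real n))) powr (1 / 2)"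
  have rate: "?rate \<longlonglongrightarrow> 0"
    using lin_pos v_nonneg[of x] k_pos phi_v_pos[of x]
    by (intro contraction_rate_tendsto_0 contracts_lawsD(2)[OF contracts]) (auto simp: less_imp_le)
  have "act (real n * h) (act h f) x = (\<integral>y. act (real n * h) f y \<partial>P h x)" for n
    using act_add[OF h_nonneg time_nonneg meas bound, of n x]
      act_add[OF time_nonneg h_nonneg meas bound, of n x] by (simp add: add.commute)
  moreover have "act (real n * h) f x = (\<integral>y. act (real n * h) f y \<partial>P 0 x)" for n
    by (intro act_0[symmetric] act_measurable time_nonneg meas)
  ultimately have "norm (act (real n * h) (act h f) x - act (real n * h) f x) \<le> ?rate n" for n
    using contracts_lawsD(3)[OF contracts bLip moment_le_P_h moment_le_P_0] by simp
  then show ?thesis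
    by (intro Lim_null_comparison[OF _ rate] always_eventually) simp
qed

theorem invariant_exists:
  assumes feller: "feller P"
  obtains \<pi> where "borel_prob_space \<pi>" "\<pi> \<bind> P h = \<pi>"
proof -
  fix x :: 'a
  obtain \<pi> t where \<pi>: "borel_prob_space \<pi>" and t_mono: "strict_mono (t :: nat \<Rightarrow> nat)" and lim:
    "\<And>g::'a \<Rightarrow> real. continuous_on UNIV g \<Longrightarrow> bounded (range g) \<Longrightarrow>
      (\<lambda>i. act (real (t i) * h) g x) \<longlonglongrightarrow> (\<integral>z. g z \<partial>\<pi>)"
    using exists_convergent_times[of x thesis] by blast
  have "\<pi> \<bind> P h = \<pi>"
  proof (rule measure_eqI_bLip[OF borel_prob_space_bind_P[OF \<pi> h_nonneg] \<pi>])
    fix f :: "'a \<Rightarrow> real"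
    assume bLip: "bLip f"
    have cont: "continuous_on UNIV f" "bounded (range f)"
      by (rule bLip_continuous[OF bLip], rule bLip_bounded[OF bLip])
    then have act_cont: "continuous_on UNIV (act h f)" "bounded (range (act h f))"
      using feller h_nonneg by (auto simp: feller_def)
    have "(\<lambda>i. act (real (t i) * h) (act h f) x - act (real (t i) * h) f x) \<longlonglongrightarrow> 0"
      by (rule filterlim_compose[OF asymptotically_invariant[OF bLip] filterlim_subseq[OF t_mono]])
    moreover have "(\<lambda>i. act (real (t i) * h) (act h f) x - act (real (t i) * h) f x)
        \<longlonglongrightarrow> (\<integral>z. act h f z \<partial>\<pi>) - (\<integral>z. f z \<partial>\<pi>)"
      by (intro tendsto_diff lim cont act_cont)
    ultimately have "(\<integral>z. act h f z \<partial>\<pi>) - (\<integral>z. f z \<partial>\<pi>) = 0"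
      using LIMSEQ_unique by blast
    then show "(\<integral>z. f z \<partial>(\<pi> \<bind> P h)) = (\<integral>z. f z \<partial>\<pi>)"
      by (simp add: integral_bind_P[OF \<pi> h_nonneg bLip_measurable[OF bLip] bLip_abs_le[OF bLip]])
  qed
  with \<pi> show thesis
    by (rule that)
qed

end

section \<open>Convergence in continuous time\<close>

lemma (in markov_semigroup) invariant_prob_iff_bind:
  "invariant_prob P \<pi> \<longleftrightarrow> borel_prob_space \<pi> \<and> (\<forall>t\<ge>0. \<pi> \<bind> P t = \<pi>)"
proof (cases "borel_prob_space \<pi>")
  case True
  have "\<pi> \<bind> P t = \<pi> \<longleftrightarrow> (\<forall>A\<in>sets borel. (\<integral>\<^sup>+x. emeasure (P t x) A \<partial>\<pi>) = emeasure \<pi> A)"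
    if "0 \<le> t" for t
    using emeasure_bind_P[OF True that] True borel_prob_space_bind_P[OF True that]
    by (auto intro!: measure_eqI simp: borel_prob_space.sets_eq_borel)
  then show ?thesis
    using True by (simp add: invariant_prob_def borel_prob_space_iff)
qed (auto simp: invariant_prob_def borel_prob_space_iff)

lemma (in subgeometric_chain) invariant_prob_iff_skeleton:
  "invariant_prob P \<pi> \<longleftrightarrow> borel_prob_space \<pi> \<and> \<pi> \<bind> P h = \<pi>"
proof -
  have "\<pi> \<bind> P t = \<pi>" if \<pi>_invariant: "borel_prob_space \<pi>" "\<pi> \<bind> P h = \<pi>" and t_nonneg: "0 \<le> t" for t
  proof (rule invariant_unique[OF borel_prob_space_bind_P[OF \<pi>_invariant(1) t_nonneg] _ \<pi>_invariant])
    have "(\<pi> \<bind> P t) \<bind> P h = (\<pi> \<bind> P h) \<bind> P t"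
      using \<pi>_invariant(1) t_nonneg h_nonneg by (simp add: bind_P_add add.commute)
    then show "(\<pi> \<bind> P t) \<bind> P h = \<pi> \<bind> P t"
      by (simp add: \<pi>_invariant)
  qed
  then show ?thesis
    using h_nonneg by (auto simp: invariant_prob_iff_bind)
qed

lemma (in concave_rate) one_le_rate_bound:
  assumes "0 \<le> t" "t \<le> h" "0 < c" "0 < \<delta>" "0 \<le> z" and D_ge: "\<phi> (H_inv (c * h)) powr \<delta> \<le> D"
  shows "1 \<le> D * (1 + z) / \<phi> (H_inv (c * t)) powr \<delta>"
proof -
  have rate_pos: "0 < \<phi> (H_inv (c * t))"
    using assms by (intro phi_H_inv_pos) simp
  have "\<phi> (H_inv (c * t)) powr \<delta> \<le> \<phi> (H_inv (c * h)) powr \<delta>"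
    using assms rate_pos by (intro powr_mono2 phi_H_inv_mono) auto
  also note D_ge
  also have "D \<le> D * (1 + z)"
    using order_trans[OF powr_ge_zero D_ge] assms by (simp add: distrib_left)
  finally show ?thesis
    using rate_pos by simp
qed

lemma affine_powr_le:
  fixes a b z \<delta> :: real
  assumes "0 \<le> a" "0 \<le> b" "0 \<le> z" "0 < \<delta>"
  shows "(a + b * z) powr \<delta> \<le> (a + b) powr \<delta> * (1 + z powr \<delta>)"
proof -
  have "a * 1 + b * z \<le> a * max 1 z + b * max 1 z"
    using assms by (intro add_mono mult_left_mono) auto
  then have "(a + b * z) powr \<delta> \<le> ((a + b) * max 1 z) powr \<delta>"
    using assms by (intro powr_mono2) (auto simp: distrib_right)
  also have "\<dots> = (a + b) powr \<delta> * max 1 z powr \<delta>"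
    using assms by (simp add: powr_mult)
  also have "\<dots> \<le> (a + b) powr \<delta> * (1 + z powr \<delta>)"
    by (intro mult_left_mono) (auto simp: max_def)
  finally show ?thesis .
qed

locale lyapunov_chain = lyapunov_semigroup P \<phi> V K + subgeometric_chain P \<phi> \<theta> N T h M k \<eta> \<kappa> v
  for P :: "real \<Rightarrow> 'a::polish_space \<Rightarrow> 'a measure" and \<phi> V K \<theta> N T h M k \<eta> \<kappa> v +
  fixes a0 a1 :: real
  assumes a0_pos: "0 < a0" and a1_nonneg: "0 \<le> a1" and phi_v_le: "\<And>x. \<phi> (v x) \<le> a0 + a1 * \<phi> (V x)"
begin

lemma moment_le_P:
  assumes s_bounds: "0 \<le> s" "s \<le> h"
  shows "moment_le (a0 + a1 * (\<phi> (V x) + lin * K * h)) (P s x)"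
  unfolding moment_le_def
proof (intro conjI borel_prob_space_P s_bounds)
  have nonneg: "0 \<le> \<phi> (V x) + lin * K * t" if "0 \<le> t" for t
    using that lin_pos K_pos phi_V_nonneg[of x] by simp
  show "0 < a0 + a1 * (\<phi> (V x) + lin * K * h)"
    using a0_pos a1_nonneg nonneg[OF h_nonneg] by (simp add: add_pos_nonneg)
  have "nn_act s (\<lambda>y. \<phi> (v y)) x \<le> ennreal (a0 + a1 * (\<phi> (V x) + lin * K * s))"
    using phi_v_pos
    by (intro nn_act_le_affine[OF s_bounds(1) phi_V_measurable phi_V_nonneg
        nn_act_phi_V_le[OF s_bounds(1)]] nonneg s_bounds phi_v_le a1_nonneg)
      (simp add: less_imp_le)
  also have "\<dots> \<le> ennreal (a0 + a1 * (\<phi> (V x) + lin * K * h))"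
    using s_bounds a1_nonneg lin_pos K_pos by (intro ennreal_leI add_left_mono mult_left_mono) auto
  finally show "nn_act s (\<lambda>y. \<phi> (v y)) x \<le> ennreal (a0 + a1 * (\<phi> (V x) + lin * K * h))" .
qed

lemma time_decomposition:
  assumes "h \<le> t"
  obtains n s where "t = s + real n * h" "0 \<le> s" "s \<le> h" "t \<le> 2 * h * real n"
proof
  let ?n = "nat \<lfloor>t / h\<rfloor>"
  have "1 \<le> t / h"
    using assms h_pos by simp
  then have n_bounds: "1 \<le> real ?n" "real ?n \<le> t / h" "t / h \<le> real ?n + 1"
    by auto
  then show "0 \<le> t - real ?n * h" "t - real ?n * h \<le> h"
    using h_pos by (auto simp: field_simps)
  have "t / h \<le> 2 * real ?n"
    using n_bounds by linarith
  then show "t \<le> 2 * h * real ?n"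
    using h_pos by (simp add: field_simps)
qed simp

lemma abs_act_diff_invariant_le:
  assumes contracts: "contracts_laws \<delta> C c" and \<delta>_pos: "0 < \<delta>"
    and \<pi>_invariant: "borel_prob_space \<pi>" "\<pi> \<bind> P h = \<pi>" and bLip: "bLip f" and h_le_t: "h \<le> t"
  shows "\<bar>act t f x - (\<integral>z. f z \<partial>\<pi>)\<bar>
    \<le> C * ((a0 + a1 * (\<phi> (V x) + lin * K * h) + drift_excess / \<eta>) / \<phi> (H_inv (c / (2 * h) * t))) powr \<delta>"
proof -
  note c = contracts_lawsD(2)[OF contracts]
  obtain n s where decomposition: "t = s + real n * h" "0 \<le> s" "s \<le> h"
    and t_le: "t \<le> 2 * h * real n"
    by (rule time_decomposition[OF h_le_t])
  define m where "m = a0 + a1 * (\<phi> (V x) + lin * K * h)"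
  have moments: "moment_le m (P s x)" "moment_le (drift_excess / \<eta>) \<pi>"
    using moment_le_P[OF decomposition(2,3)] moment_le_invariant[OF \<pi>_invariant]
    by (auto simp: m_def)
  have "\<bar>act t f x - (\<integral>z. f z \<partial>\<pi>)\<bar>
      = \<bar>(\<integral>y. act (real n * h) f y \<partial>P s x) - (\<integral>y. act (real n * h) f y \<partial>\<pi>)\<bar>"
    using act_add[OF decomposition(2) time_nonneg bLip_measurable[OF bLip] bLip_abs_le[OF bLip]]
    by (simp add: decomposition(1) integral_act_invariant[OF \<pi>_invariant bLip])
  also have "\<dots> \<le> C * ((m + drift_excess / \<eta>) / \<phi> (H_inv (c * real n))) powr \<delta>"
    by (rule contracts_lawsD(3)[OF contracts bLip moments])
  also have "\<dots> \<le> C * ((m + drift_excess / \<eta>) / \<phi> (H_inv (c / (2 * h) * t))) powr \<delta>"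
  proof -
    have t_nonneg: "0 \<le> c / (2 * h) * t"
      using c h_pos h_le_t by simp
    have "c / (2 * h) * t \<le> c / (2 * h) * (2 * h * real n)"
      using t_le c h_pos by (intro mult_left_mono) auto
    then have "c / (2 * h) * t \<le> c * real n"
      using h_pos by simp
    then have "\<phi> (H_inv (c / (2 * h) * t)) \<le> \<phi> (H_inv (c * real n))"
      by (rule phi_H_inv_mono[OF t_nonneg])
    moreover have "0 < \<phi> (H_inv (c / (2 * h) * t))"
      by (rule phi_H_inv_pos[OF t_nonneg])
    moreover have "0 \<le> m + drift_excess / \<eta>"
      using moments by (simp add: moment_le_def)
    ultimately show ?thesis
      using contracts_lawsD(1)[OF contracts] \<delta>_pos
      by (intro mult_left_mono powr_mono2 divide_left_mono) auto
  qed
  finally show ?thesis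
    by (simp add: m_def)
qed

definition rate_const :: real where
  "rate_const = a0 + a1 * (lin * K * h) + drift_excess / \<eta>"

lemma rate_const_pos: "0 < rate_const"
  unfolding rate_const_def
  using a0_pos a1_nonneg lin_pos K_pos h_pos drift_excess_pos \<eta>_pos by (intro add_pos_nonneg) auto

lemma act_diff_invariant_le:
  assumes contracts: "contracts_laws \<delta> C c" and \<delta>_pos: "0 < \<delta>"
    and \<pi>_invariant: "borel_prob_space \<pi>" "\<pi> \<bind> P h = \<pi>" and bLip: "bLip f" and "h \<le> t"
  shows "act t f x - (\<integral>z. f z \<partial>\<pi>)
    \<le> C * (rate_const + a1) powr \<delta> * (1 + \<phi> (V x) powr \<delta>) / \<phi> (H_inv (c / (2 * h) * t)) powr \<delta>"
proof -
  note C_pos = contracts_lawsD(1)[OF contracts] and c_pos = contracts_lawsD(2)[OF contracts]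
  define \<rho> where "\<rho> = \<phi> (H_inv (c / (2 * h) * t))"
  have \<rho>_pos: "0 < \<rho>"
    unfolding \<rho>_def using c_pos h_pos \<open>h \<le> t\<close> by (intro phi_H_inv_pos) simp
  have "\<bar>act t f x - (\<integral>z. f z \<partial>\<pi>)\<bar> \<le> C * ((rate_const + a1 * \<phi> (V x)) / \<rho>) powr \<delta>"
    using abs_act_diff_invariant_le[OF contracts \<delta>_pos \<pi>_invariant bLip \<open>h \<le> t\<close>, of x]
    by (simp add: rate_const_def \<rho>_def algebra_simps)
  also have "\<dots> = C * (rate_const + a1 * \<phi> (V x)) powr \<delta> / \<rho> powr \<delta>"
    using \<rho>_pos rate_const_pos a1_nonneg phi_V_nonneg[of x] by (simp add: powr_divide)
  also have "\<dots> \<le> C * ((rate_const + a1) powr \<delta> * (1 + \<phi> (V x) powr \<delta>)) / \<rho> powr \<delta>"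
    using C_pos rate_const_pos a1_nonneg \<delta>_pos phi_V_nonneg
    by (intro divide_right_mono mult_left_mono affine_powr_le) auto
  finally show ?thesis
    by (simp add: \<rho>_def mult.assoc)
qed

theorem wasserstein_rate:
  assumes "invariant_prob P \<pi>" and \<delta>_bounds: "0 < \<delta>" "\<delta> < 1"
  shows "\<exists>C1>0. \<exists>C2>0. \<forall>x. \<forall>t\<ge>0. wasserstein bdist (P t x) \<pi>
    \<le> ennreal (C1 * (1 + \<phi> (V x) powr \<delta>) / \<phi> (H_inv (C2 * t)) powr \<delta>)"
proof -
  have \<pi>_invariant: "borel_prob_space \<pi>" "\<pi> \<bind> P h = \<pi>"
    using assms by (auto simp: invariant_prob_iff_skeleton)
  obtain C c where contracts: "contracts_laws \<delta> C c"
    by (rule exists_contracts_laws[OF \<delta>_bounds])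
  define C2 where "C2 = c / (2 * h)"
  define C1 where "C1 = max (C * (rate_const + a1) powr \<delta>) (\<phi> (H_inv (C2 * h)) powr \<delta>)"
  have C2_pos: "0 < C2"
    using contracts_lawsD(2)[OF contracts] h_pos by (simp add: C2_def)
  then have "0 < \<phi> (H_inv (C2 * h))"
    using h_nonneg by (intro phi_H_inv_pos) simp
  then have C1_pos: "0 < C1"
    by (simp add: C1_def less_max_iff_disj)
  have "wasserstein bdist (P t x) \<pi>
      \<le> ennreal (C1 * (1 + \<phi> (V x) powr \<delta>) / \<phi> (H_inv (C2 * t)) powr \<delta>)"
    if t_nonneg: "0 \<le> t" for x t
  proof (rule wasserstein_le_dual[OF borel_prob_space_P[OF t_nonneg] \<pi>_invariant(1)])
    fix f :: "'a \<Rightarrow> real"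
    assume bLip: "bLip f"
    show "act t f x - (\<integral>z. f z \<partial>\<pi>) \<le> C1 * (1 + \<phi> (V x) powr \<delta>) / \<phi> (H_inv (C2 * t)) powr \<delta>"
    proof (cases "t < h")
      case True
      then have "1 \<le> C1 * (1 + \<phi> (V x) powr \<delta>) / \<phi> (H_inv (C2 * t)) powr \<delta>"
        using t_nonneg C2_pos \<delta>_bounds
        by (intro one_le_rate_bound[where h=h]) (auto simp: C1_def)
      then show ?thesis
        using abs_integral_bLip_diff_le_1[OF borel_prob_space_P[OF t_nonneg] \<pi>_invariant(1) bLip, of x]
        by linarith
    next
      case False
      then have "act t f x - (\<integral>z. f z \<partial>\<pi>)
          \<le> C * (rate_const + a1) powr \<delta> * (1 + \<phi> (V x) powr \<delta>) / \<phi> (H_inv (C2 * t)) powr \<delta>"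
        unfolding C2_def
        by (intro act_diff_invariant_le[OF contracts \<delta>_bounds(1) \<pi>_invariant bLip]) simp
      also have "\<dots> \<le> C1 * (1 + \<phi> (V x) powr \<delta>) / \<phi> (H_inv (C2 * t)) powr \<delta>"
        by (intro divide_right_mono mult_right_mono) (auto simp: C1_def)
      finally show ?thesis .
    qed
  qed
  with C1_pos C2_pos show ?thesis
    by blast
qed

end

lemma (in lyapunov_semigroup) exists_lyapunov_chain:
  assumes assumption_A: "assumption_A TYPE('w) P \<theta> r L"
    and \<theta>_ge: "premetric \<theta>" "\<And>x y. bdist x y \<le> \<theta> x y"
    and t0_pos: "0 < t0" and assumption_B1: "\<And>M. 0 < M \<Longrightarrow> assumption_B1 P \<theta> {x. V x \<le> M} t0"
  obtains N T h M k \<eta> \<kappa> v a0 a1 where "lyapunov_chain P \<phi> V K \<theta> N T h M k \<eta> \<kappa> v a0 a1"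
proof -
  obtain N T where N_ge_1: "1 \<le> N" and T_nonneg: "0 \<le> T"
    and local: "\<And>x y. x \<noteq> y \<Longrightarrow> contracts T (trunc N \<theta>) (t0 + T) x y (trunc (N / 2) \<theta> x y)"
    and small: "\<And>S. assumption_B1 P \<theta> S t0 \<Longrightarrow>
      \<exists>\<kappa>. 0 < \<kappa> \<and> \<kappa> < 1 \<and> (\<forall>x\<in>S. \<forall>y\<in>S. contracts T (trunc N \<theta>) (t0 + T) x y (1 - \<kappa>))"
    using local_and_small_set_contraction[OF assumption_A \<theta>_ge(1), of t0] t0_pos
    by (metis less_imp_le)
  define h where "h = t0 + T"
  have h_pos: "0 < h"
    using t0_pos T_nonneg by (simp add: h_def)
  obtain A M \<eta> where A_ge_1: "1 \<le> A" and M_pos: "0 < M" and \<eta>_pos: "0 < \<eta>"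
    and const_le: "\<And>x. drift_const h \<le> \<eta> / 4 * \<phi> (shifted A h x)"
    and drift: "\<And>x. M \<le> shifted A h x \<Longrightarrow> \<eta> * \<phi> (shifted A h x) \<le> shifted A h x"
      "\<And>x. M \<le> shifted A h x \<Longrightarrow>
        nn_act h (shifted A h) x \<le> ennreal (shifted A h x - \<eta> * \<phi> (shifted A h x))"
    using exists_shifted_drift[OF h_pos] by metis
  obtain \<kappa> where \<kappa>_bounds: "0 < \<kappa>" "\<kappa> < 1"
    and contr: "\<And>x y. V x \<le> M \<Longrightarrow> V y \<le> M \<Longrightarrow> contracts T (trunc N \<theta>) h x y (1 - \<kappa>)"
    using small[OF assumption_B1[OF M_pos]] by (auto simp: h_def)
  have V_le: "V x \<le> shifted A h x" and A_le: "A \<le> shifted A h x" for x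
    using shifted_ge[of h A x] h_pos A_ge_1 V_nonneg[of x] by auto
  have "lyapunov_chain P \<phi> V K \<theta> N T h M (drift_const h) \<eta> \<kappa> (shifted A h) (\<phi> A) (1 + h * lin)"
  proof unfold_locales
    show "contracts T (trunc N \<theta>) h x y (trunc (N / 2) \<theta> x y)" if "x \<noteq> y" for x y
      using local[OF that] by (simp add: h_def)
    show "contracts T (trunc N \<theta>) h x y (1 - \<kappa>)" if "shifted A h x \<le> M" "shifted A h y \<le> M" for x y
      using that V_le[of x] V_le[of y] by (intro contr) auto
    show "1 \<le> shifted A h x" for x
      using A_ge_1 A_le[of x] by linarith
    show "nn_act h (shifted A h) x \<le> ennreal (shifted A h x + drift_const h)" for x
      using h_pos A_ge_1 shifted_ge[of h A x]
      by (intro order_trans[OF nn_act_shifted_le] ennreal_leI) auto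
  qed (use h_pos N_ge_1 T_nonneg \<theta>_ge \<kappa>_bounds \<eta>_pos A_ge_1 const_le drift drift_const_pos[OF h_pos]
      phi_shifted_le nn_act_shifted_finite lin_pos phi_pos in \<open>simp_all add: less_imp_le\<close>)
  then show thesis
    by (rule that)
qed

theorem theorem2p7:
  fixes P :: "real \<Rightarrow> 'a::polish_space \<Rightarrow> 'a measure"
    and V :: "'a \<Rightarrow> real" and \<phi> :: "real \<Rightarrow> real" and K :: real
    and \<theta> :: "'a \<Rightarrow> 'a \<Rightarrow> real" and r L :: "real \<Rightarrow> real" and t0 :: real
  assumes markov: "markov_tf P"
    and feller: "feller P"
    and V_meas: "V \<in> borel_measurable borel" and V_nonneg: "\<forall>x. V x \<ge> 0"
    and phi_concave: "concave_on {0..} \<phi>"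
    and phi_diff: "\<forall>s\<ge>0. \<phi> differentiable (at s within {0..})"
    and phi_nonneg: "\<forall>s\<ge>0. \<phi> s \<ge> 0"
    and phi_mono: "mono_on {0..} \<phi>"
    and phi_infty: "filterlim \<phi> at_top at_top"
    and phi_0: "\<phi> 0 = 0"
    and K_pos: "K > 0"
    and lyapunov: "\<forall>t\<ge>0. \<forall>x.
        (\<integral>\<^sup>+ y. ennreal (V y) \<partial>P t x)
          + (\<integral>\<^sup>+ s\<in>{0..t}. (\<integral>\<^sup>+ y. ennreal (\<phi> (V y)) \<partial>P s x) \<partial>lborel)
        \<le> ennreal (V x + K * t)"
    and theta_premetric: "premetric \<theta>"
    and theta_ge: "\<forall>x y. min (dist x y) 1 \<le> \<theta> x y"
    and assmA: "assumption_A TYPE('w) P \<theta> r L"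
    and t0_pos: "t0 > 0"
    and assmB1: "\<forall>M>0. assumption_B1 P \<theta> {x. V x \<le> M} t0"
  shows "\<exists>\<pi>. invariant_prob P \<pi> \<and> (\<forall>\<pi>'. invariant_prob P \<pi>' \<longrightarrow> \<pi>' = \<pi>) \<and>
     (\<forall>\<delta>. 0 < \<delta> \<and> \<delta> < 1 \<longrightarrow> (\<exists>C1>0. \<exists>C2>0. \<forall>x. \<forall>t\<ge>0.
        wasserstein (\<lambda>x y. min (dist x y) 1) (P t x) \<pi>
          \<le> ennreal (C1 * (1 + \<phi> (V x) powr \<delta>) / \<phi> (H_phi_inv \<phi> (C2 * t)) powr \<delta>)))"
proof -
  interpret lyapunov_semigroup P \<phi> V K
    using assms by unfold_locales auto
  obtain N T h M k \<eta> \<kappa> v a0 a1 where "lyapunov_chain P \<phi> V K \<theta> N T h M k \<eta> \<kappa> v a0 a1"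
    by (rule exists_lyapunov_chain[OF assmA theta_premetric _ t0_pos])
      (use theta_ge assmB1 in \<open>auto simp: bdist_def\<close>)
  then interpret lyapunov_chain P \<phi> V K \<theta> N T h M k \<eta> \<kappa> v a0 a1 .
  obtain \<pi> where \<pi>: "borel_prob_space \<pi>" "\<pi> \<bind> P h = \<pi>"
    by (rule invariant_exists[OF feller])
  then have invariant: "invariant_prob P \<pi>"
    unfolding invariant_prob_iff_skeleton by blast
  moreover have "\<pi>' = \<pi>" if "invariant_prob P \<pi>'" for \<pi>'
    using that \<pi> unfolding invariant_prob_iff_skeleton by (blast intro: invariant_unique)
  ultimately show ?thesis
    using wasserstein_rate[OF invariant, unfolded bdist_def[abs_def]] by blast
qed

end
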